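(* Let $1\le p<\infty$, let $\mathcal B$ be a $2m\times 2m$ real matrix with distinct eigenvalues listed as $\sigma(\mathcal B)=\{\lambda_1,\dots,\lambda_d,\lambda_{d+1},\dots,\lambda_k\}$, $0\le d\le k$, and let $(G(t))_{t\ge 0}$ be the $C_0$-semigroup on $\mathbf X_p$ generated by $A$ (see context). Assume that $$|\lambda_j|<1,\qquad j=d+1,\dots,k .$$ Then there exists a decomposition $\mathbf X_p=Z^1\oplus Z^2$ into $(G(t))_{t\ge 0}$-invariant subspaces, namely $Z^1=\operatorname{rng}G^1(0)$ and $Z^2=\operatorname{rng}G^2(0)$, such that $G^1(t)=G(t)$ on $Z^1$ for all $t\ge 0$ and $$\lim_{t\to\infty}\bigl(G(t)-G^1(t)\bigr)=0$$ in the uniform operator topology on $\mathbf X_p$. The family $(G^1(t))_{t\ge0}$ is explicitly given, for $\mathbf\Phi=\binom{\upsilon}{\varpi}\in\mathbf X_p$, by $G^1(t)\binom{\upsilon}{\varpi}(x)=\binom{(G^1(t)\mathbf\Phi)^+(x)}{(G^1(t)\mathbf\Phi)^-(x)}$, where $$(G^1(t)\mathbf\Phi)^+(x)=\sum_{j=1}^d\lambda_j^n\Bigl((\mathcal p_j(n)\Pi_j)^{11}\upsilon(n-t+x)+(\mathcal p_j(n)\Pi_j)^{12}\varpi(1-n+t-x)\Bigr)$$ for $n-1+x<t<n+x$, $n\in\mathbb N_0$, and $$(G^1(t)\mathbf\Phi)^-(x)=\sum_{j=1}^d\lambda_j^n\Bigl((\mathcal p_j(n)\Pi_j)^{21}\upsilon(1-t+n-x)+(\mathcal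 p_j(n)\Pi_j)^{22}\varpi(t-n+x)\Bigr)$$ for $n-x<t<n+1-x$, $n\in\mathbb N_0$. If, in addition, $d\ge 1$ and the eigenvalues $\lambda_1,\dots,\lambda_d$ are semisimple and of the form $\lambda_j=e^{2\pi i(j-1)/d}$, $j=1,\dots,d$, then $(G^1(t))_{t\ge0}$ is periodic with period $d$ and $$G^1(t)\binom{\upsilon}{\varpi}(x)=\begin{pmatrix}\sum_{j=1}^d e^{\frac{2\pi i(j-1)n}{d}}\bigl(\Pi_j^{11}\upsilon(n-t+x)+\Pi_j^{12}\varpi(1-n+t-x)\bigr)\\[2mm] \sum_{j=1}^d e^{\frac{2\pi i(j-1)n}{d}}\bigl(\Pi_j^{21}\upsilon(1-t+n-x)+\Pi_j^{22}\varpi(t-n+x)\bigr)\end{pmatrix},$$ where in the first (resp. second) row $n\in\mathbb N_0$ is such that $n-1+x<t<n+x$ (resp. $n-x<t<n+1-x$).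
   Context: Setting. Fix integers $m_+,m_-\ge 0$ with $m_++m_-=2m\ge 1$, and $1\le p<\infty$. $\mathbf X_p=(L^p(0,1))^{2m}$ (complex-valued functions); its elements are written $\binom{\upsilon}{\varpi}$ with $\upsilon$ having $m_+$ components and $\varpi$ having $m_-$ components. On $\mathbf X_p$ consider the norm $\|\mathbf f\|=(\int_0^1\sum_{i=1}^{2m}|f_i(x)|^p\,dx)^{1/p}$. The operator $A$ is $$A\binom{\upsilon}{\varpi}=\binom{-\upsilon'}{\varpi'},\qquad D(A)=\Bigl\{\tbinom{\upsilon}{\varpi}\in (W^{1,p}(0,1))^{2m}:\ \tbinom{\upsilon(0)}{\varpi(1)}=\mathcal B\tbinom{\upsilon(1)}{\varpi(0)}\Bigr\}.$$ It is known that $A$ generates a $C_0$-semigroup $(G(t))_{t\ge0}$ on $\mathbf X_p$ for every matrix $\mathcal B$. Blocks. Any $2m\times 2m$ matrix $M$ is written $M=\begin{pmatrix} M^{11} & M^{12} \\ M^{21} & M^{22} \end{pmatrix}$ with blocks of sizes $m_+\times m_+$, $m_+\times m_-$, $m_-\times m_+$, $m_-\times m_-$. Spectral notation. $\lambda_1,\dots,\lambda_k$ are the distinct eigenvalues of $\mathcal B$, $\alpha_j$ is the algebraic multiplicity of $\lambda_j$, and $\Pi_j$ is the spectral projection of $\mathcal B$ onto the generalized eigenspace of $\lambda_j$ (along the sum of the other generalized eigenspaces). For $n\in\mathbb N_0$ one writes $$\mathcal B^n\Pi_j=\sum_{r=0}^n\binom nr\lambda_j^{n-r}(\mathcal B-\lambda_jI)^r\Pi_j=\lambda_j^n\mathcal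 p_j(n)\Pi_j,$$ where $\mathcal p_j$ is a matrix-valued polynomial in $n$ of degree strictly smaller than $\alpha_j$; if $\lambda_j=0$, the expression $\lambda_j^n\mathcal p_j(n)\Pi_j$ is to be read as $\mathcal B^n\Pi_j$. Let $\mathcal V:\mathbf X_p\to\mathbf X_p$, $\mathcal V\binom{\upsilon}{\varpi}(x)=\binom{\upsilon(x)}{\varpi(1-x)}$. For $t\ge 0$, define bounded operators on $\mathbf X_p$ by $$G^1(t)=\mathcal V\,S^1(t)\,\mathcal V,\quad G^2(t)=\mathcal V\,S^2(t)\,\mathcal V,$$ where, for a.e. $x\in(0,1)$ and with $n\in\mathbb N_0$ the unique integer such that $0<n-t+x<1$, $$(S^1(t)\mathbf f)(x)=\sum_{j=1}^d\lambda_j^n\mathcal p_j(n)\Pi_j\mathbf f(n-t+x),\qquad (S^2(t)\mathbf f)(x)=\sum_{j=d+1}^k\lambda_j^n\mathcal p_j(n)\Pi_j\mathbf f(n-t+x).$$ Empty sums are $0$. $\operatorname{rng}$ denotes the range. Pointwise formulas hold for a.e. $x$. "Periodic with period $d$" means that $G^1(t+d)=G^1(t)$ for all $t\ge0$ and that $d$ is the smallest positive number with this property (equivalently, the smallest $t_0>0$ such that $G^1(t_0)$ is the identity on $Z^1$). *)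

theory Defs
  imports
    "HOL-Analysis.Analysis"
    "HOL-Computational_Algebra.Polynomial"
begin

text \<open>
  Conventions. An element of \<open>X\<^sub>p\<close> is represented by a function \<open>real \<Rightarrow> complex ^ 'n\<close> of which only the
  values on \<open>(0,1)\<close>, up to almost-everywhere equality, matter; operators act on representatives.
  The coordinates are indexed by \<open>'n\<close>, where \<open>CARD('n) = 2m\<close>. A set \<open>P :: 'n set\<close> of \<open>m\<^sub>+\<close> indices marks
  the components of \<open>\<upsilon>\<close>; its complement marks the \<open>m\<^sub>-\<close> components of \<open>\<varpi>\<close>. Either may be empty.
  Blocks of a matrix are thus the restrictions of its entries to \<open>P \<times> P\<close>, \<open>P \<times> -P\<close>, \<open>-P \<times> P\<close>, \<open>-P \<times> -P\<close>.
\<close>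

subsection \<open>The space \<open>X\<^sub>p\<close>\<close>

abbreviation I01 :: "real measure" where
  "I01 \<equiv> lebesgue_on {0<..<1}"

definition ae_eq :: "(real \<Rightarrow> 'a) \<Rightarrow> (real \<Rightarrow> 'a) \<Rightarrow> bool" (infix "=\<^sub>a\<^sub>e" 50) where
  "f =\<^sub>a\<^sub>e g \<longleftrightarrow> (AE x in I01. f x = g x)"

definition Xp :: "real \<Rightarrow> (real \<Rightarrow> complex ^ 'n) set" where
  "Xp p = {f \<in> borel_measurable I01. \<forall>i. integrable I01 (\<lambda>x. norm (f x $ i) powr p)}"

definition Xnorm :: "real \<Rightarrow> (real \<Rightarrow> complex ^ 'n) \<Rightarrow> real" where
  "Xnorm p f = (LINT x|I01. (\<Sum>i\<in>UNIV. norm (f x $ i) powr p)) powr (1 / p)"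

definition bounded_operator ::
  "real \<Rightarrow> ((real \<Rightarrow> complex ^ 'n) \<Rightarrow> (real \<Rightarrow> complex ^ 'n)) \<Rightarrow> bool" where
  "bounded_operator p T \<longleftrightarrow>
     (\<forall>f\<in>Xp p. T f \<in> Xp p) \<and>
     (\<forall>f\<in>Xp p. \<forall>g\<in>Xp p. f =\<^sub>a\<^sub>e g \<longrightarrow> T f =\<^sub>a\<^sub>e T g) \<and>
     (\<forall>f\<in>Xp p. \<forall>g\<in>Xp p. T (\<lambda>x. f x + g x) =\<^sub>a\<^sub>e (\<lambda>x. T f x + T g x)) \<and>
     (\<forall>c. \<forall>f\<in>Xp p. T (\<lambda>x. c *s f x) =\<^sub>a\<^sub>e (\<lambda>x. c *s T f x)) \<and>
     (\<exists>C. \<forall>f\<in>Xp p. Xnorm p (T f) \<le> C * Xnorm p f)"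

text \<open>The operator norm takes values in \<^typ>\<open>ennreal\<close>, so that the supremum always exists.\<close>

definition operator_norm ::
  "real \<Rightarrow> ((real \<Rightarrow> complex ^ 'n) \<Rightarrow> (real \<Rightarrow> complex ^ 'n)) \<Rightarrow> ennreal" where
  "operator_norm p T = (SUP f\<in>{f \<in> Xp p. Xnorm p f \<le> 1}. ennreal (Xnorm p (T f)))"

definition operator_range ::
  "real \<Rightarrow> ((real \<Rightarrow> complex ^ 'n) \<Rightarrow> (real \<Rightarrow> complex ^ 'n)) \<Rightarrow> (real \<Rightarrow> complex ^ 'n) set" where
  "operator_range p T = {g \<in> Xp p. \<exists>f\<in>Xp p. g =\<^sub>a\<^sub>e T f}"

definition closed_subspace :: "real \<Rightarrow> (real \<Rightarrow> complex ^ 'n) set \<Rightarrow> bool" where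
  "closed_subspace p Z \<longleftrightarrow>
     Z \<subseteq> Xp p \<and> (\<lambda>x. 0) \<in> Z \<and>
     (\<forall>f\<in>Z. \<forall>g\<in>Z. (\<lambda>x. f x + g x) \<in> Z) \<and>
     (\<forall>c. \<forall>f\<in>Z. (\<lambda>x. c *s f x) \<in> Z) \<and>
     (\<forall>F f. (\<forall>k::nat. F k \<in> Z) \<longrightarrow> f \<in> Xp p \<longrightarrow>
        (\<lambda>k. Xnorm p (\<lambda>x. F k x - f x)) \<longlonglongrightarrow> 0 \<longrightarrow> f \<in> Z)"

definition direct_sum ::
  "real \<Rightarrow> (real \<Rightarrow> complex ^ 'n) set \<Rightarrow> (real \<Rightarrow> complex ^ 'n) set \<Rightarrow> bool" where
  "direct_sum p Z1 Z2 \<longleftrightarrow>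
     closed_subspace p Z1 \<and> closed_subspace p Z2 \<and>
     (\<forall>f\<in>Xp p. \<exists>g\<in>Z1. \<exists>h\<in>Z2. f =\<^sub>a\<^sub>e (\<lambda>x. g x + h x)) \<and>
     (\<forall>f\<in>Z1 \<inter> Z2. f =\<^sub>a\<^sub>e (\<lambda>x. 0))"

subsection \<open>Semigroups and generators\<close>

definition C0_semigroup ::
  "real \<Rightarrow> (real \<Rightarrow> (real \<Rightarrow> complex ^ 'n) \<Rightarrow> (real \<Rightarrow> complex ^ 'n)) \<Rightarrow> bool" where
  "C0_semigroup p G \<longleftrightarrow>
     (\<forall>t\<ge>0. bounded_operator p (G t)) \<and>
     (\<forall>f\<in>Xp p. G 0 f =\<^sub>a\<^sub>e f) \<and>
     (\<forall>s\<ge>0. \<forall>t\<ge>0. \<forall>f\<in>Xp p. G (s + t) f =\<^sub>a\<^sub>e G s (G t f)) \<and>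
     (\<forall>f\<in>Xp p. ((\<lambda>t. Xnorm p (\<lambda>x. G t f x - f x)) \<longlongrightarrow> 0) (at_right 0))"

text \<open>Unbounded operators are given by their graphs, closed under changing representatives.\<close>

definition generator ::
  "real \<Rightarrow> (real \<Rightarrow> (real \<Rightarrow> complex ^ 'n) \<Rightarrow> (real \<Rightarrow> complex ^ 'n)) \<Rightarrow>
   ((real \<Rightarrow> complex ^ 'n) \<times> (real \<Rightarrow> complex ^ 'n)) set" where
  "generator p G = {(f, g). f \<in> Xp p \<and> g \<in> Xp p \<and>
     ((\<lambda>h. Xnorm p (\<lambda>x. (1 / h) *\<^sub>R (G h f x - f x) - g x)) \<longlongrightarrow> 0) (at_right 0)}"

subsection \<open>The operator \<open>A\<close>\<close>

text \<open>Weak derivatives are tested against \<open>C\<^sup>1\<close> functions with compact support in \<open>(0,1)\<close>.\<close>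

definition test_function :: "(real \<Rightarrow> real) \<Rightarrow> bool" where
  "test_function \<phi> \<longleftrightarrow> \<phi> C1_differentiable_on UNIV \<and>
     (\<exists>a b. 0 < a \<and> b < 1 \<and> (\<forall>x. x \<notin> {a..b} \<longrightarrow> \<phi> x = 0))"

definition weak_derivative :: "(real \<Rightarrow> complex ^ 'n) \<Rightarrow> (real \<Rightarrow> complex ^ 'n) \<Rightarrow> bool" where
  "weak_derivative f g \<longleftrightarrow> (\<forall>\<phi>. test_function \<phi> \<longrightarrow>
     (\<forall>i. (LINT x|I01. f x $ i * of_real (deriv \<phi> x)) = - (LINT x|I01. g x $ i * of_real (\<phi> x))))"

definition W1p :: "real \<Rightarrow> (real \<Rightarrow> complex ^ 'n) set" where
  "W1p p = {f \<in> Xp p. \<exists>g\<in>Xp p. weak_derivative f g}"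

text \<open>Boundary values are those of the representative which is continuous on \<open>[0,1]\<close>.\<close>

definition continuous_representative ::
  "(real \<Rightarrow> complex ^ 'n) \<Rightarrow> (real \<Rightarrow> complex ^ 'n) \<Rightarrow> bool" where
  "continuous_representative f F \<longleftrightarrow> continuous_on {0..1} F \<and> F =\<^sub>a\<^sub>e f"

definition A_dom :: "real \<Rightarrow> 'n set \<Rightarrow> complex ^ 'n ^ 'n \<Rightarrow> (real \<Rightarrow> complex ^ 'n) set" where
  "A_dom p P B = {f \<in> W1p p. \<exists>F. continuous_representative f F \<and>
     (\<chi> i. if i \<in> P then F 0 $ i else F 1 $ i) =
       B *v (\<chi> i. if i \<in> P then F 1 $ i else F 0 $ i)}"

definition A_graph ::
  "real \<Rightarrow> 'n set \<Rightarrow> complex ^ 'n ^ 'n \<Rightarrow>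
   ((real \<Rightarrow> complex ^ 'n) \<times> (real \<Rightarrow> complex ^ 'n)) set" where
  "A_graph p P B = {(f, g). f \<in> A_dom p P B \<and> g \<in> Xp p \<and>
     (\<exists>f'\<in>Xp p. weak_derivative f f' \<and>
        g =\<^sub>a\<^sub>e (\<lambda>x. \<chi> i. if i \<in> P then - (f' x $ i) else f' x $ i))}"

subsection \<open>Spectral data of a matrix\<close>

definition eigenspace :: "complex ^ 'n ^ 'n \<Rightarrow> complex \<Rightarrow> (complex ^ 'n) set" where
  "eigenspace B \<mu> = {v. B *v v = \<mu> *s v}"

definition eigenvalues :: "complex ^ 'n ^ 'n \<Rightarrow> complex set" where
  "eigenvalues B = {\<mu>. \<exists>v \<in> eigenspace B \<mu>. v \<noteq> 0}"

definition charpoly :: "complex ^ 'n ^ 'n \<Rightarrow> complex poly" where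
  "charpoly B = det (mat [:0, 1:] - map_matrix (\<lambda>c. [:c:]) B)"

definition alg_mult :: "complex ^ 'n ^ 'n \<Rightarrow> complex \<Rightarrow> nat" where
  "alg_mult B \<mu> = order \<mu> (charpoly B)"

definition semisimple_eigenvalue :: "complex ^ 'n ^ 'n \<Rightarrow> complex \<Rightarrow> bool" where
  "semisimple_eigenvalue B \<mu> \<longleftrightarrow>
     \<mu> \<in> eigenvalues B \<and> alg_mult B \<mu> = vec.dim (eigenspace B \<mu>)"

text \<open>\<^term>\<open>(^)\<close> on the type of square matrices is the componentwise power.\<close>

definition mat_pow :: "complex ^ 'n ^ 'n \<Rightarrow> nat \<Rightarrow> complex ^ 'n ^ 'n" where
  "mat_pow M n = (((**) M) ^^ n) (mat 1)"

definition gen_eigenspace :: "complex ^ 'n ^ 'n \<Rightarrow> complex \<Rightarrow> (complex ^ 'n) set" where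
  "gen_eigenspace B \<mu> = {v. \<exists>r. mat_pow (B - mat \<mu>) r *v v = 0}"

text \<open>The projection onto one generalized eigenspace along the sum of all the others.\<close>

definition spectral_projection :: "complex ^ 'n ^ 'n \<Rightarrow> complex \<Rightarrow> complex ^ 'n ^ 'n" where
  "spectral_projection B \<mu> = (THE Q. \<forall>v.
     Q *v v \<in> gen_eigenspace B \<mu> \<and>
     v - Q *v v \<in> vec.span (\<Union>\<nu>\<in>eigenvalues B - {\<mu>}. gen_eigenspace B \<nu>))"

text \<open>
  The polynomial \<open>p\<^sub>j(n) = \<Sum>\<^sub>r (n choose r) \<lambda>\<^sub>j\<^sup>-\<^sup>r (B - \<lambda>\<^sub>j I)\<^sup>r\<close>, for \<open>\<lambda>\<^sub>j \<noteq> 0\<close>. The sum over \<open>r \<le> n\<close> in the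
  expansion of \<open>B\<^sup>n \<Pi>\<^sub>j\<close> may be replaced by the one over \<open>r < \<alpha>\<^sub>j\<close>, because the binomial coefficient
  vanishes for \<open>r > n\<close> and \<open>(B - \<lambda>\<^sub>j I)\<^sup>r \<Pi>\<^sub>j\<close> vanishes for \<open>r \<ge> \<alpha>\<^sub>j\<close>. This makes the degree in \<open>n\<close>
  smaller than \<open>\<alpha>\<^sub>j\<close>.
\<close>

definition spectral_poly :: "complex ^ 'n ^ 'n \<Rightarrow> complex \<Rightarrow> nat \<Rightarrow> complex ^ 'n ^ 'n" where
  "spectral_poly B \<mu> n =
     (\<Sum>r<alg_mult B \<mu>. mat (of_nat (n choose r) / \<mu> ^ r) ** mat_pow (B - mat \<mu>) r)"

text \<open>The expression \<open>\<lambda>\<^sub>j\<^sup>n p\<^sub>j(n) \<Pi>\<^sub>j\<close>, to be read as \<open>B\<^sup>n \<Pi>\<^sub>j\<close> if \<open>\<lambda>\<^sub>j = 0\<close>.\<close>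

definition spectral_term :: "complex ^ 'n ^ 'n \<Rightarrow> complex \<Rightarrow> nat \<Rightarrow> complex ^ 'n ^ 'n" where
  "spectral_term B \<mu> n =
     (if \<mu> = 0 then mat_pow B n ** spectral_projection B \<mu>
      else mat (\<mu> ^ n) ** (spectral_poly B \<mu> n ** spectral_projection B \<mu>))"

subsection \<open>The explicit families\<close>

definition reflect :: "'n set \<Rightarrow> (real \<Rightarrow> complex ^ 'n) \<Rightarrow> (real \<Rightarrow> complex ^ 'n)" where
  "reflect P f = (\<lambda>x. \<chi> i. if i \<in> P then f x $ i else f (1 - x) $ i)"

text \<open>
  For fixed \<open>t \<ge> 0\<close> the shift \<open>n\<close> exists for all \<open>x\<close> in \<open>(0,1)\<close> with \<open>t - x\<close> not an integer, hence almost
  everywhere. The families \<open>S\<^sup>1, S\<^sup>2\<close> (and \<open>G\<^sup>1, G\<^sup>2\<close>) correspond to \<open>J = {1..d}\<close> and \<open>J = {d+1..k}\<close>.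
\<close>

definition S_part ::
  "complex ^ 'n ^ 'n \<Rightarrow> (nat \<Rightarrow> complex) \<Rightarrow> nat set \<Rightarrow> real \<Rightarrow>
   (real \<Rightarrow> complex ^ 'n) \<Rightarrow> (real \<Rightarrow> complex ^ 'n)" where
  "S_part B lam J t f = (\<lambda>x.
     let n = (THE n::nat. 0 < real n - t + x \<and> real n - t + x < 1)
     in \<Sum>j\<in>J. spectral_term B (lam j) n *v f (real n - t + x))"

definition G_part ::
  "'n set \<Rightarrow> complex ^ 'n ^ 'n \<Rightarrow> (nat \<Rightarrow> complex) \<Rightarrow> nat set \<Rightarrow> real \<Rightarrow>
   (real \<Rightarrow> complex ^ 'n) \<Rightarrow> (real \<Rightarrow> complex ^ 'n)" where
  "G_part P B lam J t f = reflect P (S_part B lam J t (reflect P f))"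

definition is_period ::
  "real \<Rightarrow> (real \<Rightarrow> (real \<Rightarrow> complex ^ 'n) \<Rightarrow> (real \<Rightarrow> complex ^ 'n)) \<Rightarrow> real \<Rightarrow> bool" where
  "is_period p T s \<longleftrightarrow> 0 < s \<and> (\<forall>t\<ge>0. \<forall>f\<in>Xp p. T (t + s) f =\<^sub>a\<^sub>e T t f)"

definition periodic_with_period ::
  "real \<Rightarrow> (real \<Rightarrow> (real \<Rightarrow> complex ^ 'n) \<Rightarrow> (real \<Rightarrow> complex ^ 'n)) \<Rightarrow> real \<Rightarrow> bool" where
  "periodic_with_period p T s \<longleftrightarrow> is_period p T s \<and> (\<forall>s'. is_period p T s' \<longrightarrow> s \<le> s')"

end

theory Submission
  imports Defs "HOL-Computational_Algebra.Fundamental_Theorem_Algebra"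
begin

text \<open>
  After the reflection of the components of the second kind the equation becomes a transport equation
  on \<open>(0,1)\<close> whose outflow is fed back through \<open>B\<close>, so its solution is \<open>x \<mapsto> B\<^sup>n f(n - t + x)\<close>. To see that
  the given semigroup \<open>G\<close> is this one, take \<open>f\<close> of class \<open>C\<^sup>1\<close> vanishing outside \<open>(0,1)\<close>: the explicit
  solution \<open>u\<close> is then classical, and \<open>s \<mapsto> G(t - s) u(s)\<close> has right derivative zero. Such \<open>f\<close> are dense.
  Everything else is linear algebra: the spectral projections commute with \<open>B\<close>, \<open>B\<^sup>n \<Pi>\<^sub>j \<rightarrow> 0\<close> if
  \<open>\<bar>\<lambda>\<^sub>j\<bar> < 1\<close>, and \<open>B\<^sup>n \<Pi>\<^sub>j = \<lambda>\<^sub>j\<^sup>n \<Pi>\<^sub>j\<close> if \<open>\<lambda>\<^sub>j\<close> is semisimple.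
\<close>


text \<open>The bound on the norms of \<open>G t\<close> is only locally uniform away from time 0,
  while the comparison along \<open>G (t - s)\<close> runs down to time 0. It is therefore carried
  out with \<open>G (t + \<delta> - s)\<close> for a fixed \<delta> > 0, and \<delta> is sent to 0
  by strong continuity at the very end. In the linear algebra two notions of multiplicity meet:
  \<open>alg_mult\<close> is the order of a zero of a determinant, whereas the projections only see
  kernels of powers of B - \<mu>. The link is that the dimension of a generalized eigenspace is at
  most \<open>alg_mult\<close>. It justifies the truncation of the expansion of B^n at the algebraic
  multiplicity, and it identifies generalized with ordinary eigenvectors in the semisimple case. Its
  proof subtracts the nilpotent part of B on that eigenspace, which leaves the determinant
  unchanged. Convergence in operator norm is inherited from convergence of matrices: at time t only
  the indices floor t and floor t + 1 occur, and the argument of f is moved by a measure preserving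
  rotation of (0,1).\<close>

section \<open>Scalar matrices and matrix powers\<close>

lemma mat_vec: "mat (c::'a::semiring_1) *v v = c *s (v::'a^'n)"
  by (simp add: matrix_vector_mult_def mat_def vec_eq_iff if_distrib if_distribR cong: if_cong)

lemma mat_pow_0 [simp]: "mat_pow M 0 = mat 1"
  by (simp add: mat_pow_def)

lemma mat_pow_Suc: "mat_pow M (Suc n) = M ** mat_pow M n"
  by (simp add: mat_pow_def)

lemma mat_pow_commute: "A ** M = M ** A \<Longrightarrow> A ** mat_pow M n = mat_pow M n ** A"
  by (induction n) (simp_all add: mat_pow_Suc matrix_mul_assoc, metis matrix_mul_assoc)

lemma mat_pow_add: "mat_pow M (m + n) = mat_pow M m ** mat_pow M n"
  by (induction m) (simp_all add: mat_pow_Suc matrix_mul_assoc)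

lemma mat_commute: "mat c ** (M::'a::comm_semiring_1^'n^'n) = M ** mat c"
  by (simp add: matrix_matrix_mult_def mat_def vec_eq_iff if_distrib if_distribR mult.commute cong: if_cong)

lemma mat_pow_Suc_vec: "mat_pow M (Suc n) *v v = M *v (mat_pow M n *v v)"
  by (simp add: mat_pow_Suc matrix_vector_mul_assoc)

lemma mat_pow_Suc_vec': "mat_pow M (Suc n) *v v = mat_pow M n *v (M *v v)"
  using mat_pow_commute[of M M n] by (simp add: mat_pow_Suc matrix_vector_mul_assoc)

lemma mat_pow_add_vec: "mat_pow M (m + n) *v v = mat_pow M m *v (mat_pow M n *v v)"
  by (simp add: mat_pow_add matrix_vector_mul_assoc)

subsection \<open>Polynomials acting on vectors\<close>

text \<open>The vector q(B) v, evaluated by Horner's scheme. It turns the vector space into a module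
  over the polynomials in which X acts as B, so that facts about commuting powers of B - \<mu>
  follow from commutativity of polynomial multiplication.\<close>

definition pact :: "complex^'n^'n \<Rightarrow> complex poly \<Rightarrow> complex^'n \<Rightarrow> complex^'n" where
  "pact B q v = fold_coeffs (\<lambda>a w. a *s v + B *v w) q 0"

lemma pact_0 [simp]: "pact B 0 v = 0"
  by (simp add: pact_def)

lemma pact_pCons [simp]: "pact B (pCons a q) v = a *s v + B *v pact B q v"
  by (cases "q = 0 \<and> a = 0") (auto simp: pact_def fold_coeffs_pCons_not_0_0_eq fold_coeffs_pCons_coeff_not_0_eq)

lemma pact_add: "pact B (p + q) v = pact B p v + pact B q v"
  by (induction p q rule: poly_induct2) (simp_all add: vec.scale_left_distrib matrix_vector_right_distrib)

lemma pact_smult: "pact B (smult c q) v = c *s pact B q v"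
  by (induction q) (simp_all add: vec.scale_right_distrib vec.scale)

lemma pact_mult: "pact B (p * q) v = pact B p (pact B q v)"
  by (induction p) (simp_all add: pact_add pact_smult)

lemma pact_commute: "pact B p (pact B q v) = pact B q (pact B p v)"
  by (metis mult.commute pact_mult)

lemma pact_vec_add: "pact B q (v + w) = pact B q v + pact B q w"
  by (induction q) (simp_all add: vec.scale_right_distrib matrix_vector_right_distrib)

lemma pact_vec_smult: "pact B q (c *s v) = c *s pact B q v"
  by (induction q) (simp_all add: vec.scale_right_distrib vec.scale mult.commute)

lemma pact_vec_0 [simp]: "pact B q 0 = 0"
  by (induction q) simp_all

lemma pact_linear_factor: "pact B [:- \<mu>, 1:] v = (B - mat \<mu>) *v v"
  by (simp add: matrix_vector_mult_diff_rdistrib mat_vec)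

lemma pact_linear_power: "pact B ([:- \<mu>, 1:] ^ r) v = mat_pow (B - mat \<mu>) r *v v"
proof (induction r)
  case (Suc r)
  then show ?case
    by (simp only: power_Suc pact_mult pact_linear_factor mat_pow_Suc_vec)
qed (simp add: one_pCons)

lemma pact_monom: "pact B (monom c i) v = c *s (mat_pow B i *v v)"
  by (induction i) (simp_all add: monom_0 monom_Suc mat_pow_Suc_vec vec.scale)

lemma pact_sum: "pact B (sum f A) v = (\<Sum>i\<in>A. pact B (f i) v)"
  by (induction A rule: infinite_finite_induct) (simp_all add: pact_add)

lemma pact_eigenvector: "B *v v = \<mu> *s v \<Longrightarrow> pact B q v = poly q \<mu> *s v"
  by (induction q) (simp_all add: vec.scale vec.scale_left_distrib mult.commute)

text \<open>A space of dimension N cannot contain N + 1 independent vectors, here v, B v, ..., B^N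
  v. The polynomial depends on v, which is enough for the decomposition into generalized
  eigenspaces.\<close>

lemma ex_annihilating_poly:
  fixes B :: "complex^'n^'n"
  obtains q where "q \<noteq> 0" "pact B q v = 0"
proof (cases "inj_on (\<lambda>i. mat_pow B i *v v) {..CARD('n)}")
  case False
  then obtain i j where ij: "i \<noteq> j" "mat_pow B i *v v = mat_pow B j *v v"
    by (auto simp: inj_on_def)
  \<comment> \<open>A repetition in the list of vectors is invisible to linear dependence of the set
    that they form; it gives the polynomial X^i - X^j directly.\<close>
  let ?q = "monom 1 i + monom (-1) j :: complex poly"
  have "coeff ?q i = 1" using ij by simp
  then have "?q \<noteq> 0" by (intro notI) (metis coeff_0 zero_neq_one)
  moreover have "pact B ?q v = 0"
    by (simp add: pact_add pact_monom ij)
  ultimately show ?thesis by (rule that)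
next
  case True
  let ?f = "\<lambda>i. mat_pow B i *v v"
  let ?S = "?f ` {..CARD('n)}"
  have "card ?S = Suc CARD('n)" using True by (simp add: card_image)
  then have "vec.dependent ?S"
    using vec.independent_card_le_dim[of ?S UNIV] vec_dim_card[where 'a=complex and 'n='n]
    by (metis not_less_eq_eq order_refl subset_UNIV)
  then obtain u where u: "\<exists>x\<in>?S. u x \<noteq> 0" "(\<Sum>x\<in>?S. u x *s x) = 0"
    using vec.dependent_finite[of ?S] by auto
  let ?q = "\<Sum>i\<le>CARD('n). monom (u (?f i)) i"
  have c: "coeff ?q i = u (?f i)" if "i \<le> CARD('n)" for i
    using that by (simp add: coeff_sum)
  have "?q \<noteq> 0" using u(1) c by fastforce
  moreover have "pact B ?q v = 0"
    using u(2) by (simp add: pact_sum pact_monom sum.reindex[OF True])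
  ultimately show ?thesis by (rule that)
qed

subsection \<open>Generalized eigenspaces\<close>

lemma gen_eigenspace_mono:
  assumes "mat_pow N r *v v = 0" "r \<le> s" shows "mat_pow N s *v v = 0"
  using mat_pow_add_vec[of N "s - r" r v] assms by simp

lemma subspace_gen_eigenspace: "vec.subspace (gen_eigenspace B \<mu>)"
  unfolding vec.subspace_def
proof (intro conjI ballI allI)
  show "0 \<in> gen_eigenspace B \<mu>" by (auto simp: gen_eigenspace_def)
next
  fix x y assume "x \<in> gen_eigenspace B \<mu>" "y \<in> gen_eigenspace B \<mu>"
  then obtain r s where "mat_pow (B - mat \<mu>) r *v x = 0" "mat_pow (B - mat \<mu>) s *v y = 0"
    by (auto simp: gen_eigenspace_def)
  then have "mat_pow (B - mat \<mu>) (max r s) *v (x + y) = 0"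
    by (simp add: matrix_vector_right_distrib gen_eigenspace_mono)
  then show "x + y \<in> gen_eigenspace B \<mu>" by (auto simp: gen_eigenspace_def)
next
  fix c x assume "x \<in> gen_eigenspace B \<mu>"
  then show "c *s x \<in> gen_eigenspace B \<mu>" by (auto simp: gen_eigenspace_def vec.scale)
qed

lemma pact_gen_eigenspace:
  assumes "v \<in> gen_eigenspace B \<mu>" shows "pact B q v \<in> gen_eigenspace B \<mu>"
proof -
  obtain r where "mat_pow (B - mat \<mu>) r *v v = 0" using assms by (auto simp: gen_eigenspace_def)
  then have "mat_pow (B - mat \<mu>) r *v pact B q v = 0"
    by (metis pact_linear_power pact_commute pact_vec_0)
  then show ?thesis by (auto simp: gen_eigenspace_def)
qed

lemma mult_gen_eigenspace:
  assumes "v \<in> gen_eigenspace B \<mu>" shows "B *v v \<in> gen_eigenspace B \<mu>"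
  using pact_gen_eigenspace[OF assms, of "[:0, 1:]"] by simp

text \<open>Descent through the powers of B - \<mu>: if the next power kills v, then w = (B -
  \<mu>)^r v satisfies B w = \<mu> w, so q(B) acts on w as the nonzero scalar q(\<mu>), while q(B) w
  = 0. Hence w = 0 and the exponent drops until v itself is reached.\<close>

lemma gen_eigenspace_trivial_inter:
  assumes "v \<in> gen_eigenspace B \<mu>" "pact B q v = 0" "poly q \<mu> \<noteq> 0"
  shows "v = 0"
proof -
  obtain r where "mat_pow (B - mat \<mu>) r *v v = 0" using assms(1) by (auto simp: gen_eigenspace_def)
  then show ?thesis
  proof (induction r)
    case (Suc r)
    let ?w = "mat_pow (B - mat \<mu>) r *v v"
    have "(B - mat \<mu>) *v ?w = 0" using Suc.prems by (simp add: mat_pow_Suc_vec)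
    then have "B *v ?w = \<mu> *s ?w" by (simp add: matrix_vector_mult_diff_rdistrib mat_vec)
    then have "pact B q ?w = poly q \<mu> *s ?w" by (rule pact_eigenvector)
    moreover have "pact B q ?w = 0"
      by (metis assms(2) pact_commute pact_linear_power pact_vec_0)
    ultimately have "?w = 0" using assms(3) by simp
    then show ?case by (rule Suc.IH)
  qed simp
qed

text \<open>The same descent. It allows unions over all complex numbers in place of unions over the
  eigenvalues.\<close>

lemma gen_eigenspace_noneigenvalue:
  assumes "\<mu> \<notin> eigenvalues B" "v \<in> gen_eigenspace B \<mu>" shows "v = 0"
proof -
  obtain r where "mat_pow (B - mat \<mu>) r *v v = 0" using assms(2) by (auto simp: gen_eigenspace_def)
  then show ?thesis
  proof (induction r)
    case (Suc r)
    let ?w = "mat_pow (B - mat \<mu>) r *v v"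
    have "(B - mat \<mu>) *v ?w = 0" using Suc.prems by (simp add: mat_pow_Suc_vec)
    then have "B *v ?w = \<mu> *s ?w" by (simp add: matrix_vector_mult_diff_rdistrib mat_vec)
    then have "?w = 0" using assms(1) by (auto simp: eigenvalues_def eigenspace_def)
    then show ?case by (rule Suc.IH)
  qed simp
qed

lemma eigenspace_subset_gen: "eigenspace B \<mu> \<subseteq> gen_eigenspace B \<mu>"
proof
  fix v assume "v \<in> eigenspace B \<mu>"
  then have "mat_pow (B - mat \<mu>) 1 *v v = 0"
    by (simp add: mat_pow_Suc eigenspace_def matrix_vector_mult_diff_rdistrib mat_vec)
  then show "v \<in> gen_eigenspace B \<mu>" unfolding gen_eigenspace_def by blast
qed

text \<open>On this space B - \<nu> is the nonzero scalar \<mu> - \<nu> plus a nilpotent map. Since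
  (B - \<nu>) u = (B - \<mu>) u + (\<mu> - \<nu>) u and (B - \<mu>) u has a smaller nilpotency
  index, subtracting a preimage w of it and dividing by \<mu> - \<nu> gives a preimage of u.\<close>

lemma gen_eigenspace_surj:
  assumes "\<mu> \<noteq> \<nu>" "u \<in> gen_eigenspace B \<mu>"
  shows "\<exists>w\<in>gen_eigenspace B \<mu>. (B - mat \<nu>) *v w = u"
proof -
  obtain r where "mat_pow (B - mat \<mu>) r *v u = 0" using assms(2) by (auto simp: gen_eigenspace_def)
  then show ?thesis using assms(2)
  proof (induction r arbitrary: u)
    case 0
    then show ?case using vec.subspace_0[OF subspace_gen_eigenspace] by (intro bexI[of _ 0]) auto
  next
    case (Suc r)
    let ?u' = "(B - mat \<mu>) *v u"
    have "?u' \<in> gen_eigenspace B \<mu>"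
      by (metis Suc.prems(2) pact_gen_eigenspace pact_linear_factor)
    moreover have "mat_pow (B - mat \<mu>) r *v ?u' = 0" using Suc.prems by (simp add: mat_pow_Suc_vec')
    ultimately obtain w where w: "w \<in> gen_eigenspace B \<mu>" "(B - mat \<nu>) *v w = ?u'"
      using Suc.IH by blast
    let ?w = "(1 / (\<mu> - \<nu>)) *s (u - w)"
    have "(B - mat \<nu>) *v u = ?u' + (\<mu> - \<nu>) *s u"
      by (simp add: matrix_vector_mult_diff_rdistrib mat_vec vec.scale_left_diff_distrib)
    then have "(B - mat \<nu>) *v (u - w) = (\<mu> - \<nu>) *s u"
      using w(2) by (simp add: matrix_vector_mult_diff_distrib)
    then have "(B - mat \<nu>) *v ?w = (1 / (\<mu> - \<nu>)) *s ((\<mu> - \<nu>) *s u)"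
      by (simp only: vec.scale)
    then have "(B - mat \<nu>) *v ?w = u"
      using assms(1) by (simp only: vec.scale_scale) simp
    moreover have "?w \<in> gen_eigenspace B \<mu>"
      by (intro vec.subspace_scale vec.subspace_diff subspace_gen_eigenspace Suc.prems w)
    ultimately show ?case by blast
  qed
qed

text \<open>Every u in the span is (B - \<nu>) x up to an error in the generalized eigenspace of
  \<nu>: the components for the other eigenvalues are hit exactly, the one for \<nu> becomes the
  error. For u = (B - \<nu>) w the difference x - w is then killed by one more power of B - \<nu>,
  so it lies in the span, and so does w.\<close>

lemma span_gen_eigenspaces_preimage:
  assumes "(B - mat \<nu>) *v w \<in> vec.span (\<Union>\<mu>. gen_eigenspace B \<mu>)"
  shows "w \<in> vec.span (\<Union>\<mu>. gen_eigenspace B \<mu>)" (is "_ \<in> ?U")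
proof -
  have "\<exists>x\<in>?U. (B - mat \<nu>) *v x - u \<in> gen_eigenspace B \<nu>" if "u \<in> ?U" for u
    using that
  proof (induction rule: vec.span_induct_alt)
    case base
    show ?case using vec.span_zero vec.subspace_0[OF subspace_gen_eigenspace] by force
  next
    case (step c x y)
    then obtain z where z: "z \<in> ?U" "(B - mat \<nu>) *v z - y \<in> gen_eigenspace B \<nu>" by blast
    obtain \<mu> where \<mu>: "x \<in> gen_eigenspace B \<mu>" using step by blast
    show ?case
    proof (cases "\<mu> = \<nu>")
      case True
      have "(B - mat \<nu>) *v z - (c *s x + y) = ((B - mat \<nu>) *v z - y) - c *s x" by simp
      also have "\<dots> \<in> gen_eigenspace B \<nu>"
        using vec.subspace_diff[OF subspace_gen_eigenspace z(2)
            vec.subspace_scale[OF subspace_gen_eigenspace, of x B \<nu> c]] \<mu> True by simp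
      finally show ?thesis using z(1) by blast
    next
      case False
      then obtain w' where w': "w' \<in> gen_eigenspace B \<mu>" "(B - mat \<nu>) *v w' = x"
        using gen_eigenspace_surj \<mu> by blast
      have "(B - mat \<nu>) *v (c *s w' + z) - (c *s x + y) = (B - mat \<nu>) *v z - y"
        using w'(2) by (simp add: matrix_vector_right_distrib vec.scale)
      moreover have "c *s w' + z \<in> ?U"
        using w'(1) z(1) by (intro vec.span_add vec.span_scale) (auto intro: vec.span_base)
      ultimately show ?thesis using z(2) by metis
    qed
  qed
  then obtain x where x: "x \<in> ?U" "(B - mat \<nu>) *v x - (B - mat \<nu>) *v w \<in> gen_eigenspace B \<nu>"
    using assms by blast
  then have "(B - mat \<nu>) *v (x - w) \<in> gen_eigenspace B \<nu>"
    by (simp add: matrix_vector_mult_diff_distrib)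
  then obtain r where "mat_pow (B - mat \<nu>) r *v ((B - mat \<nu>) *v (x - w)) = 0"
    by (auto simp: gen_eigenspace_def)
  then have "mat_pow (B - mat \<nu>) (Suc r) *v (x - w) = 0"
    by (simp only: mat_pow_Suc_vec')
  then have "x - w \<in> gen_eigenspace B \<nu>" by (auto simp: gen_eigenspace_def)
  then have "x - w \<in> ?U" by (auto intro: vec.span_base)
  then show ?thesis using x(1) vec.span_diff[of x _ "x - w"] by auto
qed

text \<open>The linear factors of an annihilating polynomial of v are peeled off one at a time; each
  removal keeps the vector in the span by the preceding lemma, until a nonzero constant multiple of
  v remains.\<close>

lemma span_gen_eigenspaces: "vec.span (\<Union>\<mu>\<in>eigenvalues B. gen_eigenspace B \<mu>) = UNIV"
proof -
  let ?U = "vec.span (\<Union>\<mu>. gen_eigenspace B \<mu>)"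
  have *: "v \<in> ?U" if "q \<noteq> 0" "pact B q v \<in> ?U" for q v
    using that
  proof (induction "degree q" arbitrary: q)
    case 0
    then obtain c where "q = [:c:]" by (metis degree_eq_zeroE)
    then show ?case using 0 vec.span_scale[of "c *s v" _ "1 / c"] by auto
  next
    case (Suc n)
    then obtain \<nu> where "poly q \<nu> = 0"
      using fundamental_theorem_of_algebra constant_degree by (metis nat.simps(3))
    then obtain q' where q': "q = [:- \<nu>, 1:] * q'" using poly_eq_0_iff_dvd by (metis dvdE)
    then have "q' \<noteq> 0" using Suc.prems by auto
    then have "degree q = Suc (degree q')" using degree_mult_eq[of "[:- \<nu>, 1:]" q'] q' by simp
    moreover have "pact B q' v \<in> ?U"
      using Suc.prems(2) unfolding q' pact_mult pact_linear_factor
      by (rule span_gen_eigenspaces_preimage)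
    ultimately show ?case using Suc.hyps \<open>q' \<noteq> 0\<close> by simp
  qed
  have "v \<in> ?U" for v
    by (metis * ex_annihilating_poly vec.span_zero)
  moreover have "(\<Union>\<mu>. gen_eigenspace B \<mu>) \<subseteq> vec.span (\<Union>\<mu>\<in>eigenvalues B. gen_eigenspace B \<mu>)"
  proof
    fix x assume "x \<in> (\<Union>\<mu>. gen_eigenspace B \<mu>)"
    then obtain \<mu> where \<mu>: "x \<in> gen_eigenspace B \<mu>" by blast
    show "x \<in> vec.span (\<Union>\<mu>\<in>eigenvalues B. gen_eigenspace B \<mu>)"
    proof (cases "\<mu> \<in> eigenvalues B")
      case True
      then show ?thesis using \<mu> by (intro vec.span_base) blast
    next
      case False
      then have "x = 0" using gen_eigenspace_noneigenvalue \<mu> by blast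
      then show ?thesis by (simp add: vec.span_zero)
    qed
  qed
  ultimately show ?thesis
    using vec.span_minimal[OF _ vec.subspace_span] by blast
qed

text \<open>The device for all identities between B and its spectral projections: on each
  generalized eigenspace a projection is either 0 or the identity.\<close>

lemma matrix_eq_on_gen_eigenspaces:
  fixes A C :: "complex^'n^'n"
  assumes "\<And>\<mu> v. \<mu> \<in> eigenvalues B \<Longrightarrow> v \<in> gen_eigenspace B \<mu> \<Longrightarrow> A *v v = C *v v"
  shows "A = C"
proof -
  have "A *v v = C *v v" for v
  proof -
    have "v \<in> vec.span (\<Union>\<mu>\<in>eigenvalues B. gen_eigenspace B \<mu>)"
      by (simp add: span_gen_eigenspaces)
    then show ?thesis
      by (induction rule: vec.span_induct_alt)
        (auto simp: matrix_vector_right_distrib vec.scale assms)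
  qed
  then show ?thesis by (simp add: matrix_eq)
qed

subsection \<open>Spectral projections\<close>

abbreviation other_gen_eigenspaces :: "complex^'n^'n \<Rightarrow> complex \<Rightarrow> (complex^'n) set" where
  "other_gen_eigenspaces B \<mu> \<equiv> vec.span (\<Union>\<nu>\<in>eigenvalues B - {\<mu>}. gen_eigenspace B \<nu>)"

text \<open>A product of factors (X - \<nu>)^r with \<nu> different from \<mu>. Together with the
  descent lemma it shows that the sum of the generalized eigenspaces is direct.\<close>

lemma other_gen_eigenspaces_annihilated:
  assumes "v \<in> other_gen_eigenspaces B \<mu>"
  shows "\<exists>q. poly q \<mu> \<noteq> 0 \<and> pact B q v = 0"
  using assms
proof (induction rule: vec.span_induct_alt)
  case base
  show ?case by (rule exI[of _ 1]) simp
next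
  case (step c x y)
  then obtain q where q: "poly q \<mu> \<noteq> 0" "pact B q y = 0" by blast
  obtain \<nu> r where \<nu>: "\<nu> \<noteq> \<mu>" "pact B ([:- \<nu>, 1:] ^ r) x = 0"
    using step by (auto simp: gen_eigenspace_def pact_linear_power)
  let ?r = "[:- \<nu>, 1:] ^ r"
  have "pact B (q * ?r) (c *s x + y) = 0"
    using q(2) \<nu>(2) pact_commute[of B q ?r y]
    by (simp add: pact_mult pact_vec_add pact_vec_smult)
  moreover have "poly (q * ?r) \<mu> \<noteq> 0" using q(1) \<nu>(1) by simp
  ultimately show ?case by blast
qed

lemma gen_eigenspace_inter_others:
  "v \<in> gen_eigenspace B \<mu> \<Longrightarrow> v \<in> other_gen_eigenspaces B \<mu> \<Longrightarrow> v = 0"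
  using other_gen_eigenspaces_annihilated gen_eigenspace_trivial_inter by metis

lemma gen_eigenspace_decomp:
  "\<exists>w\<in>gen_eigenspace B \<mu>. v - w \<in> other_gen_eigenspaces B \<mu>"
proof -
  have "v \<in> vec.span (gen_eigenspace B \<mu> \<union> (\<Union>\<nu>\<in>eigenvalues B - {\<mu>}. gen_eigenspace B \<nu>))"
    using vec.span_mono[of "\<Union>\<nu>\<in>eigenvalues B. gen_eigenspace B \<nu>"
        "gen_eigenspace B \<mu> \<union> (\<Union>\<nu>\<in>eigenvalues B - {\<mu>}. gen_eigenspace B \<nu>)"]
    by (auto simp: span_gen_eigenspaces)
  then obtain w u where "w \<in> vec.span (gen_eigenspace B \<mu>)" "u \<in> other_gen_eigenspaces B \<mu>" "v = w + u"
    unfolding vec.span_Un by blast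
  moreover have "vec.span (gen_eigenspace B \<mu>) = gen_eigenspace B \<mu>"
    by (simp add: vec.span_eq_iff subspace_gen_eigenspace)
  ultimately show ?thesis by (intro bexI[of _ w]) auto
qed

lemma gen_eigenspace_decomp_unique:
  assumes "w \<in> gen_eigenspace B \<mu>" "v - w \<in> other_gen_eigenspaces B \<mu>"
    and "w' \<in> gen_eigenspace B \<mu>" "v - w' \<in> other_gen_eigenspaces B \<mu>"
  shows "w = w'"
proof -
  have "w - w' \<in> gen_eigenspace B \<mu>"
    using assms by (intro vec.subspace_diff subspace_gen_eigenspace)
  moreover have "(v - w') - (v - w) \<in> other_gen_eigenspaces B \<mu>"
    by (rule vec.span_diff[OF assms(4) assms(2)])
  then have "w - w' \<in> other_gen_eigenspaces B \<mu>" by simp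
  ultimately show ?thesis using gen_eigenspace_inter_others by fastforce
qed

text \<open>Justifies the definite description. The component of v in the generalized eigenspace
  exists and is unique; uniqueness makes the chosen component \<open>f v\<close> linear in v, so it
  is given by a matrix, and the same uniqueness makes that matrix the only candidate.\<close>

lemma spectral_projection_spec:
  fixes B :: "complex^'n^'n"
  shows "spectral_projection B \<mu> *v v \<in> gen_eigenspace B \<mu> \<and>
   v - spectral_projection B \<mu> *v v \<in> other_gen_eigenspaces B \<mu>"
proof -
  define f where "f v = (SOME w. w \<in> gen_eigenspace B \<mu> \<and> v - w \<in> other_gen_eigenspaces B \<mu>)" for v
  have f: "f v \<in> gen_eigenspace B \<mu> \<and> v - f v \<in> other_gen_eigenspaces B \<mu>" for v
    unfolding f_def by (rule someI_ex) (rule gen_eigenspace_decomp[of B \<mu> v, unfolded Bex_def])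
  have unique: "f x = w" if "w \<in> gen_eigenspace B \<mu>" "x - w \<in> other_gen_eigenspaces B \<mu>" for x w
    using gen_eigenspace_decomp_unique[of w B \<mu> x "f x"] f that by simp
  have "Vector_Spaces.linear (*s) (*s) f"
  proof (unfold_locales)
    fix x y
    have "x - f x + (y - f y) \<in> other_gen_eigenspaces B \<mu>"
      using f by (intro vec.span_add conjunct2[OF f])
    then have "(x + y) - (f x + f y) \<in> other_gen_eigenspaces B \<mu>" by (simp add: algebra_simps)
    then show "f (x + y) = f x + f y"
      using vec.subspace_add[OF subspace_gen_eigenspace conjunct1[OF f] conjunct1[OF f]] by (intro unique)
  next
    fix c x
    have "c *s (x - f x) \<in> other_gen_eigenspaces B \<mu>"
      by (intro vec.span_scale conjunct2[OF f])
    then have "c *s x - c *s f x \<in> other_gen_eigenspaces B \<mu>" by (simp only: vec.scale_right_diff_distrib)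
    then show "f (c *s x) = c *s f x"
      using vec.subspace_scale[OF subspace_gen_eigenspace conjunct1[OF f]] by (intro unique)
  qed
  then have "matrix f *v v = f v" for v by (rule matrix_works)
  then have "\<forall>v. matrix f *v v \<in> gen_eigenspace B \<mu> \<and> v - matrix f *v v \<in> other_gen_eigenspaces B \<mu>"
    using f by simp
  then have "\<forall>v. spectral_projection B \<mu> *v v \<in> gen_eigenspace B \<mu> \<and>
      v - spectral_projection B \<mu> *v v \<in> other_gen_eigenspaces B \<mu>"
    unfolding spectral_projection_def
  proof (rule theI)
    fix Q :: "complex^'n^'n"
    assume "\<forall>v. Q *v v \<in> gen_eigenspace B \<mu> \<and> v - Q *v v \<in> other_gen_eigenspaces B \<mu>"
    then have "Q *v v = f v" for v
      using f by (intro gen_eigenspace_decomp_unique[of _ B \<mu> v]) auto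
    then show "Q = matrix f"
      using \<open>\<And>v. matrix f *v v = f v\<close> by (simp add: matrix_eq)
  qed
  then show ?thesis by blast
qed

lemma spectral_projection_on_gen:
  assumes "v \<in> gen_eigenspace B \<nu>"
  shows "spectral_projection B \<mu> *v v = (if \<nu> = \<mu> then v else 0)"
proof (cases "\<nu> = \<mu>")
  case True
  then show ?thesis
    using assms spectral_projection_spec[of B \<mu> v] vec.span_zero
    by (auto intro!: gen_eigenspace_decomp_unique[of _ B \<mu> v])
next
  case False
  have "v \<in> other_gen_eigenspaces B \<mu>"
  proof (cases "\<nu> \<in> eigenvalues B")
    case True
    then show ?thesis using assms False by (intro vec.span_base) blast
  next
    case False
    then show ?thesis using gen_eigenspace_noneigenvalue[OF False assms] vec.span_zero by simp
  qed
  then show ?thesis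
    using False spectral_projection_spec[of B \<mu> v] vec.subspace_0[OF subspace_gen_eigenspace]
    by (auto intro!: gen_eigenspace_decomp_unique[of _ B \<mu> v])
qed


subsection \<open>Algebraic multiplicities\<close>

lemma norm_vector_smult: "norm (c *s (v::complex^'n)) = norm c * norm v"
  by (simp add: norm_vec_def L2_set_right_distrib norm_mult)

lemma matrix_sub_ldistrib: "(A::'a::ring_1^'n^'m) ** (C - D) = A ** C - A ** D"
  by (simp add: matrix_matrix_mult_def vec_eq_iff right_diff_distrib sum_subtractf)

lemma matrix_sub_rdistrib: "(C - D) ** (A::'a::ring_1^'n^'m) = C ** A - D ** A"
  by (simp add: matrix_matrix_mult_def vec_eq_iff left_diff_distrib sum_subtractf)

lemma det_nonzero_iff_ker:
  fixes M :: "'a::field^'n^'n"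
  shows "det M \<noteq> 0 \<longleftrightarrow> (\<forall>v. M *v v = 0 \<longrightarrow> v = 0)"
  unfolding invertible_det_nz[symmetric] invertible_left_inverse matrix_left_invertible_ker ..

lemma poly_det: "poly (det M) t = det (map_matrix (\<lambda>q. poly q t) M)"
  for M :: "'a::comm_ring_1 poly^'n^'n"
proof -
  have "poly (of_int (sign p)) t = of_int (sign p)" for p :: "'n \<Rightarrow> 'n"
    by (simp add: sign_def)
  then show ?thesis
    by (simp add: det_def poly_sum poly_prod map_matrix_def)
qed

lemma poly_charpoly: "poly (charpoly B) x = det (mat x - B)"
proof -
  have "map_matrix (\<lambda>q. poly q x) (mat [:0, 1:] - map_matrix (\<lambda>c. [:c:]) B) = mat x - B"
    by (simp add: map_matrix_def vec_eq_iff mat_def)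
  then show ?thesis by (simp add: charpoly_def poly_det)
qed

text \<open>Beyond an operator bound of B the matrix x - B is injective, so the polynomial has a
  value different from 0. Without this, divisibility by a power of X - \<mu> would say nothing about
  \<open>order\<close>.\<close>

lemma charpoly_nonzero: "charpoly B \<noteq> 0"
proof -
  obtain K where K: "K > 0" "\<And>v. norm (B *v v) \<le> norm v * K"
    using linear_bounded_pos[OF matrix_vector_mul_linear, of B] by (auto simp: mult.commute)
  let ?x = "of_real (K + 1) :: complex"
  have "v = 0" if "(mat ?x - B) *v v = 0" for v
  proof (rule ccontr)
    assume "v \<noteq> 0"
    have "B *v v = ?x *s v" using that by (simp add: matrix_vector_mult_diff_rdistrib mat_vec)
    then have "norm (B *v v) = (K + 1) * norm v"
      using K(1) by (simp only: norm_vector_smult norm_of_real)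
    then show False using K(2)[of v] \<open>v \<noteq> 0\<close> by (simp add: algebra_simps)
  qed
  then have "poly (charpoly B) ?x \<noteq> 0" by (simp add: poly_charpoly det_nonzero_iff_ker)
  then show ?thesis by auto
qed

text \<open>If C v = - u L v, then iteration with C and L commuting gives C^k v = (- u)^k L^k v. For
  k = r the right side vanishes, and C is injective.\<close>

lemma det_add_nilpotent_nonzero:
  fixes C L :: "complex^'n^'n"
  assumes "C ** L = L ** C" "mat_pow L r = 0" "det C \<noteq> 0"
  shows "det (C + mat u ** L) \<noteq> 0"
  unfolding det_nonzero_iff_ker
proof (intro allI impI)
  fix v assume "(C + mat u ** L) *v v = 0"
  then have v: "C *v v = (- u) *s (L *v v)"
    by (simp add: matrix_vector_mult_add_rdistrib mat_vec eq_neg_iff_add_eq_0 flip: matrix_vector_mul_assoc)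
  have CL: "C *v (mat_pow L k *v w) = mat_pow L k *v (C *v w)" for k w
    using mat_pow_commute[OF assms(1), of k] by (simp add: matrix_vector_mul_assoc)
  have "mat_pow C k *v v = (- u) ^ k *s (mat_pow L k *v v)" for k
  proof (induction k)
    case (Suc k)
    have "mat_pow C (Suc k) *v v = (- u) ^ k *s (mat_pow L k *v (C *v v))"
      by (simp add: mat_pow_Suc_vec Suc.IH vec.scale CL)
    also have "\<dots> = (- u) ^ Suc k *s (mat_pow L (Suc k) *v v)"
      unfolding v vec.scale mat_pow_Suc_vec' by (simp add: mult.commute)
    finally show ?case .
  qed simp
  then have "mat_pow C r *v v = 0" using assms(2) by simp
  moreover have "w = 0" if "mat_pow C k *v w = 0" for k w
    using that
  proof (induction k)
    case (Suc k)
    then show ?case using assms(3) by (simp add: mat_pow_Suc_vec det_nonzero_iff_ker)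
  qed simp
  ultimately show "v = 0" by blast
qed

text \<open>The polynomial \<open>t \<mapsto> det (A + t L)\<close> has either no zeros or only zeros, so it is constant.\<close>

lemma det_add_nilpotent:
  fixes A L :: "complex^'n^'n"
  assumes "A ** L = L ** A" "mat_pow L r = 0"
  shows "det (A + L) = det A"
proof -
  define f where "f = det (\<chi> i j. [:A$i$j, L$i$j:])"
  have f: "poly f t = det (A + mat t ** L)" for t
    by (simp add: f_def poly_det map_matrix_def plus_vec_def matrix_matrix_mult_def mat_def
        if_distrib if_distribR cong: if_cong)
  have nz: "poly f t \<noteq> 0" if "poly f s \<noteq> 0" for s t
  proof -
    \<comment> \<open>The base point is moved from 0 to s: the matrix A + s L still commutes with L,
      so the preceding lemma applies with increment t - s.\<close>
    have "(A + mat s ** L) ** L = L ** (A + mat s ** L)"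
      using assms(1) by (simp add: matrix_eq matrix_vector_mult_add_rdistrib matrix_vector_right_distrib
          mat_vec vec.scale flip: matrix_vector_mul_assoc)
    moreover have "A + mat t ** L = (A + mat s ** L) + mat (t - s) ** L"
      by (simp add: vec_eq_iff matrix_matrix_mult_def mat_def if_distrib if_distribR algebra_simps cong: if_cong)
    ultimately show ?thesis
      using det_add_nilpotent_nonzero assms(2) that by (metis f)
  qed
  have "poly f 1 = poly f 0"
  proof (cases "\<exists>s. poly f s \<noteq> 0")
    case True
    then have "\<nexists>t. poly f t = 0" using nz by blast
    then show ?thesis using fundamental_theorem_of_algebra[of f] unfolding constant_def by blast
  next
    case False
    then show ?thesis by simp
  qed
  then show ?thesis by (simp add: f)
qed

text \<open>If r is the least exponent that kills v, the kernels of the powers 0, ..., r of B -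
  \<mu> increase strictly, so the last one has dimension at least r. All of them lie in the
  generalized eigenspace.\<close>

lemma mat_pow_dim_gen_eigenspace:
  assumes "v \<in> gen_eigenspace B \<mu>"
  shows "mat_pow (B - mat \<mu>) (vec.dim (gen_eigenspace B \<mu>)) *v v = 0"
proof (rule ccontr)
  let ?N = "B - mat \<mu>" and ?W = "gen_eigenspace B \<mu>"
  assume *: "mat_pow ?N (vec.dim ?W) *v v \<noteq> 0"
  define r where "r = (LEAST r. mat_pow ?N r *v v = 0)"
  have r: "mat_pow ?N r *v v = 0" "\<And>s. s < r \<Longrightarrow> mat_pow ?N s *v v \<noteq> 0"
    using assms LeastI[of "\<lambda>r. mat_pow ?N r *v v = 0"] not_less_Least[of _ "\<lambda>r. mat_pow ?N r *v v = 0"]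
    unfolding r_def gen_eigenspace_def by blast+
  have less: "vec.dim ?W < r" using * gen_eigenspace_mono r(1) by (metis not_le)
  define K where "K j = {v. mat_pow ?N j *v v = 0}" for j
  have sub: "vec.subspace (K j)" for j
    unfolding vec.subspace_def K_def by (auto simp: matrix_vector_right_distrib vec.scale)
  have "j \<le> r \<Longrightarrow> j \<le> vec.dim (K j)" for j
  proof (induction j)
    case (Suc j)
    \<comment> \<open>By minimality of r this vector is killed by the power j + 1 but not by the
      power j, which makes the inclusion of the kernels strict.\<close>
    let ?w = "mat_pow ?N (r - Suc j) *v v"
    have "?w \<in> K (Suc j)" "?w \<notin> K j"
      using r Suc.prems unfolding K_def mem_Collect_eq mat_pow_add_vec[symmetric] by auto
    moreover have "K j \<subseteq> K (Suc j)" unfolding K_def using gen_eigenspace_mono[of ?N j _ "Suc j"] by auto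
    ultimately have "K j \<subset> K (Suc j)" by blast
    then have "vec.span (K j) \<subset> vec.span (K (Suc j))"
      using sub by (metis vec.span_eq_iff)
    then have "vec.dim (K j) < vec.dim (K (Suc j))" by (rule vec.dim_psubset)
    then show ?case using Suc by simp
  qed simp
  then have "r \<le> vec.dim (K r)" by simp
  also have "\<dots> \<le> vec.dim ?W" by (rule vec.dim_subset) (auto simp: K_def gen_eigenspace_def)
  finally show False using less by simp
qed

lemma spectral_projection_commute:
  "B ** spectral_projection B \<mu> = spectral_projection B \<mu> ** B"
proof (rule matrix_eq_on_gen_eigenspaces[of B])
  fix \<nu> v assume "v \<in> gen_eigenspace B \<nu>"
  then show "(B ** spectral_projection B \<mu>) *v v = (spectral_projection B \<mu> ** B) *v v"
    using spectral_projection_on_gen[of v B \<nu> \<mu>] spectral_projection_on_gen[OF mult_gen_eigenspace, of v B \<nu> \<mu>]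
    by (simp flip: matrix_vector_mul_assoc)
qed

text \<open>After the nilpotent part L has been removed, B - L acts as the scalar \<mu> on the
  generalized eigenspace, and det (x - B) is unchanged. In a basis that extends one of this
  eigenspace, x - B + L multiplies each of the first basis vectors by x - \<mu>, so that (x -
  \<mu>)^dim splits off the determinant.\<close>

lemma dim_gen_eigenspace_le_alg_mult: "vec.dim (gen_eigenspace B \<mu>) \<le> alg_mult B \<mu>"
proof -
  let ?W = "gen_eigenspace B \<mu>" and ?N = "B - mat \<mu>" and ?Q = "spectral_projection B \<mu>"
  \<comment> \<open>The nilpotent part of B for \<mu>: it equals B - \<mu> on the generalized
    eigenspace and 0 on the complementary sum.\<close>
  define L where "L = ?N ** ?Q"
  have NQ: "?N ** ?Q = ?Q ** ?N"
    using spectral_projection_commute[of B \<mu>] mat_commute[of \<mu> ?Q]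
    by (simp add: matrix_sub_ldistrib matrix_sub_rdistrib)
  have "L ** B = B ** L"
    unfolding L_def using spectral_projection_commute[of B \<mu>] mat_commute[of \<mu> B]
    by (metis NQ matrix_mul_assoc matrix_sub_ldistrib matrix_sub_rdistrib)
  then have comm: "(mat x - B) ** L = L ** (mat x - B)" for x
    by (simp add: matrix_sub_ldistrib matrix_sub_rdistrib mat_commute)
  have LW: "mat_pow L k *v v = mat_pow ?N k *v (?Q *v v)" if "k > 0" for k v
    using that
  proof (induction k)
    case (Suc k)
    have Q: "?Q *v (mat_pow ?N k *v (?Q *v v)) = mat_pow ?N k *v (?Q *v v)"
      using spectral_projection_on_gen[of _ B \<mu> \<mu>] spectral_projection_spec[of B \<mu> v]
      by (metis pact_gen_eigenspace pact_linear_power)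
    show ?case
    proof (cases "k = 0")
      case True
      then show ?thesis by (simp add: mat_pow_Suc L_def matrix_vector_mul_assoc)
    next
      case False
      then show ?thesis using Suc.IH Q
        by (simp add: mat_pow_Suc_vec L_def flip: matrix_vector_mul_assoc)
    qed
  qed simp
  \<comment> \<open>The successor keeps the exponent positive even if the eigenspace is trivial; the
    formula for the powers of L fails for exponent 0, where the left side is the identity.\<close>
  have "mat_pow L (Suc (vec.dim ?W)) = 0"
    using LW[of "Suc (vec.dim ?W)"]
      mat_pow_dim_gen_eigenspace[OF conjunct1[OF spectral_projection_spec[of B \<mu>]]]
    by (simp add: matrix_eq mat_pow_Suc_vec)
  then have det_eq: "det (mat x - B) = det (mat x - B + L)" for x
    using det_add_nilpotent[OF comm] by metis
  obtain b1 where b1: "b1 \<subseteq> ?W" "vec.independent b1" "card b1 = vec.dim ?W"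
    by (rule vec.basis_exists)
  obtain b where b: "b1 \<subseteq> b" "vec.independent b" "UNIV \<subseteq> vec.span b"
    by (rule vec.maximal_independent_subset_extend[OF subset_UNIV b1(2)])
  have fin: "finite b" using b(2) vec.finiteI_independent by blast
  have "card b = CARD('a)"
    using vec.basis_card_eq_dim[of b UNIV] b by (simp add: card_cart_basis)
  then obtain h where h: "bij_betw h (UNIV :: 'a set) b"
    using finite_same_card_bij[of "UNIV :: 'a set" b] fin by auto
  \<comment> \<open>The columns of S are the basis vectors, indexed through the bijection h; I
    collects the columns in the generalized eigenspace.\<close>
  define S where "S = transpose (\<chi> i. h i)"
  define I where "I = {i. h i \<in> b1}"
  have "h ` I = b1" using h b(1) unfolding I_def bij_betw_def by auto
  then have cardI: "card I = vec.dim ?W"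
    using b1(3) h by (metis bij_betw_def card_image inj_on_subset subset_UNIV)
  have "det S \<noteq> 0"
    unfolding det_nonzero_iff_ker
  proof (intro allI impI)
    fix c assume "S *v c = 0"
    then have "(\<Sum>i\<in>UNIV. c$i *s h i) = 0"
      by (simp add: matrix_mult_sum S_def column_def transpose_def vec_lambda_eta)
    moreover have "(\<Sum>x\<in>b. c $ (inv h x) *s x) = (\<Sum>i\<in>UNIV. c$i *s h i)"
      using h by (simp add: sum.reindex_bij_betw[OF h, symmetric] bij_betw_def inv_f_f)
    ultimately have "\<forall>x\<in>b. c $ (inv h x) = 0"
      using b(2) fin vec.independentD[of b b "\<lambda>x. c $ (inv h x)"] by simp
    then show "c = 0" using h by (auto simp: vec_eq_iff bij_betw_def inv_f_f)
  qed
  \<comment> \<open>The transpose of (x - B + L) S as a matrix of polynomials in x, with the factor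
    x - \<mu> already taken out of the rows in I.\<close>
  define R where "R = (\<chi> i. \<chi> j. if i \<in> I then [:h i $ j:] else [:- ((B - L) *v h i) $ j, h i $ j:])"
  have "poly (charpoly B) x * det S = (x - \<mu>) ^ card I * poly (det R) x" for x
  proof -
    have row: "(mat x - B + L) *v h i = (x - \<mu>) *s h i" if "i \<in> I" for i
    proof -
      have "?Q *v h i = h i" using that b1(1) spectral_projection_on_gen[of "h i" B \<mu> \<mu>] by (auto simp: I_def)
      then have "L *v h i = ?N *v h i" by (simp add: L_def flip: matrix_vector_mul_assoc)
      then show ?thesis
        by (simp add: matrix_vector_mult_diff_rdistrib matrix_vector_mult_add_rdistrib mat_vec
            vec.scale_left_diff_distrib)
    qed
    have "poly (charpoly B) x * det S = det ((mat x - B + L) ** S)"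
      by (simp add: poly_charpoly det_eq det_mul)
    also have "(mat x - B + L) ** S = transpose (\<chi> i. (mat x - B + L) *v h i)"
      by (simp add: S_def vec_eq_iff matrix_matrix_mult_def matrix_vector_mult_def transpose_def)
    also have "det \<dots> = det (\<chi> i. (mat x - B + L) *v h i)" by (rule det_transpose)
    also have "(\<chi> i. (mat x - B + L) *v h i) =
        (\<chi> i. (if i \<in> I then x - \<mu> else 1) *s (map_matrix (\<lambda>q. poly q x) R $ i))"
      using row by (simp add: vec_eq_iff R_def map_matrix_def)
        (simp add: matrix_vector_mult_diff_rdistrib matrix_vector_mult_add_rdistrib mat_vec left_diff_distrib)
    also have "det \<dots> = (\<Prod>i\<in>UNIV. if i \<in> I then x - \<mu> else 1) * det (\<chi> i. map_matrix (\<lambda>q. poly q x) R $ i)"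
      by (rule det_rows_mul)
    also have "(\<Prod>i\<in>UNIV. if i \<in> I then x - \<mu> else 1) = (x - \<mu>) ^ card I"
      by (simp add: prod.If_cases)
    finally show ?thesis by (simp add: poly_det vec_lambda_eta)
  qed
  then have "poly (smult (det S) (charpoly B)) = poly ([:- \<mu>, 1:] ^ card I * det R)"
    by (intro ext) (simp add: mult.commute)
  then have "smult (det S) (charpoly B) = [:- \<mu>, 1:] ^ card I * det R"
    by (simp only: poly_eq_poly_eq_iff)
  then have "[:- \<mu>, 1:] ^ card I dvd charpoly B"
    using \<open>det S \<noteq> 0\<close> by (metis dvd_triv_left dvd_smult_cancel)
  then show ?thesis
    using charpoly_nonzero[of B] cardI unfolding alg_mult_def by (simp add: order_divides)
qed

lemma mat_pow_gen_eigenspace_alg_mult: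
  assumes "v \<in> gen_eigenspace B \<mu>" "alg_mult B \<mu> \<le> r"
  shows "mat_pow (B - mat \<mu>) r *v v = 0"
  by (rule gen_eigenspace_mono[OF mat_pow_dim_gen_eigenspace[OF assms(1)]
      order_trans[OF dim_gen_eigenspace_le_alg_mult assms(2)]])

text \<open>The dimension of the generalized eigenspace is squeezed between that of the eigenspace
  and the algebraic multiplicity, which coincide by assumption.\<close>

lemma semisimple_gen_eigenspace:
  assumes "semisimple_eigenvalue B \<mu>"
  shows "gen_eigenspace B \<mu> = eigenspace B \<mu>"
proof -
  have "vec.subspace (eigenspace B \<mu>)"
    unfolding vec.subspace_def eigenspace_def
    by (auto simp: matrix_vector_right_distrib vec.scale vec.scale_right_distrib mult.commute)
  then show ?thesis
    using assms dim_gen_eigenspace_le_alg_mult[of B \<mu>] eigenspace_subset_gen[of B \<mu>]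
      vec.subspace_dim_equal[of "eigenspace B \<mu>" "gen_eigenspace B \<mu>"] subspace_gen_eigenspace[of B \<mu>]
    by (simp add: semisimple_eigenvalue_def)
qed

subsection \<open>Powers on the spectral subspaces\<close>

text \<open>The binomial theorem for X = (X - \<mu>) + \<mu> in the commutative ring of polynomials,
  transported to matrices by \<open>pact\<close>.\<close>

lemma mat_pow_binomial:
  "mat_pow B n *v v = (\<Sum>r\<le>n. (of_nat (n choose r) * \<mu> ^ (n - r)) *s (mat_pow (B - mat \<mu>) r *v v))"
proof -
  have "monom 1 n = ([:- \<mu>, 1:] + [:\<mu>:]) ^ n"
    by (simp add: monom_altdef)
  also have "\<dots> = (\<Sum>r\<le>n. of_nat (n choose r) * [:- \<mu>, 1:] ^ r * [:\<mu>:] ^ (n - r))"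
    by (rule binomial_ring)
  also have "\<dots> = (\<Sum>r\<le>n. smult (of_nat (n choose r) * \<mu> ^ (n - r)) ([:- \<mu>, 1:] ^ r))"
    by (intro sum.cong refl) (simp add: of_nat_poly poly_const_pow mult.commute)
  finally have "pact B (monom 1 n) v = pact B (\<Sum>r\<le>n. smult (of_nat (n choose r) * \<mu> ^ (n - r)) ([:- \<mu>, 1:] ^ r)) v"
    by simp
  then show ?thesis by (simp add: pact_monom pact_sum pact_smult pact_linear_power)
qed

lemma mat_pow_gen_eigenspace:
  assumes "v \<in> gen_eigenspace B \<mu>" "\<mu> \<noteq> 0"
  shows "mat_pow B n *v v =
    (\<Sum>r<alg_mult B \<mu>. (\<mu> ^ n * (of_nat (n choose r) / \<mu> ^ r)) *s (mat_pow (B - mat \<mu>) r *v v))"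
proof -
  let ?g = "\<lambda>r. (\<mu> ^ n * (of_nat (n choose r) / \<mu> ^ r)) *s (mat_pow (B - mat \<mu>) r *v v)"
  have "mat_pow B n *v v = (\<Sum>r\<le>n. ?g r)"
    unfolding mat_pow_binomial[of B n v \<mu>] using assms(2)
    by (intro sum.cong refl) (simp add: power_diff mult.commute)
  \<comment> \<open>Neither range need contain the other, so both are compared with their union: the
    binomial coefficient vanishes for r > n, the power of B - \<mu> from \<open>alg_mult\<close>
    on.\<close>
  also have "\<dots> = (\<Sum>r\<in>{..n} \<union> {..<alg_mult B \<mu>}. ?g r)"
    by (rule sum.mono_neutral_left) (auto simp: binomial_eq_0)
  also have "\<dots> = (\<Sum>r<alg_mult B \<mu>. ?g r)"
    by (rule sum.mono_neutral_right) (auto simp: mat_pow_gen_eigenspace_alg_mult[OF assms(1)])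
  finally show ?thesis .
qed

lemma matrix_vector_mult_sum_rdistrib: "(\<Sum>i\<in>A. M i) *v v = (\<Sum>i\<in>A. M i *v (v::'a::comm_ring_1^'n))"
  by (induction A rule: infinite_finite_induct) (simp_all add: matrix_vector_mult_add_rdistrib)

text \<open>Replaces the polynomials p_j by plain powers of B. From here on the families G^1 and G^2
  are those of B^n times a projection.\<close>

lemma spectral_term_eq: "spectral_term B \<mu> n = mat_pow B n ** spectral_projection B \<mu>"
proof (cases "\<mu> = 0")
  case False
  have "spectral_term B \<mu> n *v v = (mat_pow B n ** spectral_projection B \<mu>) *v v" for v
    using False mat_pow_gen_eigenspace[OF conjunct1[OF spectral_projection_spec[of B \<mu> v]] False, of n]
    by (simp add: spectral_term_def spectral_poly_def matrix_vector_mult_sum_rdistrib mat_vec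
        vec.scale_sum_right flip: matrix_vector_mul_assoc)
  then show ?thesis by (simp add: matrix_eq)
qed (simp add: spectral_term_def)

lemma semisimple_spectral_term:
  assumes "semisimple_eigenvalue B \<mu>"
  shows "spectral_term B \<mu> n = mat (\<mu> ^ n) ** spectral_projection B \<mu>"
proof -
  have eig: "B *v v = \<mu> *s v" if "v \<in> gen_eigenspace B \<mu>" for v
    using that by (simp add: semisimple_gen_eigenspace[OF assms] eigenspace_def)
  have "mat_pow B n *v v = \<mu> ^ n *s v" if "v \<in> gen_eigenspace B \<mu>" for v
    by (induction n) (simp_all add: mat_pow_Suc_vec vec.scale eig[OF that] mult.commute)
  then have "spectral_term B \<mu> n *v v = (mat (\<mu> ^ n) ** spectral_projection B \<mu>) *v v" for v
    using spectral_projection_spec[of B \<mu> v]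
    by (simp add: spectral_term_eq mat_vec flip: matrix_vector_mul_assoc)
  then show ?thesis by (simp add: matrix_eq)
qed

text \<open>With s the root of order r + 1 of the modulus of \<mu>, the sequence is dominated by
  n^(r+1) s^((r+1) n), that is by (n s^n)^(r+1), and n s^n tends to 0 for s < 1.\<close>

lemma binomial_times_power_tendsto_0:
  fixes \<mu> :: complex
  assumes "norm \<mu> < 1"
  shows "(\<lambda>n. \<mu> ^ n * of_nat (n choose r)) \<longlonglongrightarrow> 0"
proof (rule tendsto_norm_zero_cancel)
  define s where "s = root (Suc r) (norm \<mu>)"
  have s: "0 \<le> s" "s < 1" "s ^ Suc r = norm \<mu>"
    unfolding s_def using assms real_root_lt_1_iff[of "Suc r" "norm \<mu>"]
    by (auto simp del: power_Suc intro!: real_root_pow_pos2)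
  have "(\<lambda>n. (real n * s ^ n) ^ Suc r) \<longlonglongrightarrow> 0 ^ Suc r"
    using s by (intro tendsto_power powser_times_n_limit_0) simp
  then have lim: "(\<lambda>n. (real n * s ^ n) ^ Suc r) \<longlonglongrightarrow> 0" by simp
  show "(\<lambda>n. norm (\<mu> ^ n * of_nat (n choose r))) \<longlonglongrightarrow> 0"
  proof (rule tendsto_sandwich[OF _ _ tendsto_const lim])
    show "\<forall>\<^sub>F n in sequentially. norm (\<mu> ^ n * of_nat (n choose r)) \<le> (real n * s ^ n) ^ Suc r"
    proof (rule eventually_sequentiallyI)
      fix n :: nat assume "1 \<le> n"
      have "real (n choose r) \<le> real n ^ r"
        by (metis binomial_le_pow binomial_eq_0_iff not_le of_nat_0 of_nat_0_le_iff of_nat_le_iff of_nat_power zero_le_power)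
      also have "\<dots> \<le> real n ^ Suc r" using \<open>1 \<le> n\<close> by (intro power_increasing) auto
      finally have "norm \<mu> ^ n * real (n choose r) \<le> norm \<mu> ^ n * real n ^ Suc r"
        by (intro mult_left_mono) auto
      also have "\<dots> = (real n * s ^ n) ^ Suc r"
        by (simp only: s(3)[symmetric] power_mult_distrib power_mult[symmetric] mult.commute)
      finally show "norm (\<mu> ^ n * of_nat (n choose r)) \<le> (real n * s ^ n) ^ Suc r"
        by (simp add: norm_mult norm_power)
    qed
  qed simp
qed

lemma mat_pow_spectral_projection_tendsto_0:
  assumes "norm \<mu> < 1"
  shows "(\<lambda>n. mat_pow B n *v (spectral_projection B \<mu> *v v)) \<longlonglongrightarrow> 0"
proof -
  have w: "spectral_projection B \<mu> *v v \<in> gen_eigenspace B \<mu>" (is "?w \<in> _")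
    using spectral_projection_spec by blast
  show ?thesis
  proof (cases "\<mu> = 0")
    \<comment> \<open>The expansion divides by powers of \<mu>. For \<mu> = 0 nilpotency takes over:
      the sequence is eventually 0.\<close>
    case True
    then have "mat_pow B n *v ?w = 0" if "n \<ge> alg_mult B \<mu>" for n
      using mat_pow_gen_eigenspace_alg_mult[OF w that] by simp
    then show ?thesis by (intro tendsto_eventually eventually_sequentiallyI) blast
  next
    case False
    have "(\<lambda>n. (\<mu> ^ n * (of_nat (n choose r) / \<mu> ^ r)) *s u) \<longlonglongrightarrow> 0" for r and u :: "complex^'a"
    proof (rule tendsto_norm_zero_cancel)
      have "(\<lambda>n. norm (\<mu> ^ n * of_nat (n choose r)) * (norm u / norm (\<mu> ^ r))) \<longlonglongrightarrow> 0"
        using tendsto_mult_left_zero[OF tendsto_norm_zero[OF binomial_times_power_tendsto_0[OF assms]]] .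
      then show "(\<lambda>n. norm ((\<mu> ^ n * (of_nat (n choose r) / \<mu> ^ r)) *s u)) \<longlonglongrightarrow> 0"
        by (simp add: norm_vector_smult norm_mult norm_divide norm_power)
    qed
    then show ?thesis
      unfolding mat_pow_gen_eigenspace[OF w False] by (intro tendsto_null_sum) blast
  qed
qed


section \<open>Projections onto groups of eigenvalues\<close>

definition spectral_sum :: "complex^'n^'n \<Rightarrow> (nat \<Rightarrow> complex) \<Rightarrow> nat set \<Rightarrow> complex^'n^'n" where
  "spectral_sum B lam J = (\<Sum>j\<in>J. spectral_projection B (lam j))"

text \<open>Injectivity of \<open>lam\<close> leaves at most one summand that acts as the identity;
  the others vanish.\<close>

lemma spectral_sum_on_gen:
  assumes "inj_on lam K" "J \<subseteq> K" "finite K" "i \<in> K" "v \<in> gen_eigenspace B (lam i)"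
  shows "spectral_sum B lam J *v v = (if i \<in> J then v else 0)"
proof -
  have "spectral_projection B (lam j) *v v = (if j = i then v else 0)" if "j \<in> J" for j
    using spectral_projection_on_gen[OF assms(5), of "lam j"] inj_onD[OF assms(1), of i j] assms that by auto
  then have "spectral_sum B lam J *v v = (\<Sum>j\<in>J. if j = i then v else 0)"
    by (simp add: spectral_sum_def matrix_vector_mult_sum_rdistrib)
  then show ?thesis using finite_subset[OF assms(2,3)] by simp
qed

lemma spectral_sum_UNIV:
  assumes "inj_on lam K" "finite K" "lam ` K = eigenvalues B"
  shows "spectral_sum B lam K = mat 1"
proof (rule matrix_eq_on_gen_eigenspaces[of B])
  fix \<mu> v assume "\<mu> \<in> eigenvalues B" and v: "v \<in> gen_eigenspace B \<mu>"
  then obtain i where "i \<in> K" "\<mu> = lam i" using assms(3) by auto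
  then show "spectral_sum B lam K *v v = mat 1 *v v"
    using spectral_sum_on_gen[OF assms(1) order_refl assms(2)] v by simp
qed

lemma spectral_sum_mult:
  assumes "inj_on lam K" "finite K" "lam ` K = eigenvalues B" "J \<subseteq> K" "J' \<subseteq> K"
  shows "spectral_sum B lam J ** spectral_sum B lam J' = spectral_sum B lam (J \<inter> J')"
proof (rule matrix_eq_on_gen_eigenspaces[of B])
  fix \<mu> v assume "\<mu> \<in> eigenvalues B" and v: "v \<in> gen_eigenspace B \<mu>"
  then obtain i where i: "i \<in> K" "\<mu> = lam i" using assms(3) by auto
  have sub: "J \<inter> J' \<subseteq> K" using assms by blast
  show "(spectral_sum B lam J ** spectral_sum B lam J') *v v = spectral_sum B lam (J \<inter> J') *v v"
    using spectral_sum_on_gen[OF assms(1) assms(4,2) i(1) v[unfolded i(2)]]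
      spectral_sum_on_gen[OF assms(1) assms(5,2) i(1) v[unfolded i(2)]]
      spectral_sum_on_gen[OF assms(1) sub assms(2) i(1) v[unfolded i(2)]]
    by (simp flip: matrix_vector_mul_assoc)
qed

lemma spectral_sum_empty [simp]: "spectral_sum B lam {} = 0"
  by (simp add: spectral_sum_def)

lemma mat_pow_spectral_sum_commute:
  "mat_pow B n ** spectral_sum B lam J = spectral_sum B lam J ** mat_pow B n"
proof -
  have "spectral_projection B \<mu> ** B = B ** spectral_projection B \<mu>" for \<mu>
    by (simp add: spectral_projection_commute)
  then have "spectral_projection B \<mu> ** mat_pow B n = mat_pow B n ** spectral_projection B \<mu>" for \<mu>
    by (rule mat_pow_commute)
  then have "mat_pow B n *v (spectral_projection B \<mu> *v v) = spectral_projection B \<mu> *v (mat_pow B n *v v)" for \<mu> v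
    by (simp add: matrix_vector_mul_assoc)
  then show ?thesis
    by (simp add: matrix_eq spectral_sum_def matrix_vector_mult_sum_rdistrib vec.sum
        flip: matrix_vector_mul_assoc)
qed

lemma sum_spectral_term:
  "(\<Sum>j\<in>J. spectral_term B (lam j) n *v v) = mat_pow B n *v (spectral_sum B lam J *v v)"
  by (simp add: spectral_sum_def spectral_term_eq matrix_vector_mult_sum_rdistrib vec.sum
      flip: matrix_vector_mul_assoc)

lemma mat_pow_spectral_sum_tendsto_0:
  assumes "\<forall>j\<in>J. norm (lam j) < 1"
  shows "(\<lambda>n. mat_pow B n *v (spectral_sum B lam J *v v)) \<longlonglongrightarrow> 0"
  unfolding spectral_sum_def matrix_vector_mult_sum_rdistrib vec.sum
  using assms by (intro tendsto_null_sum mat_pow_spectral_projection_tendsto_0) blast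


subsection \<open>The integrand of the norm\<close>

text \<open>The p-th power of the l^p norm on the finite dimensional space, so that
  \<open>Xnorm\<close> is the p-th root of its integral.\<close>

definition psum :: "real \<Rightarrow> complex^'n \<Rightarrow> real" where
  "psum p v = (\<Sum>i\<in>UNIV. norm (v $ i) powr p)"

lemma psum_nonneg [simp]: "0 \<le> psum p v"
  by (simp add: psum_def sum_nonneg)

lemma psum_component: "norm (v $ i) powr p \<le> psum p v"
  unfolding psum_def by (rule member_le_sum) auto

lemma psum_eq_0_iff: "psum p v = 0 \<longleftrightarrow> v = 0"
  by (simp add: psum_def sum_nonneg_eq_0_iff vec_eq_iff)

lemma psum_scale: "psum p (c *s v) = norm c powr p * psum p v"
  by (simp add: psum_def norm_mult powr_mult sum_distrib_left)

lemma powr_add_le: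
  fixes a b p :: real
  assumes "0 \<le> a" "0 \<le> b" "0 \<le> p"
  shows "(a + b) powr p \<le> 2 powr p * (a powr p + b powr p)"
proof -
  have "(a + b) powr p \<le> (2 * max a b) powr p" using assms by (intro powr_mono2) auto
  also have "\<dots> = 2 powr p * (max a b) powr p" using assms by (simp add: powr_mult)
  also have "(max a b) powr p \<le> a powr p + b powr p" by (simp add: max_def)
  finally show ?thesis by simp
qed

lemma psum_add_le:
  assumes "0 \<le> p" shows "psum p (v + w) \<le> 2 powr p * (psum p v + psum p w)"
proof -
  have "norm ((v + w) $ i) powr p \<le> 2 powr p * (norm (v $ i) powr p + norm (w $ i) powr p)" for i
    using assms by (intro order_trans[OF powr_mono2 powr_add_le]) (auto simp: norm_triangle_ineq)
  then show ?thesis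
    unfolding psum_def sum.distrib[symmetric] sum_distrib_left by (intro sum_mono)
qed

lemma psum_le_norm:
  assumes "0 \<le> p" shows "psum p (v::complex^'n) \<le> CARD('n) * norm v powr p"
proof -
  have "psum p v \<le> (\<Sum>i\<in>(UNIV::'n set). norm v powr p)"
    unfolding psum_def using assms by (intro sum_mono powr_mono2) (auto simp: Finite_Cartesian_Product.norm_nth_le)
  then show ?thesis by simp
qed

text \<open>The entrywise l^1 norm. It dominates every row sum, and it tends to 0 as soon as all
  entries do.\<close>

definition matsum :: "complex^'n^'n \<Rightarrow> real" where
  "matsum M = (\<Sum>i\<in>UNIV. \<Sum>l\<in>UNIV. norm (M $ i $ l))"

lemma matsum_nonneg [simp]: "0 \<le> matsum M"
  by (simp add: matsum_def sum_nonneg)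

lemma psum_matrix_le:
  assumes "1 \<le> p" shows "psum p (M *v (v::complex^'n)) \<le> CARD('n) * matsum M powr p * psum p v"
proof -
  let ?m = "psum p v powr (1 / p)"
  have m: "norm (v $ l) \<le> ?m" for l
    using powr_mono2[OF _ _ psum_component[of v l p], of "1 / p"] assms by (simp add: powr_powr)
  have "norm ((M *v v) $ i) powr p \<le> matsum M powr p * psum p v" for i
  proof -
    have "norm ((M *v v) $ i) \<le> (\<Sum>l\<in>UNIV. norm (M $ i $ l) * norm (v $ l))"
      unfolding matrix_vector_mult_def by (simp add: norm_mult[symmetric] norm_sum)
    also have "\<dots> \<le> (\<Sum>l\<in>UNIV. norm (M $ i $ l)) * ?m"
      unfolding sum_distrib_right by (intro sum_mono mult_left_mono m) auto
    also have "\<dots> \<le> matsum M * ?m"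
      unfolding matsum_def by (intro mult_right_mono member_le_sum) (auto simp: sum_nonneg)
    finally have "norm ((M *v v) $ i) powr p \<le> (matsum M * ?m) powr p"
      using assms by (intro powr_mono2) auto
    then show ?thesis using assms by (simp add: powr_mult powr_powr)
  qed
  then have "psum p (M *v v) \<le> (\<Sum>i\<in>(UNIV::'n set). matsum M powr p * psum p v)"
    unfolding psum_def[of p "M *v v"] by (intro sum_mono)
  then show ?thesis by simp
qed

text \<open>Convexity of the p-th power on the positive axis. If one of the arguments is 0, the
  inequality reduces to t^p \<le> t for 0 < t < 1.\<close>

lemma powr_convex_comb:
  fixes a b \<theta> p :: real
  assumes "0 \<le> a" "0 \<le> b" "0 < \<theta>" "\<theta> < 1" "1 \<le> p"
  shows "(\<theta> * a + (1 - \<theta>) * b) powr p \<le> \<theta> * a powr p + (1 - \<theta>) * b powr p"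
proof (cases "a = 0 \<or> b = 0")
  case True
  have le: "t powr p \<le> t" if "0 < t" "t < 1" for t :: real
    using powr_mono'[of 1 p t] that assms by simp
  have "(t * c) powr p \<le> t * c powr p" if "0 < t" "t < 1" "0 \<le> c" for t c
    using mult_right_mono[OF le[OF that(1,2)], of "c powr p"] that by (simp add: powr_mult)
  then show ?thesis using True assms by auto
next
  case False
  then show ?thesis
    using convex_onD[OF powr_convex[OF assms(5)], of "1 - \<theta>" a b] assms by auto
qed

subsection \<open>The seminorm of \<open>X\<^sub>p\<close>\<close>

lemma Xnorm_psum: "Xnorm p f = (LINT x|I01. psum p (f x)) powr (1 / p)"
  by (simp add: Xnorm_def psum_def)

lemma Xnorm_nonneg [simp]: "0 \<le> Xnorm p f"
  by (simp add: Xnorm_def)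

lemma borel_measurable_nth [measurable (raw)]:
  "f \<in> borel_measurable M \<Longrightarrow> (\<lambda>x. (f x :: complex^'n) $ i) \<in> borel_measurable M"
  by (rule measurable_compose[OF _ borel_measurable_continuous_onI]) (auto intro: continuous_intros)

lemma borel_measurable_matrix_vector [measurable (raw)]:
  "f \<in> borel_measurable M \<Longrightarrow> (\<lambda>x. A *v (f x :: complex^'n)) \<in> borel_measurable M"
  by (rule measurable_compose[OF _ borel_measurable_continuous_onI])
    (auto intro: linear_continuous_on linear_linear[THEN iffD2] matrix_vector_mul_linear)

lemma borel_measurable_psum [measurable (raw)]:
  "f \<in> borel_measurable M \<Longrightarrow> (\<lambda>x. psum p (f x)) \<in> borel_measurable M"
  unfolding psum_def by measurable

lemma borel_measurable_vec_lambda: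
  assumes "\<And>i. (\<lambda>x. f x i) \<in> borel_measurable M"
  shows "(\<lambda>x. (\<chi> i. f x i) :: complex^'n) \<in> borel_measurable M"
proof -
  have eq: "(\<lambda>x. (\<chi> i. f x i) :: complex^'n) = (\<lambda>x. \<Sum>i\<in>UNIV. axis i (f x i))"
    by (auto simp: fun_eq_iff vec_eq_iff axis_def sum.delta if_distrib cong: if_cong)
  have "continuous_on UNIV (\<lambda>x :: complex. if j = i then x else 0)" for i j :: 'n
    by (cases "j = i") (auto intro: continuous_intros)
  then have axis: "continuous_on UNIV (axis i :: complex \<Rightarrow> complex^'n)" for i
    unfolding axis_def by (intro continuous_on_vec_lambda)
  show ?thesis
    unfolding eq
    by (rule borel_measurable_sum)
      (rule measurable_compose[OF assms borel_measurable_continuous_onI[OF axis]])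
qed

lemma Xp_iff: "f \<in> Xp p \<longleftrightarrow> f \<in> borel_measurable I01 \<and> integrable I01 (\<lambda>x. psum p (f x))"
proof safe
  assume "f \<in> Xp p"
  then show "f \<in> borel_measurable I01" "integrable I01 (\<lambda>x. psum p (f x))"
    by (simp_all add: Xp_def psum_def)
next
  assume f: "f \<in> borel_measurable I01" "integrable I01 (\<lambda>x. psum p (f x))"
  have "integrable I01 (\<lambda>x. norm (f x $ i) powr p)" for i
    by (rule Bochner_Integration.integrable_bound[OF f(2)])
      (use f(1) in \<open>auto simp: psum_component\<close>)
  then show "f \<in> Xp p" using f by (simp add: Xp_def)
qed

lemma XpD: "f \<in> Xp p \<Longrightarrow> f \<in> borel_measurable I01" "f \<in> Xp p \<Longrightarrow> integrable I01 (\<lambda>x. psum p (f x))"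
  by (simp_all add: Xp_iff)

lemma Xp_dominated:
  assumes "g \<in> borel_measurable I01" "integrable I01 h" "AE x in I01. psum p (g x) \<le> h x"
  shows "g \<in> Xp p"
proof -
  have "AE x in I01. norm (psum p (g x)) \<le> norm (h x)"
    using assms(3) by eventually_elim (use psum_nonneg order_trans in fastforce)
  then show ?thesis
    unfolding Xp_iff
    using assms(1) Bochner_Integration.integrable_bound[OF assms(2) borel_measurable_psum[OF assms(1)]] by blast
qed

lemma Xp_add: "0 \<le> p \<Longrightarrow> f \<in> Xp p \<Longrightarrow> g \<in> Xp p \<Longrightarrow> (\<lambda>x. f x + g x) \<in> Xp p"
  by (rule Xp_dominated[where h = "\<lambda>x. 2 powr p * (psum p (f x) + psum p (g x))"])
    (simp_all add: psum_add_le XpD borel_measurable_add)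

lemma borel_measurable_vector_smult [measurable (raw)]:
  "f \<in> borel_measurable M \<Longrightarrow> (\<lambda>x. c *s (f x :: complex^'n)) \<in> borel_measurable M"
  using borel_measurable_matrix_vector[of f M "mat c"] by (simp add: mat_vec)

lemma Xp_scale: "f \<in> Xp p \<Longrightarrow> (\<lambda>x. c *s f x) \<in> Xp p"
  by (auto simp: Xp_iff psum_scale borel_measurable_vector_smult)

lemma Xp_diff: "0 \<le> p \<Longrightarrow> f \<in> Xp p \<Longrightarrow> g \<in> Xp p \<Longrightarrow> (\<lambda>x. f x - g x) \<in> Xp p"
  using Xp_add[OF _ _ Xp_scale[of g p "-1"], of f] by (simp add: vector_smult_lneg)

lemma Xp_0 [simp]: "(\<lambda>x. 0 :: complex^'a) \<in> Xp p"
  using psum_eq_0_iff[of p "0 :: complex^'a"] by (simp add: Xp_iff)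

lemma ae_eq_refl [simp]: "f =\<^sub>a\<^sub>e f"
  by (simp add: ae_eq_def)

lemma ae_eq_sym: "f =\<^sub>a\<^sub>e g \<Longrightarrow> g =\<^sub>a\<^sub>e f"
  unfolding ae_eq_def by (auto elim: AE_mp)

lemma ae_eq_trans [trans]: "f =\<^sub>a\<^sub>e g \<Longrightarrow> g =\<^sub>a\<^sub>e h \<Longrightarrow> f =\<^sub>a\<^sub>e h"
  unfolding ae_eq_def by (auto elim: AE_mp)

lemma ae_eq_lift2: "f =\<^sub>a\<^sub>e f' \<Longrightarrow> g =\<^sub>a\<^sub>e g' \<Longrightarrow> (\<lambda>x. F (f x) (g x)) =\<^sub>a\<^sub>e (\<lambda>x. F (f' x) (g' x))"
  unfolding ae_eq_def by (auto elim: AE_mp)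

lemma ae_eq_lift: "f =\<^sub>a\<^sub>e f' \<Longrightarrow> (\<lambda>x. F (f x)) =\<^sub>a\<^sub>e (\<lambda>x. F (f' x))"
  unfolding ae_eq_def by (auto elim: AE_mp)

lemma Xnorm_cong:
  assumes "f \<in> Xp p" "g \<in> Xp p" "f =\<^sub>a\<^sub>e g" shows "Xnorm p f = Xnorm p g"
  unfolding Xnorm_psum using assms(3)
  by (intro arg_cong[where f = "\<lambda>y. y powr _"] integral_cong_AE)
    (auto simp: ae_eq_def elim: AE_mp intro!: borel_measurable_psum XpD assms)

lemma Xnorm_mono:
  assumes "1 \<le> p" "f \<in> Xp p" "g \<in> Xp p" "0 \<le> C" "AE x in I01. psum p (f x) \<le> C powr p * psum p (g x)"
  shows "Xnorm p f \<le> C * Xnorm p g"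
proof -
  have "(LINT x|I01. psum p (f x)) \<le> (LINT x|I01. C powr p * psum p (g x))"
    using assms by (intro integral_mono_AE integrable_mult_right XpD) auto
  then have "Xnorm p f \<le> (C powr p * (LINT x|I01. psum p (g x))) powr (1 / p)"
    unfolding Xnorm_psum using assms by (intro powr_mono2) (auto simp: integral_nonneg_AE)
  then show ?thesis using assms by (simp add: Xnorm_psum powr_mult powr_powr)
qed

lemma Xnorm_eq_0_iff:
  assumes "1 \<le> p" "f \<in> Xp p" shows "Xnorm p f = 0 \<longleftrightarrow> f =\<^sub>a\<^sub>e (\<lambda>x. 0)"
proof -
  have "Xnorm p f = 0 \<longleftrightarrow> (LINT x|I01. psum p (f x)) = 0"
    using assms by (simp add: Xnorm_psum powr_eq_0_iff)
  also have "\<dots> \<longleftrightarrow> (AE x in I01. psum p (f x) = 0)"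
    using assms by (intro integral_nonneg_eq_0_iff_AE XpD) auto
  finally show ?thesis by (simp add: ae_eq_def psum_eq_0_iff)
qed

lemma Xnorm_scale:
  assumes "1 \<le> p" shows "Xnorm p (\<lambda>x. c *s f x) = norm c * Xnorm p f"
  using assms by (simp add: Xnorm_psum psum_scale powr_mult powr_powr)

lemma integral_psum_le:
  assumes "1 \<le> p" "f \<in> Xp p" "Xnorm p f < a"
  shows "(LINT x|I01. psum p (f x)) \<le> a powr p"
proof -
  have "(LINT x|I01. psum p (f x)) = Xnorm p f powr p"
    using assms(1) by (simp add: Xnorm_psum powr_powr integral_nonneg_AE)
  also have "\<dots> \<le> a powr p" using assms by (intro powr_mono2) auto
  finally show ?thesis .
qed

text \<open>Minkowski's inequality by convexity. Let a and b be strict upper bounds of the two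
  norms, hence positive. With \<theta> = a / (a + b) the sum v + w is a + b times the convex
  combination of v / a and w / b, and the integrals of the p-th powers of f / a and g / b are at
  most 1. Finally a and b approach the norms.\<close>

lemma Xnorm_triangle:
  assumes p: "1 \<le> p" and f: "f \<in> Xp p" and g: "g \<in> Xp p"
  shows "Xnorm p (\<lambda>x. f x + g x) \<le> Xnorm p f + Xnorm p g"
proof -
  have *: "Xnorm p (\<lambda>x. f x + g x) \<le> a + b" if ab: "Xnorm p f < a" "Xnorm p g < b" for a b
  proof -
    have pos: "0 < a" "0 < b" using ab Xnorm_nonneg[of p f] Xnorm_nonneg[of p g] by linarith+
    let ?\<theta> = "a / (a + b)"
    have \<theta>: "0 < ?\<theta>" "?\<theta> < 1" "1 - ?\<theta> = b / (a + b)" using pos by (auto simp: field_simps)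
    have comp: "norm ((v + w) $ i) powr p \<le>
        (a + b) powr p * (?\<theta> * (norm (v $ i) powr p / a powr p) + (1 - ?\<theta>) * (norm (w $ i) powr p / b powr p))"
      for v w :: "complex^'a" and i
    proof -
      have "norm ((v + w) $ i) powr p \<le> (norm (v $ i) + norm (w $ i)) powr p"
        using p by (intro powr_mono2) (auto simp: norm_triangle_ineq)
      also have "norm (v $ i) + norm (w $ i) =
          (a + b) * (?\<theta> * (norm (v $ i) / a) + (1 - ?\<theta>) * (norm (w $ i) / b))"
        unfolding \<theta>(3) using pos by (simp add: distrib_left)
      also have "\<dots> powr p = (a + b) powr p * (?\<theta> * (norm (v $ i) / a) + (1 - ?\<theta>) * (norm (w $ i) / b)) powr p"
        by (rule powr_mult)
      also have "\<dots> \<le> (a + b) powr p * (?\<theta> * (norm (v $ i) / a) powr p + (1 - ?\<theta>) * (norm (w $ i) / b) powr p)"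
        using pos \<theta> p by (intro mult_left_mono powr_convex_comb) auto
      finally show ?thesis using pos by (simp add: powr_divide)
    qed
    have "psum p (v + w) \<le> (a + b) powr p * (?\<theta> * (psum p v / a powr p) + (1 - ?\<theta>) * (psum p w / b powr p))"
      for v w :: "complex^'a"
    proof -
      have "psum p (v + w) \<le> (\<Sum>i\<in>UNIV. (a + b) powr p * (?\<theta> * (norm (v $ i) powr p / a powr p)
          + (1 - ?\<theta>) * (norm (w $ i) powr p / b powr p)))"
        unfolding psum_def by (intro sum_mono comp)
      then show ?thesis
        by (simp only: psum_def sum_distrib_left[symmetric] sum.distrib sum_divide_distrib[symmetric])
    qed
    then have "(LINT x|I01. psum p (f x + g x)) \<le>
        (LINT x|I01. (a + b) powr p * (?\<theta> * (psum p (f x) / a powr p) + (1 - ?\<theta>) * (psum p (g x) / b powr p)))"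
      using Xp_add[OF _ f g] p XpD f g
      by (intro integral_mono integrable_mult_right Bochner_Integration.integrable_add integrable_divide) auto
    also have "\<dots> = (a + b) powr p * (?\<theta> * ((LINT x|I01. psum p (f x)) / a powr p)
        + (1 - ?\<theta>) * ((LINT x|I01. psum p (g x)) / b powr p))"
      using XpD(2)[OF f] XpD(2)[OF g] by simp
    also have "\<dots> \<le> (a + b) powr p * (?\<theta> * 1 + (1 - ?\<theta>) * 1)"
      using integral_psum_le[OF p f ab(1)] integral_psum_le[OF p g ab(2)] pos \<theta>
      by (intro mult_left_mono add_mono) auto
    finally have "(LINT x|I01. psum p (f x + g x)) \<le> (a + b) powr p" by simp
    then have "Xnorm p (\<lambda>x. f x + g x) \<le> ((a + b) powr p) powr (1 / p)"
      unfolding Xnorm_psum using p by (intro powr_mono2) (auto simp: integral_nonneg_AE)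
    then show ?thesis using p pos by (simp add: powr_powr)
  qed
  show ?thesis
  proof (rule field_le_epsilon)
    fix e :: real assume "0 < e"
    then show "Xnorm p (\<lambda>x. f x + g x) \<le> Xnorm p f + Xnorm p g + e"
      using *[of "Xnorm p f + e / 2" "Xnorm p g + e / 2"] by simp
  qed
qed

lemma Xnorm_diff_commute: "Xnorm p (\<lambda>x. f x - g x) = Xnorm p (\<lambda>x. g x - f x)"
  by (simp add: Xnorm_def norm_minus_commute)

lemma Xnorm_triangle_diff:
  assumes "1 \<le> p" "f \<in> Xp p" "g \<in> Xp p" "h \<in> Xp p"
  shows "Xnorm p (\<lambda>x. f x - h x) \<le> Xnorm p (\<lambda>x. f x - g x) + Xnorm p (\<lambda>x. g x - h x)"
  using Xnorm_triangle[OF assms(1), of "\<lambda>x. f x - g x" "\<lambda>x. g x - h x"] assms by (simp add: Xp_diff)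

lemma Xnorm_bounded:
  assumes p: "1 \<le> p" and f: "f \<in> borel_measurable I01" and C: "\<And>x. x \<in> {0<..<1} \<Longrightarrow> norm (f x :: complex^'n) \<le> C"
  shows "f \<in> Xp p" "Xnorm p f \<le> CARD('n) powr (1 / p) * C"
proof -
  have C0: "0 \<le> C" using order_trans[OF norm_ge_zero C[of "1/2"]] by simp
  have le: "psum p (f x) \<le> CARD('n) * C powr p" if "x \<in> {0<..<1}" for x
    using p C[OF that] C0 by (intro order_trans[OF psum_le_norm] mult_left_mono powr_mono2) auto
  have fin: "finite_measure I01" by (intro finite_measureI) (simp add: emeasure_restrict_space)
  then have int: "integrable I01 (\<lambda>x. CARD('n) * C powr p)"
    by (simp add: finite_measure.integrable_const)
  show Xp: "f \<in> Xp p"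
    by (rule Xp_dominated[OF f int]) (use le in auto)
  have "(LINT x|I01. psum p (f x)) \<le> (LINT x|I01. CARD('n) * C powr p)"
    using le by (intro integral_mono XpD Xp int) auto
  also have "\<dots> = CARD('n) * C powr p"
    by (simp add: measure_restrict_space)
  finally have "Xnorm p f \<le> (CARD('n) * C powr p) powr (1 / p)"
    unfolding Xnorm_psum using p by (intro powr_mono2) (auto simp: integral_nonneg_AE)
  then show "Xnorm p f \<le> CARD('n) powr (1 / p) * C" using p C0 by (simp add: powr_mult powr_powr)
qed

section \<open>Bounded operators acting on representatives\<close>

lemma bounded_operatorD:
  assumes "bounded_operator p T" "f \<in> Xp p"
  shows "T f \<in> Xp p"
    and "g \<in> Xp p \<Longrightarrow> f =\<^sub>a\<^sub>e g \<Longrightarrow> T f =\<^sub>a\<^sub>e T g"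
    and "g \<in> Xp p \<Longrightarrow> T (\<lambda>x. f x + g x) =\<^sub>a\<^sub>e (\<lambda>x. T f x + T g x)"
    and "T (\<lambda>x. c *s f x) =\<^sub>a\<^sub>e (\<lambda>x. c *s T f x)"
  using assms by (simp_all add: bounded_operator_def)

lemma bounded_operator_bound:
  fixes T :: "(real \<Rightarrow> complex^'n) \<Rightarrow> (real \<Rightarrow> complex^'n)"
  assumes "bounded_operator p T"
  obtains C where "0 \<le> C" "\<And>f. f \<in> Xp p \<Longrightarrow> Xnorm p (T f) \<le> C * Xnorm p f"
proof -
  obtain C where C: "\<And>f. f \<in> Xp p \<Longrightarrow> Xnorm p (T f) \<le> C * Xnorm p f"
    using assms unfolding bounded_operator_def by blast
  have "Xnorm p (T f) \<le> max C 0 * Xnorm p f" if "f \<in> Xp p" for f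
    by (rule order_trans[OF C[OF that]]) (simp add: mult_right_mono)
  then show ?thesis by (intro that[of "max C 0"]) auto
qed

lemma bounded_operator_diff:
  assumes T: "bounded_operator p T" and f: "f \<in> Xp p" and g: "g \<in> Xp p"
  shows "T (\<lambda>x. f x - g x) =\<^sub>a\<^sub>e (\<lambda>x. T f x - T g x)"
proof -
  have "T (\<lambda>x. f x + (-1) *s g x) =\<^sub>a\<^sub>e (\<lambda>x. T f x + T (\<lambda>x. (-1) *s g x) x)"
    by (rule bounded_operatorD(3)[OF T f Xp_scale[OF g]])
  moreover have "T (\<lambda>x. (-1) *s g x) =\<^sub>a\<^sub>e (\<lambda>x. (-1) *s T g x)"
    by (rule bounded_operatorD(4)[OF T g])
  ultimately have "T (\<lambda>x. f x + (-1) *s g x) =\<^sub>a\<^sub>e (\<lambda>x. T f x - T g x)"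
    unfolding ae_eq_def by eventually_elim (simp add: vector_smult_lneg)
  then show ?thesis by (simp add: vector_smult_lneg)
qed

lemma bounded_operator_diff_le:
  assumes T: "bounded_operator p T" and p: "1 \<le> p" and f: "f \<in> Xp p" and g: "g \<in> Xp p"
    and C: "\<And>h. h \<in> Xp p \<Longrightarrow> Xnorm p (T h) \<le> C * Xnorm p h"
  shows "Xnorm p (\<lambda>x. T f x - T g x) \<le> C * Xnorm p (\<lambda>x. f x - g x)"
proof -
  have fg: "(\<lambda>x. f x - g x) \<in> Xp p" using p by (intro Xp_diff f g) simp
  have "Xnorm p (\<lambda>x. T f x - T g x) = Xnorm p (T (\<lambda>x. f x - g x))"
    using p by (intro Xnorm_cong ae_eq_sym[OF bounded_operator_diff[OF T f g]] Xp_diff bounded_operatorD(1)[OF T] f g fg) simp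
  also have "\<dots> \<le> C * Xnorm p (\<lambda>x. f x - g x)" by (rule C[OF fg])
  finally show ?thesis .
qed


subsection \<open>Measure preserving maps of the interval\<close>

definition meas_pres :: "(real \<Rightarrow> real) \<Rightarrow> bool" where
  "meas_pres T \<longleftrightarrow> T \<in> measurable I01 I01 \<and> distr I01 I01 T = I01"

lemma meas_presI:
  assumes T: "\<And>x. x \<in> {0<..<1} \<Longrightarrow> T x \<in> {0<..<1}"
    and sets: "\<And>A. A \<in> sets lebesgue \<Longrightarrow> A \<subseteq> {0<..<1} \<Longrightarrow> T -` A \<inter> {0<..<1} \<in> sets lebesgue"
    and em: "\<And>A. A \<in> sets lebesgue \<Longrightarrow> A \<subseteq> {0<..<1} \<Longrightarrow>
      emeasure lebesgue (T -` A \<inter> {0<..<1}) = emeasure lebesgue A"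
  shows "meas_pres T"
proof -
  have sets_iff: "A \<in> sets I01 \<longleftrightarrow> A \<in> sets lebesgue \<and> A \<subseteq> {0<..<1}" for A :: "real set"
    by (subst sets_restrict_space_iff) auto
  have meas: "T \<in> measurable I01 I01"
    by (rule measurableI) (use T sets sets_iff in auto)
  have "distr I01 I01 T = I01"
  proof (rule measure_eqI)
    fix A assume "A \<in> sets (distr I01 I01 T)"
    then have A: "A \<in> sets lebesgue" "A \<subseteq> {0<..<1}" "A \<in> sets I01" using sets_iff by auto
    have "emeasure (distr I01 I01 T) A = emeasure I01 (T -` A \<inter> {0<..<1})"
      using emeasure_distr[OF meas A(3)] by simp
    also have "\<dots> = emeasure lebesgue (T -` A \<inter> {0<..<1})"
      by (rule emeasure_restrict_space) auto
    also have "\<dots> = emeasure lebesgue A" by (rule em[OF A(1,2)])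
    also have "\<dots> = emeasure I01 A"
      using A by (intro emeasure_restrict_space[symmetric]) auto
    finally show "emeasure (distr I01 I01 T) A = emeasure I01 A" .
  qed simp
  then show ?thesis using meas by (simp add: meas_pres_def)
qed

lemma emeasure_lebesgue_translate: "emeasure lebesgue ((\<lambda>x. x + a) ` (S::real set)) = emeasure lebesgue S"
  using emeasure_lebesgue_affine[of 1 a S] by simp

lemma sets_lebesgue_translate: "S \<in> sets lebesgue \<Longrightarrow> (\<lambda>x. x + a) ` (S::real set) \<in> sets lebesgue"
  using lebesgue_sets_translation[of S a] by (simp add: add.commute)

lemma meas_pres_reflect: "meas_pres (\<lambda>x. 1 - x)"
proof (rule meas_presI)
  fix A :: "real set" assume A: "A \<in> sets lebesgue" "A \<subseteq> {0<..<1}"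
  have eq: "(\<lambda>x. 1 - x) -` A \<inter> {0<..<1} = (\<lambda>x. (-1) *\<^sub>R x + 1) ` A"
    using A(2) by (auto simp: image_iff intro!: bexI[of _ "1 - _"])
  show "emeasure lebesgue ((\<lambda>x. 1 - x) -` A \<inter> {0<..<1}) = emeasure lebesgue A"
    unfolding eq using emeasure_lebesgue_affine[of "-1" 1 A] by simp
  have "(\<lambda>x. 1 - x) \<in> measurable lebesgue (lebesgue :: real measure)"
    using lebesgue_affine_measurable[of "\<lambda>_. -1" "1::real"] by simp
  then show "(\<lambda>x. 1 - x) -` A \<inter> {0<..<1} \<in> sets lebesgue"
    using A(1) measurable_sets[of "\<lambda>x. 1 - x" lebesgue lebesgue A] by (intro sets.Int) auto
qed auto

text \<open>The value at the exceptional point \<open>r\<close> only serves to stay inside \<open>(0,1)\<close>.\<close>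

definition rot :: "real \<Rightarrow> real \<Rightarrow> real" where
  "rot r x = (if x < r then x - r + 1 else if x = r then 1 / 2 else x - r)"

lemma meas_pres_rot:
  assumes "0 \<le> r" "r < 1" shows "meas_pres (rot r)"
proof (rule meas_presI)
  show "rot r x \<in> {0<..<1}" if "x \<in> {0<..<1}" for x
    using that assms by (auto simp: rot_def)
next
  fix A :: "real set" assume A: "A \<in> sets lebesgue" "A \<subseteq> {0<..<1}"
  \<comment> \<open>The preimage consists of the part of A below 1 - r moved right by r, the part
    above 1 - r moved left by 1 - r, and possibly the exceptional point r, which lies in (0,1) only
    if r > 0.\<close>
  let ?A1 = "A \<inter> {0<..<1 - r}" and ?A2 = "A \<inter> {1 - r<..<1}"
  let ?E = "if 1 / 2 \<in> A \<and> 0 < r then {r} else {}"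
  let ?S = "((\<lambda>x. x + r) ` ?A1 \<union> (\<lambda>x. x + (r - 1)) ` ?A2) \<union> ?E"
  have eq: "rot r -` A \<inter> {0<..<1} = ?S"
  proof (intro set_eqI iffI)
    fix x assume x: "x \<in> rot r -` A \<inter> {0<..<1}"
    consider "x < r" | "x = r" | "x > r" by linarith
    then show "x \<in> ?S"
    proof cases
      case 1
      then have "x - r + 1 \<in> ?A2" using x by (auto simp: rot_def)
      then have "x \<in> (\<lambda>x. x + (r - 1)) ` ?A2" by (intro image_eqI[of _ _ "x - r + 1"]) auto
      then show ?thesis by blast
    next
      case 2
      then show ?thesis using x by (auto simp: rot_def)
    next
      case 3
      then have "x - r \<in> ?A1" using x by (auto simp: rot_def)
      then have "x \<in> (\<lambda>x. x + r) ` ?A1" by (intro image_eqI[of _ _ "x - r"]) auto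
      then show ?thesis by blast
    qed
  next
    fix x assume "x \<in> ?S"
    then show "x \<in> rot r -` A \<inter> {0<..<1}"
      using A(2) assms by (auto simp: rot_def split: if_splits)
  qed
  have s: "?A1 \<in> sets lebesgue" "?A2 \<in> sets lebesgue"
    using A(1) by (intro sets.Int; simp)+
  then have s': "(\<lambda>x. x + r) ` ?A1 \<in> sets lebesgue" "(\<lambda>x. x + (r - 1)) ` ?A2 \<in> sets lebesgue" "?E \<in> sets lebesgue"
    by (auto intro: sets_lebesgue_translate)
  then show "rot r -` A \<inter> {0<..<1} \<in> sets lebesgue"
    unfolding eq by (intro sets.Un)
  have null: "?E \<in> null_sets lebesgue"
    by (auto simp flip: negligible_iff_null_sets)
  have "emeasure lebesgue ?S = emeasure lebesgue ((\<lambda>x. x + r) ` ?A1 \<union> (\<lambda>x. x + (r - 1)) ` ?A2)"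
    using s' by (intro emeasure_Un_null_set null sets.Un)
  also have "\<dots> = emeasure lebesgue ((\<lambda>x. x + r) ` ?A1) + emeasure lebesgue ((\<lambda>x. x + (r - 1)) ` ?A2)"
    using s' by (intro plus_emeasure[symmetric]) auto
  also have "\<dots> = emeasure lebesgue ?A1 + emeasure lebesgue ?A2"
    by (simp add: emeasure_lebesgue_translate)
  also have "\<dots> = emeasure lebesgue (?A1 \<union> ?A2)"
    using s by (intro plus_emeasure) auto
  \<comment> \<open>The cut point 1 - r belongs to neither piece and is restored as a null
    set.\<close>
  also have "\<dots> = emeasure lebesgue ((?A1 \<union> ?A2) \<union> (A \<inter> {1 - r}))"
  proof (rule emeasure_Un_null_set[symmetric])
    show "A \<inter> {1 - r} \<in> null_sets lebesgue"
      using negligible_subset[of "{1 - r}" "A \<inter> {1 - r}"] by (simp add: negligible_iff_null_sets)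
  qed (use s in auto)
  also have "(?A1 \<union> ?A2) \<union> (A \<inter> {1 - r}) = A"
    using A(2) assms by auto
  finally show "emeasure lebesgue (rot r -` A \<inter> {0<..<1}) = emeasure lebesgue A"
    unfolding eq .
qed

lemma meas_pres_AE: "meas_pres T \<Longrightarrow> AE x in I01. Q x \<Longrightarrow> AE x in I01. Q (T x)"
  unfolding meas_pres_def by (metis AE_distrD)

lemma meas_pres_measurable:
  "meas_pres T \<Longrightarrow> f \<in> measurable I01 N \<Longrightarrow> (\<lambda>x. f (T x)) \<in> measurable I01 N"
  unfolding meas_pres_def by (rule measurable_compose) auto

lemma meas_pres_integrable:
  fixes h :: "real \<Rightarrow> real"
  assumes "meas_pres T" "integrable I01 h" shows "integrable I01 (\<lambda>x. h (T x))"
  using assms integrable_distr[of T I01 I01 h] by (simp add: meas_pres_def)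

lemma meas_pres_integral:
  fixes h :: "real \<Rightarrow> real"
  assumes "meas_pres T" "h \<in> borel_measurable I01" shows "(LINT x|I01. h (T x)) = (LINT x|I01. h x)"
  using assms integral_distr[of T I01 I01 h] by (simp add: meas_pres_def)

subsection \<open>The reflection\<close>

lemma reflect_reflect [simp]: "reflect P (reflect P f) = f"
  by (auto simp: reflect_def fun_eq_iff vec_eq_iff)

lemma reflect_add: "reflect P (\<lambda>x. f x + g x) = (\<lambda>x. reflect P f x + reflect P g x)"
  by (auto simp: reflect_def fun_eq_iff vec_eq_iff)

lemma reflect_diff: "reflect P (\<lambda>x. f x - g x) = (\<lambda>x. reflect P f x - reflect P g x)"
  by (auto simp: reflect_def fun_eq_iff vec_eq_iff)

lemma reflect_scale: "reflect P (\<lambda>x. c *s f x) = (\<lambda>x. c *s reflect P f x)"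
  by (auto simp: reflect_def fun_eq_iff vec_eq_iff)

lemma reflect_0 [simp]: "reflect P (\<lambda>x. 0) = (\<lambda>x. 0)"
  by (auto simp: reflect_def fun_eq_iff vec_eq_iff)

lemma reflect_ae:
  assumes "f =\<^sub>a\<^sub>e g" shows "reflect P f =\<^sub>a\<^sub>e reflect P g"
proof -
  have *: "AE x in I01. f x = g x" using assms by (simp add: ae_eq_def)
  with meas_pres_AE[OF meas_pres_reflect *] show ?thesis unfolding ae_eq_def
    by eventually_elim (auto simp: reflect_def vec_eq_iff)
qed

lemma reflect_ae_iff: "reflect P f =\<^sub>a\<^sub>e reflect P g \<longleftrightarrow> f =\<^sub>a\<^sub>e g"
  using reflect_ae[of f g P] reflect_ae[of "reflect P f" "reflect P g" P] by auto

lemma psum_reflect: "psum p (reflect P f x) =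
  (\<Sum>i\<in>P. norm (f x $ i) powr p) + (\<Sum>i\<in>-P. norm (f (1 - x) $ i) powr p)"
proof -
  have "psum p (reflect P f x) = (\<Sum>i\<in>UNIV. if i \<in> P then norm (f x $ i) powr p else norm (f (1 - x) $ i) powr p)"
    unfolding psum_def by (intro sum.cong) (auto simp: reflect_def)
  then show ?thesis by (simp add: sum.If_cases)
qed

lemma reflect_measurable:
  assumes "f \<in> borel_measurable I01" shows "reflect P f \<in> borel_measurable I01"
  unfolding reflect_def
proof (rule borel_measurable_vec_lambda)
  fix i
  show "(\<lambda>x. if i \<in> P then f x $ i else f (1 - x) $ i) \<in> borel_measurable I01"
    using assms meas_pres_measurable[OF meas_pres_reflect borel_measurable_nth[OF assms]]
    by (cases "i \<in> P") auto
qed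

lemma Xp_component: "f \<in> Xp p \<Longrightarrow> integrable I01 (\<lambda>x. norm (f x $ i) powr p)"
  by (simp add: Xp_def)

lemma reflect_Xp:
  assumes "f \<in> Xp p" shows "reflect P f \<in> Xp p"
  unfolding Xp_iff psum_reflect using assms
  by (auto intro!: reflect_measurable XpD(1)[of f p] Bochner_Integration.integrable_add Bochner_Integration.integrable_sum
      Xp_component meas_pres_integrable[OF meas_pres_reflect, of "\<lambda>x. norm (f x $ _) powr p"])

lemma Xnorm_reflect:
  assumes f: "f \<in> Xp p" shows "Xnorm p (reflect P f) = Xnorm p f"
proof -
  have i: "integrable I01 (\<lambda>x. norm (f (1 - x) $ i) powr p)" for i
    using meas_pres_integrable[OF meas_pres_reflect Xp_component[OF f]] .
  have "(LINT x|I01. norm (f (1 - x) $ i) powr p) = (LINT x|I01. norm (f x $ i) powr p)" for i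
    using meas_pres_integral[OF meas_pres_reflect borel_measurable_integrable[OF Xp_component[OF f]]] .
  then have "(LINT x|I01. psum p (reflect P f x)) =
      (\<Sum>i\<in>P. LINT x|I01. norm (f x $ i) powr p) + (\<Sum>i\<in>-P. LINT x|I01. norm (f x $ i) powr p)"
    using Xp_component[OF f] i by (simp add: psum_reflect)
  also have "\<dots> = (\<Sum>i\<in>UNIV. LINT x|I01. norm (f x $ i) powr p)"
    by (subst sum.union_disjoint[symmetric]) auto
  also have "\<dots> = (LINT x|I01. psum p (f x))"
    using Xp_component[OF f] by (simp add: psum_def)
  finally show ?thesis by (simp add: Xnorm_psum)
qed

subsection \<open>The shift operators\<close>

text \<open>The matrices are arbitrary so that one operator covers both the whole solution, with
  B^n, and its spectral parts, with B^n Q.\<close>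

definition shift_op :: "(nat \<Rightarrow> complex^'n^'n) \<Rightarrow> real \<Rightarrow> (real \<Rightarrow> complex^'n) \<Rightarrow> (real \<Rightarrow> complex^'n)" where
  "shift_op M t f = (\<lambda>x.
     let n = (THE n::nat. 0 < real n - t + x \<and> real n - t + x < 1) in M n *v f (real n - t + x))"

lemma the_shift:
  assumes "0 < real n - t + x" "real n - t + x < 1"
  shows "(THE n::nat. 0 < real n - t + x \<and> real n - t + x < 1) = n"
proof (rule the_equality)
  fix m :: nat assume "0 < real m - t + x \<and> real m - t + x < 1"
  then have "real m < real n + 1" "real n < real m + 1" using assms by auto
  then show "m = n" by linarith
qed (use assms in auto)

lemma shift_op_apply:
  assumes "0 < real n - t + x" "real n - t + x < 1"
  shows "shift_op M t f x = M n *v f (real n - t + x)"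
  by (simp add: shift_op_def the_shift[OF assms])

lemma shift_op_add: "shift_op M t (\<lambda>x. f x + g x) = (\<lambda>x. shift_op M t f x + shift_op M t g x)"
  by (simp add: shift_op_def Let_def matrix_vector_right_distrib)

lemma shift_op_scale: "shift_op M t (\<lambda>x. c *s f x) = (\<lambda>x. c *s shift_op M t f x)"
  by (simp add: shift_op_def Let_def vec.scale)

lemma S_part_eq: "S_part B lam J t f = shift_op (\<lambda>n. mat_pow B n ** spectral_sum B lam J) t f"
  by (simp add: S_part_def shift_op_def sum_spectral_term matrix_vector_mul_assoc)

text \<open>For fixed t only two values of n occur, floor t for x above frac t and floor t + 1 below
  it. In both cases the argument n - t + x is the rotation of x by frac t, which preserves
  measure.\<close>

lemma shift_op_rot:
  assumes "0 \<le> t" "x \<in> {0<..<1}" "x \<noteq> frac t"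
  shows "shift_op M t f x =
    (if x < frac t then M (Suc (nat \<lfloor>t\<rfloor>)) else M (nat \<lfloor>t\<rfloor>)) *v f (rot (frac t) x)"
proof -
  have t: "real (nat \<lfloor>t\<rfloor>) = t - frac t" using assms(1) by (simp add: frac_def)
  have fr: "0 \<le> frac t" "frac t < 1" by (simp_all add: frac_lt_1)
  show ?thesis
  proof (cases "x < frac t")
    case True
    then have "shift_op M t f x = M (Suc (nat \<lfloor>t\<rfloor>)) *v f (real (Suc (nat \<lfloor>t\<rfloor>)) - t + x)"
      using fr assms t by (intro shift_op_apply) auto
    also have "real (Suc (nat \<lfloor>t\<rfloor>)) - t + x = rot (frac t) x"
      using True t by (simp add: rot_def)
    finally show ?thesis using True by simp
  next
    case False
    then have "0 < real (nat \<lfloor>t\<rfloor>) - t + x" "real (nat \<lfloor>t\<rfloor>) - t + x < 1"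
      unfolding t using fr False assms(2,3) unfolding greaterThanLessThan_iff by linarith+
    then have "shift_op M t f x = M (nat \<lfloor>t\<rfloor>) *v f (real (nat \<lfloor>t\<rfloor>) - t + x)"
      by (rule shift_op_apply)
    also have "real (nat \<lfloor>t\<rfloor>) - t + x = rot (frac t) x"
      using False t assms(3) by (simp add: rot_def)
    finally show ?thesis using False by simp
  qed
qed

lemma AE_I01_neq: "AE x in I01. x \<noteq> (r::real)"
proof -
  have "AE x in lebesgue. x \<noteq> r"
    by (rule AE_I'[of "{r}"]) (auto simp flip: negligible_iff_null_sets)
  then show ?thesis by (subst AE_restrict_space_iff) (auto elim: AE_mp)
qed

lemma AE_I01_mem: "AE x in I01. x \<in> {0<..<1}"
  by (rule AE_I2) simp

lemma shift_op_rot_AE: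
  assumes "0 \<le> t"
  shows "AE x in I01. shift_op M t f x =
    (if x < frac t then M (Suc (nat \<lfloor>t\<rfloor>)) else M (nat \<lfloor>t\<rfloor>)) *v f (rot (frac t) x)"
  using AE_I01_neq[of "frac t"] AE_I01_mem
  by eventually_elim (rule shift_op_rot[OF assms])

lemma shift_op_ae:
  assumes "0 \<le> t" "f =\<^sub>a\<^sub>e g" shows "shift_op M t f =\<^sub>a\<^sub>e shift_op M t g"
proof -
  have "AE x in I01. f (rot (frac t) x) = g (rot (frac t) x)"
    using assms(2) unfolding ae_eq_def
    by (intro meas_pres_AE[OF meas_pres_rot, where Q = "\<lambda>x. f x = g x"]) (auto simp: frac_lt_1)
  with shift_op_rot_AE[OF assms(1), of M f] shift_op_rot_AE[OF assms(1), of M g]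
  show ?thesis unfolding ae_eq_def by eventually_elim simp
qed

lemma shift_op_measurable:
  assumes t: "0 \<le> t" and f: "f \<in> borel_measurable I01"
  shows "shift_op M t f \<in> borel_measurable I01"
proof -
  \<comment> \<open>Inserting the value at the exceptional point by hand makes \<open>?g\<close>
    agree with the operator at every point of (0,1), not merely almost everywhere.\<close>
  let ?g = "\<lambda>x. if x = frac t then shift_op M t f (frac t) else
    if x < frac t then M (Suc (nat \<lfloor>t\<rfloor>)) *v f (rot (frac t) x) else M (nat \<lfloor>t\<rfloor>) *v f (rot (frac t) x)"
  have [measurable]: "(\<lambda>x. f (rot (frac t) x)) \<in> borel_measurable I01"
    by (intro meas_pres_measurable[OF meas_pres_rot f]) (auto simp: frac_lt_1)
  have [measurable]: "(\<lambda>x. x) \<in> borel_measurable I01"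
    by (intro measurable_restrict_space1 measurable_completion) simp
  have [measurable]: "Measurable.pred I01 (\<lambda>x. x = frac t)" "Measurable.pred I01 (\<lambda>x. x < frac t)"
    by measurable
  have "?g \<in> borel_measurable I01" by measurable
  then show ?thesis
    by (rule measurable_cong[THEN iffD1, rotated]) (auto simp: shift_op_rot[OF t])
qed

text \<open>Only the two matrices active at time t enter the constant. This is what turns decay of
  the matrices into decay of the operator norm.\<close>

lemma shift_op_bounded:
  assumes p: "1 \<le> p" and t: "0 \<le> t" and f: "f \<in> Xp p"
    and C: "\<And>n. nat \<lfloor>t\<rfloor> \<le> n \<Longrightarrow> n \<le> Suc (nat \<lfloor>t\<rfloor>) \<Longrightarrow> matsum (M n) \<le> C"
  shows "shift_op M t (f :: real \<Rightarrow> complex^'n) \<in> Xp p"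
    and "Xnorm p (shift_op M t f) \<le> CARD('n) powr (1 / p) * C * Xnorm p f"
proof -
  have C0: "0 \<le> C" using order_trans[OF matsum_nonneg C[of "nat \<lfloor>t\<rfloor>"]] by simp
  have mp: "meas_pres (rot (frac t))" by (intro meas_pres_rot) (auto simp: frac_lt_1)
  let ?K = "CARD('n) * C powr p"
  have le: "psum p (M n *v v) \<le> ?K * psum p v" if "nat \<lfloor>t\<rfloor> \<le> n" "n \<le> Suc (nat \<lfloor>t\<rfloor>)" for n v
    using C[OF that] p by (intro order_trans[OF psum_matrix_le] mult_right_mono mult_left_mono powr_mono2) auto
  have AE: "AE x in I01. psum p (shift_op M t f x) \<le> ?K * psum p (f (rot (frac t) x))"
    using shift_op_rot_AE[OF t, of M f] by eventually_elim (auto simp: le)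
  have rf: "(\<lambda>x. f (rot (frac t) x)) \<in> Xp p"
    unfolding Xp_iff using f by (auto intro: meas_pres_measurable[OF mp] meas_pres_integrable[OF mp] XpD)
  show Xp: "shift_op M t f \<in> Xp p"
    by (rule Xp_dominated[OF shift_op_measurable[OF t XpD(1)[OF f]] integrable_mult_right[OF XpD(2)[OF rf]] AE])
  have "Xnorm p (shift_op M t f) \<le> (CARD('n) powr (1 / p) * C) * Xnorm p (\<lambda>x. f (rot (frac t) x))"
    using AE C0 p by (intro Xnorm_mono Xp rf) (auto simp: powr_mult powr_powr)
  also have "Xnorm p (\<lambda>x. f (rot (frac t) x)) = Xnorm p f"
    unfolding Xnorm_psum
    by (subst meas_pres_integral[OF mp borel_measurable_psum[OF XpD(1)[OF f]]]) simp
  finally show "Xnorm p (shift_op M t f) \<le> CARD('n) powr (1 / p) * C * Xnorm p f" .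
qed

definition refl_shift :: "'n set \<Rightarrow> (nat \<Rightarrow> complex^'n^'n) \<Rightarrow> real \<Rightarrow> (real \<Rightarrow> complex^'n) \<Rightarrow> (real \<Rightarrow> complex^'n)" where
  "refl_shift P M t f = reflect P (shift_op M t (reflect P f))"

lemma refl_shift_bound:
  assumes "1 \<le> p" "0 \<le> t" "f \<in> Xp p"
    "\<And>n. nat \<lfloor>t\<rfloor> \<le> n \<Longrightarrow> n \<le> Suc (nat \<lfloor>t\<rfloor>) \<Longrightarrow> matsum (M n) \<le> C"
  shows "refl_shift P M t (f :: real \<Rightarrow> complex^'n) \<in> Xp p"
    and "Xnorm p (refl_shift P M t f) \<le> CARD('n) powr (1 / p) * C * Xnorm p f"
  using shift_op_bounded[OF assms(1,2) reflect_Xp[OF assms(3)], of M C P] assms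
  by (auto simp: refl_shift_def reflect_Xp Xnorm_reflect)

lemma refl_shift_ae:
  "0 \<le> t \<Longrightarrow> f =\<^sub>a\<^sub>e g \<Longrightarrow> refl_shift P M t f =\<^sub>a\<^sub>e refl_shift P M t g"
  unfolding refl_shift_def by (intro reflect_ae shift_op_ae)

lemma refl_shift_bounded_operator:
  assumes "1 \<le> p" "0 \<le> t"
  shows "bounded_operator p (refl_shift P M t)"
proof -
  let ?C = "max (matsum (M (nat \<lfloor>t\<rfloor>))) (matsum (M (Suc (nat \<lfloor>t\<rfloor>))))"
  have C: "matsum (M n) \<le> ?C" if "nat \<lfloor>t\<rfloor> \<le> n" "n \<le> Suc (nat \<lfloor>t\<rfloor>)" for n
    using that by (auto simp: le_Suc_eq)
  have "\<forall>f\<in>Xp p. Xnorm p (refl_shift P M t f) \<le> CARD('a) powr (1 / p) * ?C * Xnorm p f"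
    using refl_shift_bound(2)[where M = M and C = ?C, OF assms _ C] by blast
  moreover have "\<forall>f\<in>Xp p. refl_shift P M t f \<in> Xp p"
    using refl_shift_bound(1)[where M = M and C = ?C, OF assms _ C] by blast
  ultimately show ?thesis
    unfolding bounded_operator_def using refl_shift_ae[OF assms(2), of _ _ P M]
    by (auto simp: refl_shift_def reflect_add reflect_scale shift_op_add shift_op_scale)
qed

lemma G_part_eq: "G_part P B lam J t = refl_shift P (\<lambda>n. mat_pow B n ** spectral_sum B lam J) t"
  by (simp add: fun_eq_iff G_part_def refl_shift_def S_part_eq)


subsection \<open>Uniqueness for the abstract Cauchy problem\<close>

text \<open>Tilt \<phi> by a small slope e and let c be the last point where the tilted function
  does not exceed its initial value. If c < b, the estimate to the right of c produces a later such
  point.\<close>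

lemma right_Dini_nonincreasing:
  fixes \<phi> :: "real \<Rightarrow> real"
  assumes "a \<le> b" and cont: "continuous_on {a..b} \<phi>"
    and right: "\<And>s e. a \<le> s \<Longrightarrow> s < b \<Longrightarrow> 0 < e \<Longrightarrow>
      \<forall>\<^sub>F h in at_right 0. s + h \<le> b \<longrightarrow> \<phi> (s + h) \<le> \<phi> s + e * h"
  shows "\<phi> b \<le> \<phi> a"
proof -
  have *: "\<phi> b - e * (b - a) \<le> \<phi> a" if e: "0 < e" for e
  proof (rule ccontr)
    assume neg: "\<not> \<phi> b - e * (b - a) \<le> \<phi> a"
    define \<psi> where "\<psi> s = \<phi> s - e * (s - a)" for s
    have cont': "continuous_on {a..b} \<psi>" unfolding \<psi>_def by (intro continuous_intros cont)
    define C where "C = {a..b} \<inter> \<psi> -` {..\<psi> a}"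
    have "closed C" unfolding C_def
      by (rule continuous_closed_preimage[OF cont' closed_atLeastAtMost closed_atMost])
    then have "compact C"
      by (simp add: compact_eq_bounded_closed bounded_subset[of "{a..b}"] C_def)
    moreover have "a \<in> C" using \<open>a \<le> b\<close> by (simp add: C_def)
    ultimately obtain c where c: "c \<in> C" "\<And>s. s \<in> C \<Longrightarrow> s \<le> c"
      using compact_attains_sup[of C] by blast
    have "c \<noteq> b" using c(1) neg by (auto simp: C_def \<psi>_def)
    then have cb: "a \<le> c" "c < b" using c(1) by (auto simp: C_def)
    have "\<forall>\<^sub>F h in at_right (0::real). h < b - c \<and> 0 < h"
      using cb by (intro eventually_conj eventually_at_right_less)
        (auto simp: eventually_at_right[of 0 "b - c"] intro!: exI[of _ "b - c"])
    with right[OF cb e] have "\<forall>\<^sub>F h in at_right (0::real). False"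
    proof eventually_elim
      case (elim h)
      then have "\<psi> (c + h) \<le> \<psi> c" by (simp add: \<psi>_def algebra_simps)
      also have "\<dots> \<le> \<psi> a" using c(1) by (simp add: C_def)
      finally have "c + h \<in> C" using cb elim by (simp add: C_def)
      then show ?case using c(2)[of "c + h"] elim by simp
    qed
    then show False by simp
  qed
  show ?thesis
  proof (rule field_le_epsilon)
    fix e :: real assume "0 < e"
    \<comment> \<open>The summand 1 keeps the denominator positive when a = b.\<close>
    have "e / (b - a + 1) * (b - a) \<le> e" using \<open>a \<le> b\<close> \<open>0 < e\<close> by (simp add: field_simps)
    then show "\<phi> b \<le> \<phi> a + e" using *[of "e / (b - a + 1)"] \<open>a \<le> b\<close> \<open>0 < e\<close> by simp
  qed
qed

lemma C0_semigroupD: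
  assumes "C0_semigroup p G"
  shows "0 \<le> t \<Longrightarrow> bounded_operator p (G t)"
    and "f \<in> Xp p \<Longrightarrow> G 0 f =\<^sub>a\<^sub>e f"
    and "0 \<le> s \<Longrightarrow> 0 \<le> t \<Longrightarrow> f \<in> Xp p \<Longrightarrow> G (s + t) f =\<^sub>a\<^sub>e G s (G t f)"
    and "f \<in> Xp p \<Longrightarrow> ((\<lambda>t. Xnorm p (\<lambda>x. G t f x - f x)) \<longlongrightarrow> 0) (at_right 0)"
  using assms by (simp_all add: C0_semigroup_def)

lemma C0_semigroup_Xp: "C0_semigroup p G \<Longrightarrow> 0 \<le> t \<Longrightarrow> f \<in> Xp p \<Longrightarrow> G t f \<in> Xp p"
  using C0_semigroupD(1) bounded_operatorD(1) by blast

lemma C0_semigroup_diff_le: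
  assumes G: "C0_semigroup p G" and p: "1 \<le> p" and "0 \<le> s" "0 \<le> h" and f: "f \<in> Xp p" and g: "g \<in> Xp p"
    and C: "\<And>f. f \<in> Xp p \<Longrightarrow> Xnorm p (G s f) \<le> C * Xnorm p f"
  shows "Xnorm p (\<lambda>x. G (s + h) f x - G s g x) \<le> C * Xnorm p (\<lambda>x. G h f x - g x)"
proof -
  have X: "G h f \<in> Xp p" "G s (G h f) \<in> Xp p" "G s g \<in> Xp p" "G (s + h) f \<in> Xp p"
    using \<open>0 \<le> s\<close> \<open>0 \<le> h\<close> by (simp_all add: C0_semigroup_Xp[OF G] f g)
  have "Xnorm p (\<lambda>x. G (s + h) f x - G s g x) = Xnorm p (\<lambda>x. G s (G h f) x - G s g x)"
    using p C0_semigroupD(3)[OF G \<open>0 \<le> s\<close> \<open>0 \<le> h\<close> f]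
    by (intro Xnorm_cong Xp_diff X ae_eq_lift2[where F = "(-)"]) auto
  also have "\<dots> \<le> C * Xnorm p (\<lambda>x. G h f x - g x)"
    by (rule bounded_operator_diff_le[OF C0_semigroupD(1)[OF G \<open>0 \<le> s\<close>] p X(1) g C])
  finally show ?thesis .
qed

text \<open>
  Only Baire's theorem on the time axis is used, so that no completeness of \<open>X\<^sub>p\<close> is needed; the price
  is that the bound does not reach down to \<open>t = 0\<close>.
\<close>

lemma C0_semigroup_locally_bounded:
  fixes G :: "real \<Rightarrow> (real \<Rightarrow> complex^'n) \<Rightarrow> (real \<Rightarrow> complex^'n)"
  assumes G: "C0_semigroup p G" and p: "1 \<le> p" and a: "0 < a"
  obtains K where "0 \<le> K" "\<And>t f. a \<le> t \<Longrightarrow> t \<le> b \<Longrightarrow> f \<in> Xp p \<Longrightarrow> Xnorm p (G t f) \<le> K * Xnorm p f"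
proof -
  let ?S = "{a / 2..a}"
  \<comment> \<open>The times with norm bound k. Each single \<open>G t\<close> is bounded, so these
    sets cover the interval, and by Baire one of them is dense in some subinterval.\<close>
  define E where "E k = {t \<in> ?S. \<forall>f\<in>Xp p. Xnorm p (G t f) \<le> real k * Xnorm p f}" for k :: nat
  have cover: "\<exists>k. t \<in> E k" if "t \<in> ?S" for t
  proof -
    have "0 \<le> t" using that a by auto
    obtain C where C: "0 \<le> C" "\<And>f. f \<in> Xp p \<Longrightarrow> Xnorm p (G t f) \<le> C * Xnorm p f"
      by (rule bounded_operator_bound[OF C0_semigroupD(1)[OF G \<open>0 \<le> t\<close>]]) (rule that)
    obtain k :: nat where "C \<le> real k" using real_arch_simple by blast
    then have "t \<in> E k"
      using that C by (auto simp: E_def intro!: order_trans[OF C(2)] mult_right_mono)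
    then show ?thesis by blast
  qed
  have "\<exists>k. \<not> ?S \<subseteq> closure (?S - closure (E k))"
  proof (rule ccontr)
    assume "\<nexists>k. \<not> ?S \<subseteq> closure (?S - closure (E k))"
    then have dense: "?S \<subseteq> closure (?S - closure (E k))" for k by blast
    have "openin (top_of_set ?S) (?S - closure (E k))" for k
      using openin_open_Int[of "- closure (E k)" ?S] by (simp add: Diff_eq open_Compl)
    then have "?S \<subseteq> closure (\<Inter>(range (\<lambda>k. ?S - closure (E k))))"
      using dense by (intro Baire) auto
    moreover have "x \<notin> \<Inter>(range (\<lambda>k. ?S - closure (E k)))" for x
    proof
      assume x: "x \<in> \<Inter>(range (\<lambda>k. ?S - closure (E k)))"
      then have "x \<in> ?S" by simp
      then obtain k where "x \<in> E k" using cover by blast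
      then have "x \<in> closure (E k)" by (rule subsetD[OF closure_subset])
      then show False using x by simp
    qed
    then have "\<Inter>(range (\<lambda>k. ?S - closure (E k))) = {}" unfolding set_eq_iff by simp
    ultimately have "?S \<subseteq> closure {}" by (simp only:)
    then show False using a by simp
  qed
  then obtain k t0 where t0: "t0 \<in> ?S" "t0 \<notin> closure (?S - closure (E k))" by blast
  define U where "U = - closure (?S - closure (E k))"
  have U: "open U" "t0 \<in> U" "U \<inter> (?S - closure (E k)) = {}"
    unfolding U_def using t0(2) closure_subset[of "?S - closure (E k)"] by (auto simp only: open_Compl closed_closure)
  then obtain e where e: "0 < e" "ball t0 e \<subseteq> U" by (meson open_contains_ball)
  \<comment> \<open>The ball around t0 may stick out of the interval, so a piece to the right of t0
    is taken, or one to the left if t0 is the right end.\<close>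
  obtain c d where cd: "a / 2 \<le> c" "c < d" "d \<le> a" "{c<..<d} \<subseteq> ball t0 e"
  proof (cases "t0 < a")
    case True
    then show ?thesis using t0(1) e(1)
      by (intro that[of t0 "min a (t0 + e)"]) (auto simp: dist_real_def)
  next
    case False
    then have "t0 = a" using t0(1) by simp
    then show ?thesis using a e(1)
      by (intro that[of "max (a / 2) (a - e)" a]) (auto simp: dist_real_def)
  qed
  then have sub: "{c<..<d} \<subseteq> closure (E k)"
    using U(3) e(2) by fastforce
  \<comment> \<open>The bound passes from the dense set of good times to all times in [c, d) by
    right continuity of the orbit: good times t' > t lie arbitrarily close to t. This is why the end
    d is excluded.\<close>
  have E: "Xnorm p (G t f) \<le> real k * Xnorm p f" if t: "c \<le> t" "t < d" and f: "f \<in> Xp p" for t f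
  proof (rule field_le_epsilon)
    fix \<epsilon> :: real assume \<epsilon>: "0 < \<epsilon>"
    have t0': "0 \<le> t" using t cd a by simp
    obtain C where C: "0 \<le> C" "\<And>f. f \<in> Xp p \<Longrightarrow> Xnorm p (G t f) \<le> C * Xnorm p f"
      by (rule bounded_operator_bound[OF C0_semigroupD(1)[OF G t0']]) (rule that)
    have "\<forall>\<^sub>F h in at_right 0. Xnorm p (\<lambda>x. G h f x - f x) < \<epsilon> / (C + 1)"
      using order_tendstoD(2)[OF C0_semigroupD(4)[OF G f], of "\<epsilon> / (C + 1)"] \<epsilon> C(1) by simp
    then obtain \<delta> where \<delta>: "0 < \<delta>" "\<And>h. 0 < h \<Longrightarrow> h < \<delta> \<Longrightarrow> Xnorm p (\<lambda>x. G h f x - f x) < \<epsilon> / (C + 1)"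
      by (auto simp: eventually_at_right_field)
    let ?V = "{t<..<min d (t + \<delta>)}"
    have "?V \<subseteq> closure (E k)" "?V \<noteq> {}" using sub t \<delta>(1) by auto
    then have "?V \<inter> closure (E k) \<noteq> {}" by blast
    then have "?V \<inter> E k \<noteq> {}" using open_Int_closure_eq_empty[of ?V "E k"] by auto
    then obtain t' where t': "t < t'" "t' < t + \<delta>" "t' \<in> E k" by auto
    have X: "G t f \<in> Xp p" "G t' f \<in> Xp p" using C0_semigroup_Xp[OF G _ f] t0' t' by auto
    have "Xnorm p (G t f) \<le> Xnorm p (\<lambda>x. G t f x - G t' f x) + Xnorm p (G t' f)"
      using Xnorm_triangle[OF p Xp_diff[OF _ X] X(2)] p by simp
    also have "Xnorm p (\<lambda>x. G t f x - G t' f x) = Xnorm p (\<lambda>x. G (t + (t' - t)) f x - G t f x)"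
      by (subst Xnorm_diff_commute) simp
    also have "\<dots> \<le> C * Xnorm p (\<lambda>x. G (t' - t) f x - f x)"
      using t' by (intro C0_semigroup_diff_le[OF G p t0' _ f f C(2)]) auto
    also have "\<dots> \<le> (C + 1) * (\<epsilon> / (C + 1))"
      using \<delta>(2)[of "t' - t"] t' C(1) by (intro mult_mono) auto
    also have "\<dots> = \<epsilon>" using C(1) by simp
    finally show "Xnorm p (G t f) \<le> real k * Xnorm p f + \<epsilon>"
      using t'(3) f by (auto simp: E_def)
  qed
  define \<eta> where "\<eta> = d - c"
  have \<eta>: "0 < \<eta>" using cd by (simp add: \<eta>_def)
  obtain C where C: "0 \<le> C" "\<And>f. f \<in> Xp p \<Longrightarrow> Xnorm p (G \<eta> f) \<le> C * Xnorm p f"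
    by (rule bounded_operator_bound[OF C0_semigroupD(1)[OF G less_imp_le[OF \<eta>]]]) (rule that)
  \<comment> \<open>Every t \<ge> a is a time in [c, d) plus a multiple of the length \<eta>, so
    further steps of length \<eta> carry the bound forward. The base C + 1 is at least 1, which
    makes its powers monotone in m.\<close>
  have step: "Xnorm p (G (\<tau> + real m * \<eta>) f) \<le> (C + 1) ^ m * (real k * Xnorm p f)"
    if \<tau>: "c \<le> \<tau>" "\<tau> < d" and f: "f \<in> Xp p" for \<tau> m f
  proof (induction m)
    case 0
    then show ?case using E[OF \<tau> f] by simp
  next
    case (Suc m)
    have nn: "0 \<le> \<tau> + real m * \<eta>" using \<tau> cd a \<eta> by simp
    have X: "G (\<tau> + real m * \<eta>) f \<in> Xp p" using C0_semigroup_Xp[OF G nn f] .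
    have "G (\<eta> + (\<tau> + real m * \<eta>)) f =\<^sub>a\<^sub>e G \<eta> (G (\<tau> + real m * \<eta>) f)"
      using C0_semigroupD(3)[OF G _ nn f] \<eta> by simp
    then have "Xnorm p (G (\<tau> + real (Suc m) * \<eta>) f) = Xnorm p (G \<eta> (G (\<tau> + real m * \<eta>) f))"
      using nn \<eta> by (intro Xnorm_cong C0_semigroup_Xp[OF G] X f) (auto simp: algebra_simps)
    also have "\<dots> \<le> C * Xnorm p (G (\<tau> + real m * \<eta>) f)" by (rule C(2)[OF X])
    also have "\<dots> \<le> (C + 1) * ((C + 1) ^ m * (real k * Xnorm p f))"
      using C(1) Suc.IH by (intro mult_mono) auto
    finally show ?case by (simp add: mult.assoc)
  qed
  define M where "M = nat \<lceil>(b - c) / \<eta>\<rceil>"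
  show ?thesis
  proof (rule that[of "(C + 1) ^ M * real k"])
    fix t and f :: "real \<Rightarrow> complex^'n" assume t: "a \<le> t" "t \<le> b" and f: "f \<in> Xp p"
    define m where "m = nat \<lfloor>(t - c) / \<eta>\<rfloor>"
    have nn: "0 \<le> (t - c) / \<eta>" using t cd \<eta> by simp
    then have m: "real m \<le> (t - c) / \<eta>" "(t - c) / \<eta> < real m + 1" unfolding m_def by linarith+
    then have "c \<le> t - real m * \<eta>" "t - real m * \<eta> < d" using \<eta> by (auto simp: field_simps \<eta>_def)
    then have "Xnorm p (G t f) \<le> (C + 1) ^ m * (real k * Xnorm p f)"
      using step[of "t - real m * \<eta>" f m] f by simp
    also have "m \<le> M"
    proof -
      have "(t - c) / \<eta> \<le> (b - c) / \<eta>" using t \<eta> by (intro divide_right_mono) auto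
      then show ?thesis using m unfolding M_def by linarith
    qed
    then have "(C + 1) ^ m * (real k * Xnorm p f) \<le> (C + 1) ^ M * (real k * Xnorm p f)"
      using C(1) by (intro mult_right_mono power_increasing) auto
    finally show "Xnorm p (G t f) \<le> (C + 1) ^ M * real k * Xnorm p f" by (simp add: mult.assoc)
  qed (use C(1) in auto)
qed

text \<open>The curve s -> G (t + \<delta> - s) (u s) stays at times in [\<delta>, t + \<delta>],
  where one constant K bounds the semigroup. Its distance \<phi> from its starting point is 0 at s =
  0 and does not increase, because near each s both G h (u s) and u (s + h) are u s + h v s up to
  o(h).\<close>

lemma C0_semigroup_solution_unique:
  fixes u v :: "real \<Rightarrow> real \<Rightarrow> complex^'n"
  assumes G: "C0_semigroup p G" and p: "1 \<le> p" and t: "0 \<le> t"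
    and u: "\<And>s. 0 \<le> s \<Longrightarrow> u s \<in> Xp p"
    and gen: "\<And>s. 0 \<le> s \<Longrightarrow> s < t \<Longrightarrow> (u s, v s) \<in> generator p G"
    and deriv: "\<And>s. 0 \<le> s \<Longrightarrow> s < t \<Longrightarrow>
      ((\<lambda>h. Xnorm p (\<lambda>x. (1 / h) *\<^sub>R (u (s + h) x - u s x) - v s x)) \<longlongrightarrow> 0) (at_right 0)"
    and cont: "\<And>s. s \<in> {0..t} \<Longrightarrow> ((\<lambda>s'. Xnorm p (\<lambda>x. u s' x - u s x)) \<longlongrightarrow> 0) (at s within {0..t})"
  shows "G t (u 0) =\<^sub>a\<^sub>e u t"
proof -
  have p0: "0 \<le> p" using p by simp
  have X: "G r (u s) \<in> Xp p" if "0 \<le> r" "0 \<le> s" for r s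
    using C0_semigroup_Xp[OF G] u that by blast
  have key: "G \<delta> (u t) =\<^sub>a\<^sub>e G (\<delta> + t) (u 0)" if \<delta>: "0 < \<delta>" for \<delta>
  proof -
    obtain K where K: "0 \<le> K"
      "\<And>r f. \<delta> \<le> r \<Longrightarrow> r \<le> t + \<delta> \<Longrightarrow> f \<in> Xp p \<Longrightarrow> Xnorm p (G r f) \<le> K * Xnorm p f"
      by (rule C0_semigroup_locally_bounded[OF G p \<delta>, where b = "t + \<delta>"]) (rule that)
    define \<phi> where "\<phi> s = Xnorm p (\<lambda>x. G (t + \<delta> - s) (u s) x - G (\<delta> + t) (u 0) x)" for s
    have X0: "G (\<delta> + t) (u 0) \<in> Xp p" using t \<delta> by (intro X) auto
    have \<phi>_diff: "\<phi> s' - \<phi> s \<le> Xnorm p (\<lambda>x. G (t + \<delta> - s') (u s') x - G (t + \<delta> - s) (u s) x)"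
      if "s \<in> {0..t}" "s' \<in> {0..t}" for s s'
      using Xnorm_triangle_diff[OF p X X X0, of "t + \<delta> - s'" s' "t + \<delta> - s" s] that \<delta>
      by (simp add: \<phi>_def)
    have cont_\<phi>: "continuous_on {0..t} \<phi>"
      unfolding continuous_on_def
    proof
      fix s assume s: "s \<in> {0..t}"
      \<comment> \<open>The changes of the vector and of the time are separated. For the time, the
        operator at the smaller of the two times is factored out, hence the absolute value of s' -
        s.\<close>
      have bound: "Xnorm p (\<lambda>x. G (t + \<delta> - s') (u s') x - G (t + \<delta> - s) (u s) x)
          \<le> K * Xnorm p (\<lambda>x. u s' x - u s x) + K * Xnorm p (\<lambda>x. G \<bar>s' - s\<bar> (u s) x - u s x)"
        if s': "s' \<in> {0..t}" for s'
      proof -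
        let ?r = "t + \<delta> - s'" and ?q = "t + \<delta> - s"
        have us: "u s \<in> Xp p" "u s' \<in> Xp p" using s s' u by auto
        have "Xnorm p (\<lambda>x. G ?r (u s') x - G ?r (u s) x) \<le> K * Xnorm p (\<lambda>x. u s' x - u s x)"
          using s' \<delta> by (intro bounded_operator_diff_le[OF C0_semigroupD(1)[OF G] p us(2,1)] K) auto
        moreover have "Xnorm p (\<lambda>x. G ?r (u s) x - G ?q (u s) x) \<le> K * Xnorm p (\<lambda>x. G \<bar>s' - s\<bar> (u s) x - u s x)"
        proof (cases "s' \<le> s")
          case True
          have "Xnorm p (\<lambda>x. G (?q + (s - s')) (u s) x - G ?q (u s) x) \<le> K * Xnorm p (\<lambda>x. G (s - s') (u s) x - u s x)"
            using s s' \<delta> True us by (intro C0_semigroup_diff_le[OF G p] K) auto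
          moreover have "?q + (s - s') = ?r" by simp
          ultimately show ?thesis using True by (simp only: abs_minus_commute[of s'] abs_of_nonneg diff_ge_0_iff_ge)
        next
          case False
          have "Xnorm p (\<lambda>x. G (?r + (s' - s)) (u s) x - G ?r (u s) x) \<le> K * Xnorm p (\<lambda>x. G (s' - s) (u s) x - u s x)"
            using s s' \<delta> False us by (intro C0_semigroup_diff_le[OF G p] K) auto
          moreover have "?r + (s' - s) = ?q" by simp
          ultimately show ?thesis using False
            by (simp only: Xnorm_diff_commute[of p "G ?r (u s)"] abs_of_nonneg diff_ge_0_iff_ge linear not_le less_imp_le)
        qed
        ultimately show ?thesis
          using Xnorm_triangle_diff[OF p X X X, of ?r s' ?r s ?q s] s s' \<delta> by simp
      qed
      have G0: "((\<lambda>h. Xnorm p (\<lambda>x. G h (u s) x - u s x)) \<longlongrightarrow> 0) (at_right 0)"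
        using C0_semigroupD(4)[OF G] u s by simp
      have "filterlim (\<lambda>s'. \<bar>s' - s\<bar>) (at_right 0) (at s within {0..t})"
        unfolding filterlim_at
        by (auto intro!: tendsto_eq_intros simp: eventually_at_filter)
      from filterlim_compose[OF G0 this]
      have "((\<lambda>s'. Xnorm p (\<lambda>x. G \<bar>s' - s\<bar> (u s) x - u s x)) \<longlongrightarrow> 0) (at s within {0..t})" .
      from tendsto_add[OF tendsto_mult_right_zero[OF cont[OF s], of K] tendsto_mult_right_zero[OF this, of K]]
      have lim: "((\<lambda>s'. K * Xnorm p (\<lambda>x. u s' x - u s x) + K * Xnorm p (\<lambda>x. G \<bar>s' - s\<bar> (u s) x - u s x)) \<longlongrightarrow> 0)
          (at s within {0..t})" by simp
      have "((\<lambda>s'. \<phi> s' - \<phi> s) \<longlongrightarrow> 0) (at s within {0..t})"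
      proof (rule Lim_null_comparison[OF _ lim])
        have abs_le: "\<bar>\<phi> s' - \<phi> s\<bar> \<le> Xnorm p (\<lambda>x. G (t + \<delta> - s') (u s') x - G (t + \<delta> - s) (u s) x)" if "s' \<in> {0..t}" for s'
          using \<phi>_diff[OF s that] \<phi>_diff[OF that s]
            Xnorm_diff_commute[of p "G (t + \<delta> - s') (u s')" "G (t + \<delta> - s) (u s)"] by linarith
        show "\<forall>\<^sub>F s' in at s within {0..t}. norm (\<phi> s' - \<phi> s) \<le>
            K * Xnorm p (\<lambda>x. u s' x - u s x) + K * Xnorm p (\<lambda>x. G \<bar>s' - s\<bar> (u s) x - u s x)"
          unfolding eventually_at_filter real_norm_def
          by (intro always_eventually allI impI order_trans[OF abs_le bound])
      qed
      then show "(\<phi> \<longlongrightarrow> \<phi> s) (at s within {0..t})" by (simp add: LIM_zero_iff)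
    qed
    have right_\<phi>: "\<forall>\<^sub>F h in at_right 0. s + h \<le> t \<longrightarrow> \<phi> (s + h) \<le> \<phi> s + e * h"
      if s: "0 \<le> s" "s < t" and e: "0 < e" for s e
    proof -
      have us: "u s \<in> Xp p" using s u by auto
      have vs: "v s \<in> Xp p" and G0: "((\<lambda>h. Xnorm p (\<lambda>x. (1 / h) *\<^sub>R (G h (u s) x - u s x) - v s x)) \<longlongrightarrow> 0) (at_right 0)"
        using gen[OF s] by (auto simp: generator_def)
      have lim: "((\<lambda>h. K * (Xnorm p (\<lambda>x. (1 / h) *\<^sub>R (u (s + h) x - u s x) - v s x)
          + Xnorm p (\<lambda>x. (1 / h) *\<^sub>R (G h (u s) x - u s x) - v s x))) \<longlongrightarrow> 0) (at_right 0)"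
        using tendsto_mult_right_zero[OF tendsto_add_zero[OF deriv[OF s] G0], of K] .
      show ?thesis
        using order_tendstoD(2)[OF lim e] eventually_at_right_less[of 0]
      proof (eventually_elim, intro impI)
        fix h :: real
        assume h: "0 < h" "s + h \<le> t" and less: "K * (Xnorm p (\<lambda>x. (1 / h) *\<^sub>R (u (s + h) x - u s x) - v s x)
          + Xnorm p (\<lambda>x. (1 / h) *\<^sub>R (G h (u s) x - u s x) - v s x)) < e"
        have ush: "u (s + h) \<in> Xp p" and Gh: "G h (u s) \<in> Xp p" using s h by (simp_all add: u X)
        let ?a = "\<lambda>x. (1 / h) *\<^sub>R (u (s + h) x - u s x)" and ?b = "\<lambda>x. (1 / h) *\<^sub>R (G h (u s) x - u s x)"
        have sc: "(1 / h) *\<^sub>R w = complex_of_real (1 / h) *s w" for w :: "complex^'n"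
          by (simp add: vec_eq_iff) (simp add: scaleR_conv_of_real)
        have ab: "?a \<in> Xp p" "?b \<in> Xp p"
          unfolding sc by (simp_all only: Xp_scale Xp_diff p0 ush us Gh)
        have "\<phi> (s + h) - \<phi> s \<le> Xnorm p (\<lambda>x. G (t + \<delta> - (s + h)) (u (s + h)) x - G (t + \<delta> - s) (u s) x)"
          using s h by (intro \<phi>_diff) auto
        also have "\<dots> = Xnorm p (\<lambda>x. G ((t + \<delta> - (s + h)) + h) (u s) x - G (t + \<delta> - (s + h)) (u (s + h)) x)"
          by (subst Xnorm_diff_commute) (simp add: algebra_simps)
        also have "\<dots> \<le> K * Xnorm p (\<lambda>x. G h (u s) x - u (s + h) x)"
          using s h \<delta> by (intro C0_semigroup_diff_le[OF G p _ _ us ush] K) auto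
        \<comment> \<open>The difference is written as h times the difference of two quotients, both
          of which tend to \<open>v s\<close>.\<close>
        also have "(\<lambda>x. G h (u s) x - u (s + h) x) = (\<lambda>x. complex_of_real h *s (?b x - ?a x))"
          using h unfolding sc by (simp add: fun_eq_iff vec_eq_iff field_simps)
        also have "Xnorm p \<dots> = h * Xnorm p (\<lambda>x. ?b x - ?a x)"
          using h(1) by (simp only: Xnorm_scale[OF p] norm_of_real abs_of_pos)
        also have "K * (h * Xnorm p (\<lambda>x. ?b x - ?a x)) \<le>
            K * (h * (Xnorm p (\<lambda>x. ?b x - v s x) + Xnorm p (\<lambda>x. v s x - ?a x)))"
          using K(1) h by (intro mult_left_mono Xnorm_triangle_diff[OF p ab(2) vs ab(1)]) auto
        also have "\<dots> = h * (K * (Xnorm p (\<lambda>x. ?a x - v s x) + Xnorm p (\<lambda>x. ?b x - v s x)))"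
          by (subst Xnorm_diff_commute[of p "v s"]) (simp add: algebra_simps)
        also have "\<dots> \<le> h * e" using h less by (intro mult_left_mono) auto
        finally show "\<phi> (s + h) \<le> \<phi> s + e * h" by (simp add: mult.commute)
      qed
    qed
    have "\<phi> t \<le> \<phi> 0" by (rule right_Dini_nonincreasing[OF t cont_\<phi> right_\<phi>])
    also have "\<phi> 0 = Xnorm p (\<lambda>x. 0 :: complex^'n)" by (simp add: \<phi>_def add.commute)
    also have "\<dots> = 0" using Xnorm_eq_0_iff[OF p Xp_0] by simp
    finally have "\<phi> t = 0" using Xnorm_nonneg[of p] unfolding \<phi>_def by (metis antisym)
    then have "(\<lambda>x. G \<delta> (u t) x - G (\<delta> + t) (u 0) x) =\<^sub>a\<^sub>e (\<lambda>x. 0)"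
      using Xnorm_eq_0_iff[OF p Xp_diff[OF p0 X X0, of \<delta> t]] t \<delta> by (simp add: \<phi>_def)
    then show ?thesis unfolding ae_eq_def by simp
  qed
  \<comment> \<open>It remains to let \<delta> tend to 0. The common vector G \<delta> (u t) = G
    \<delta> (G t (u 0)) approaches both u t and G t (u 0).\<close>
  have Gt: "G t (u 0) \<in> Xp p" and ut: "u t \<in> Xp p" using t by (simp_all add: X u)
  have "\<forall>\<^sub>F \<delta> in at_right 0. Xnorm p (\<lambda>x. G t (u 0) x - u t x) \<le>
      Xnorm p (\<lambda>x. G \<delta> (G t (u 0)) x - G t (u 0) x) + Xnorm p (\<lambda>x. G \<delta> (u t) x - u t x)"
    using eventually_at_right_less[of 0]
  proof eventually_elim
    case (elim \<delta>)
    have XX: "G \<delta> (G t (u 0)) \<in> Xp p" "G \<delta> (u t) \<in> Xp p" using elim t by (simp_all add: C0_semigroup_Xp[OF G] X u)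
    have "G \<delta> (u t) =\<^sub>a\<^sub>e G \<delta> (G t (u 0))"
      using ae_eq_trans[OF key[OF elim] C0_semigroupD(3)[OF G _ t u]] elim by simp
    then have "Xnorm p (\<lambda>x. G \<delta> (u t) x - u t x) = Xnorm p (\<lambda>x. G \<delta> (G t (u 0)) x - u t x)"
      using p0 by (intro Xnorm_cong Xp_diff XX ut ae_eq_lift2[where F = "(-)"]) auto
    then show ?case
      using Xnorm_triangle_diff[OF p Gt XX(1) ut] Xnorm_diff_commute[of p "G t (u 0)" "G \<delta> (G t (u 0))"] by simp
  qed
  moreover have "((\<lambda>\<delta>. Xnorm p (\<lambda>x. G \<delta> (G t (u 0)) x - G t (u 0) x) + Xnorm p (\<lambda>x. G \<delta> (u t) x - u t x)) \<longlongrightarrow> 0) (at_right 0)"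
    by (intro tendsto_add_zero C0_semigroupD(4)[OF G] Gt ut)
  ultimately have "Xnorm p (\<lambda>x. G t (u 0) x - u t x) \<le> 0"
    by (intro tendsto_lowerbound[where F = "at_right (0::real)"]) auto
  then have "Xnorm p (\<lambda>x. G t (u 0) x - u t x) = 0" using Xnorm_nonneg antisym by blast
  then show ?thesis
    using Xnorm_eq_0_iff[OF p Xp_diff[OF p0 Gt ut]] by (simp add: ae_eq_def)
qed


subsection \<open>Density of smooth functions\<close>

text \<open>The derivative is carried along as a second argument. Since h is of class C^1 on the
  whole line and vanishes off (0,1), integer translates of h add up to a C^1 function, without
  compatibility conditions at the ends.\<close>

definition C1_supported :: "(real \<Rightarrow> complex^'n) \<Rightarrow> (real \<Rightarrow> complex^'n) \<Rightarrow> bool" where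
  "C1_supported h h' \<longleftrightarrow> (\<forall>x. (h has_vector_derivative h' x) (at x)) \<and> continuous_on UNIV h' \<and>
     (\<forall>x. x \<notin> {0<..<1} \<longrightarrow> h x = 0)"

text \<open>Squaring removes the corner of the positive part: at 0 the difference quotient is
  bounded by the modulus of y.\<close>

lemma has_real_derivative_pos_part_square:
  "((\<lambda>u. (max 0 u)\<^sup>2) has_real_derivative 2 * max 0 u) (at u)" for u :: real
proof -
  consider "u > 0" | "u < 0" | "u = 0" by linarith
  then show ?thesis
  proof cases
    case 1
    have "((\<lambda>u. u\<^sup>2) has_real_derivative 2 * max 0 u) (at u)"
      using 1 by (auto intro!: derivative_eq_intros)
    then show ?thesis
      by (rule has_field_derivative_transform_within_open[of _ _ _ "{0<..}"]) (use 1 in auto)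
  next
    case 2
    have "((\<lambda>u. 0) has_real_derivative 2 * max 0 u) (at u)"
      using 2 by (auto intro!: derivative_eq_intros)
    then show ?thesis
      by (rule has_field_derivative_transform_within_open[of _ _ _ "{..<0}"]) (use 2 in auto)
  next
    case 3
    have "((\<lambda>y. ((max 0 y)\<^sup>2 - (max 0 0)\<^sup>2) / (y - 0)) \<longlongrightarrow> 0) (at (0::real))"
    proof (rule Lim_null_comparison)
      show "\<forall>\<^sub>F y in at (0::real). norm (((max 0 y)\<^sup>2 - (max 0 0)\<^sup>2) / (y - 0)) \<le> \<bar>y\<bar>"
        by (intro always_eventually allI) (auto simp: max_def power2_eq_square)
      show "((\<lambda>y. \<bar>y\<bar>) \<longlongrightarrow> 0) (at (0::real))" by (auto intro!: tendsto_eq_intros)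
    qed
    then show ?thesis using 3 by (simp add: has_field_derivative_iff)
  qed
qed

text \<open>Cut-off functions of class C^1. The squared positive part of x (1 - x) vanishes outside
  (0,1) and lies strictly between 0 and 1 inside, so the n-th power tends to 0 inside and equals 1
  outside.\<close>

definition bump :: "nat \<Rightarrow> real \<Rightarrow> real" where
  "bump n x = 1 - (1 - (max 0 (x * (1 - x)))\<^sup>2) ^ n"

definition bump' :: "nat \<Rightarrow> real \<Rightarrow> real" where
  "bump' n x = real n * (1 - (max 0 (x * (1 - x)))\<^sup>2) ^ (n - 1) * (2 * max 0 (x * (1 - x)) * (1 - 2 * x))"

lemma bump_derivative: "(bump n has_real_derivative bump' n x) (at x)"
proof -
  have "((\<lambda>x. x * (1 - x)) has_real_derivative 1 - 2 * x) (at x)"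
    by (auto intro!: derivative_eq_intros)
  from DERIV_chain2[OF has_real_derivative_pos_part_square this]
  have "((\<lambda>x. (max 0 (x * (1 - x)))\<^sup>2) has_real_derivative 2 * max 0 (x * (1 - x)) * (1 - 2 * x)) (at x)" .
  from DERIV_power[OF DERIV_diff[OF DERIV_const this], of 1 n]
  have "((\<lambda>x. (1 - (max 0 (x * (1 - x)))\<^sup>2) ^ n) has_real_derivative - bump' n x) (at x)"
    by (simp add: bump'_def mult.assoc mult.commute mult.left_commute)
  from DERIV_diff[OF DERIV_const this, of 1]
  show ?thesis by (simp add: bump_def[abs_def])
qed

lemma continuous_bump': "continuous_on UNIV (bump' n)"
  unfolding bump'_def by (intro continuous_intros)

lemma pos_part_outside: "x \<notin> {0<..<1} \<Longrightarrow> max 0 (x * (1 - x)) = (0::real)"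
  by (auto simp: max_def mult_le_0_iff not_less zero_le_mult_iff)

lemma pos_part_inside:
  assumes "x \<in> {0<..<1}" shows "0 < max 0 (x * (1 - x))" "max 0 (x * (1 - x)) < (1::real)"
  using assms mult_strict_mono[of x 1 "1 - x" 1] by (auto simp: max_def)

lemma bump_range: assumes "x \<in> {0<..<1}" shows "0 \<le> bump n x" "bump n x \<le> 1"
proof -
  let ?w = "max 0 (x * (1 - x))"
  have "?w\<^sup>2 \<le> 1" using pos_part_inside[OF assms] by (simp add: power_le_one)
  then have "0 \<le> 1 - ?w\<^sup>2" "1 - ?w\<^sup>2 \<le> 1" by simp_all
  then show "0 \<le> bump n x" "bump n x \<le> 1"
    unfolding bump_def by (simp_all add: power_le_one)
qed

lemma bump_tendsto: assumes "x \<in> {0<..<1}" shows "(\<lambda>n. bump n x) \<longlonglongrightarrow> 1"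
proof -
  define w where "w = max 0 (x * (1 - x))"
  have "0 < w" "w < 1" unfolding w_def by (rule pos_part_inside[OF assms])+
  then have "0 < w\<^sup>2" "w\<^sup>2 < 1" by (simp_all add: power_less_one_iff)
  then have "norm (1 - w\<^sup>2) < 1" by simp
  then have "(\<lambda>n. 1 - (1 - w\<^sup>2) ^ n) \<longlonglongrightarrow> 1 - 0"
    by (intro tendsto_intros LIMSEQ_power_zero)
  then show ?thesis by (simp add: bump_def w_def)
qed

lemma C1_supported_bump:
  fixes q q' :: "real \<Rightarrow> complex^'n"
  assumes "\<And>x. (q has_vector_derivative q' x) (at x)" "continuous_on UNIV q'"
  shows "C1_supported (\<lambda>x. bump n x *\<^sub>R q x) (\<lambda>x. bump n x *\<^sub>R q' x + bump' n x *\<^sub>R q x)"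
  unfolding C1_supported_def
proof (intro conjI allI impI)
  fix x
  show "((\<lambda>x. bump n x *\<^sub>R q x) has_vector_derivative bump n x *\<^sub>R q' x + bump' n x *\<^sub>R q x) (at x)"
    by (rule has_vector_derivative_scaleR[OF bump_derivative assms(1)])
next
  have "continuous_on UNIV (bump n)"
    using bump_derivative DERIV_continuous_on by blast
  moreover have "continuous_on UNIV q"
    by (rule continuous_on_vector_derivative) (rule assms(1))
  ultimately show "continuous_on UNIV (\<lambda>x. bump n x *\<^sub>R q' x + bump' n x *\<^sub>R q x)"
    using assms(2) continuous_bump' by (intro continuous_intros)
next
  fix x :: real assume "x \<notin> {0<..<1}"
  then show "bump n x *\<^sub>R q x = 0"
    by (simp add: bump_def pos_part_outside)
qed

lemma Xnorm_tendsto_0: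
  fixes s :: "nat \<Rightarrow> real \<Rightarrow> complex^'n"
  assumes p: "1 \<le> p" and s: "\<And>k. s k \<in> borel_measurable I01"
    and lim: "AE x in I01. (\<lambda>k. s k x) \<longlonglongrightarrow> 0"
    and w: "integrable I01 w" and dom: "\<And>k. AE x in I01. psum p (s k x) \<le> w x"
  shows "(\<lambda>k. Xnorm p (s k)) \<longlonglongrightarrow> 0"
proof -
  have ps: "(\<lambda>k. psum p (s k x)) \<longlonglongrightarrow> 0" if "(\<lambda>k. s k x) \<longlonglongrightarrow> 0" for x
  proof (rule tendsto_sandwich[OF _ _ tendsto_const])
    show "\<forall>\<^sub>F k in sequentially. psum p (s k x) \<le> CARD('n) * norm (s k x) powr p"
      using p by (intro always_eventually allI psum_le_norm) simp
    have "(\<lambda>k. norm (s k x) powr p) \<longlonglongrightarrow> 0"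
      using p tendsto_norm_zero[OF that] by (intro tendsto_zero_powrI[where b = p]) auto
    then show "(\<lambda>k. CARD('n) * norm (s k x) powr p) \<longlonglongrightarrow> 0"
      by (rule tendsto_mult_right_zero)
  qed simp
  have "(\<lambda>k. LINT x|I01. psum p (s k x)) \<longlonglongrightarrow> (LINT x|I01. 0 :: real)"
  proof (rule integral_dominated_convergence[OF _ _ w])
    show "AE x in I01. (\<lambda>k. psum p (s k x)) \<longlonglongrightarrow> 0"
      using lim by eventually_elim (rule ps)
    show "AE x in I01. norm (psum p (s k x)) \<le> w x" for k
      using dom[of k] by eventually_elim simp
  qed (use s in auto)
  then have "(\<lambda>k. (LINT x|I01. psum p (s k x)) powr (1 / p)) \<longlonglongrightarrow> 0"
    using p by (intro tendsto_zero_powrI[where b = "1 / p"]) (auto simp: integral_nonneg_AE)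
  then show ?thesis by (simp add: Xnorm_psum)
qed

lemma Xp_bounded_approx:
  fixes f :: "real \<Rightarrow> complex^'n"
  assumes p: "1 \<le> p" and f: "f \<in> Xp p" and e: "0 < e"
  obtains g K where "g \<in> Xp p" "0 < K" "\<And>x. norm (g x) \<le> K" "Xnorm p (\<lambda>x. f x - g x) < e"
proof -
  define g where "g k x = (if norm (f x) \<le> real k then f x else 0)" for k :: nat and x
  have [measurable]: "f \<in> borel_measurable I01" using XpD(1)[OF f] .
  have gm: "g k \<in> borel_measurable I01" for k unfolding g_def by measurable
  have gX: "g k \<in> Xp p" for k
    by (rule Xp_dominated[OF gm XpD(2)[OF f]]) (auto simp: g_def psum_eq_0_iff[THEN iffD2])
  have lim: "(\<lambda>k. Xnorm p (\<lambda>x. f x - g k x)) \<longlonglongrightarrow> 0"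
  proof (rule Xnorm_tendsto_0[OF p _ _ XpD(2)[OF f]])
    show "(\<lambda>x. f x - g k x) \<in> borel_measurable I01" for k using gm by measurable
    show "AE x in I01. (\<lambda>k. f x - g k x) \<longlonglongrightarrow> 0"
    proof (intro AE_I2 tendsto_eventually)
      fix x
      obtain N :: nat where "norm (f x) \<le> real N" using real_arch_simple by blast
      then show "\<forall>\<^sub>F k in sequentially. f x - g k x = 0"
        by (intro eventually_sequentiallyI[of N]) (auto simp: g_def)
    qed
    show "AE x in I01. psum p (f x - g k x) \<le> psum p (f x)" for k
      by (intro AE_I2) (auto simp: g_def psum_eq_0_iff[THEN iffD2])
  qed
  obtain k where k: "Xnorm p (\<lambda>x. f x - g k x) < e"
    using order_tendstoD(2)[OF lim e] by (auto simp: eventually_sequentially)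
  show ?thesis
  proof (rule that[OF gX _ _ k])
    \<comment> \<open>The bound must be positive, also for k = 0.\<close>
    show "norm (g k x) \<le> real k + 1" for x by (simp add: g_def)
  qed simp
qed

text \<open>A bounded g is the almost everywhere limit of continuous functions. These are made
  uniformly bounded, replaced by polynomials to gain smoothness, and multiplied by cut-offs;
  dominated convergence then applies with a constant majorant.\<close>

lemma C1_supported_dense:
  fixes f :: "real \<Rightarrow> complex^'n"
  assumes p: "1 \<le> p" and f: "f \<in> Xp p" and e: "0 < e"
  obtains h h' where "C1_supported h h'" "h \<in> Xp p" "Xnorm p (\<lambda>x. f x - h x) < e"
proof -
  obtain g K where g: "g \<in> Xp p" and K: "0 < K" "\<And>x. norm (g x) \<le> K"
    and fg: "Xnorm p (\<lambda>x. f x - g x) < e / 2"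
    by (rule Xp_bounded_approx[OF p f half_gt_zero[OF e]]) (rule that)
  have "g measurable_on {0<..<1}"
    using XpD(1)[OF g] by (simp add: measurable_on_iff_borel_measurable)
  then obtain N c where N: "negligible N" and c: "\<And>n. continuous_on UNIV (c n)"
    and lim: "\<And>x. x \<notin> N \<Longrightarrow> (\<lambda>n. c n x) \<longlonglongrightarrow> (if x \<in> {0<..<1} then g x else 0)"
    unfolding measurable_on_def by blast
  \<comment> \<open>The radial retraction onto the ball of radius K. It is continuous and fixes the
    values of g, so the limit is unchanged while the approximants become bounded by K.\<close>
  define clamp where "clamp v = (1 / max 1 (norm v / K)) *\<^sub>R v" for v :: "complex^'n"
  have clamp_cont: "continuous_on UNIV clamp"
    unfolding clamp_def using K(1) by (intro continuous_intros) (auto simp: max_def)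
  have clamp_le: "norm (clamp v) \<le> K" for v
    using K(1) by (auto simp: clamp_def max_def field_simps)
  have clamp_id: "clamp v = v" if "norm v \<le> K" for v
    using that K(1) by (auto simp: clamp_def max_def field_simps)
  have "\<exists>q. polynomial_function q \<and> (\<forall>x\<in>{0..1}. norm (clamp (c n x) - q x) < 1 / real (Suc n))" for n
  proof (rule Stone_Weierstrass_polynomial_function)
    show "continuous_on {0..1::real} (\<lambda>x. clamp (c n x))"
      using continuous_on_compose2[OF clamp_cont c[of n]] by (auto intro: continuous_on_subset)
  qed auto
  then obtain q where q: "\<And>n. polynomial_function (q n)"
    "\<And>n x. x \<in> {0..1} \<Longrightarrow> norm (clamp (c n x) - q n x) < 1 / real (Suc n)"
    by metis
  have "\<exists>q'. polynomial_function q' \<and> (\<forall>x. (q n has_vector_derivative q' x) (at x))" for n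
    by (rule has_vector_derivative_polynomial_function[OF q(1)]) blast
  then obtain q' where q': "\<And>n. polynomial_function (q' n)" "\<And>n x. (q n has_vector_derivative q' n x) (at x)"
    by metis
  define h where "h n x = bump n x *\<^sub>R q n x" for n x
  define h' where "h' n x = bump n x *\<^sub>R q' n x + bump' n x *\<^sub>R q n x" for n x
  have C1: "C1_supported (h n) (h' n)" for n
    unfolding h_def h'_def
    by (rule C1_supported_bump[OF q'(2)]) (simp add: q'(1) continuous_on_polymonial_function)
  have hb: "norm (h n x) \<le> K + 1" if x: "x \<in> {0<..<1}" for n x
  proof -
    have "norm (q n x) \<le> norm (clamp (c n x)) + norm (clamp (c n x) - q n x)"
      by (metis norm_minus_commute norm_triangle_sub)
    also have "\<dots> \<le> K + 1"
    proof (intro add_mono clamp_le)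
      have "1 / real (Suc n) \<le> 1" by simp
      then show "norm (clamp (c n x) - q n x) \<le> 1" using q(2)[of x n] x by (meson atLeastAtMost_iff greaterThanLessThan_iff less_imp_le order_trans)
    qed
    finally have "\<bar>bump n x\<bar> * norm (q n x) \<le> 1 * (K + 1)"
      using bump_range[OF x, of n] by (intro mult_mono) auto
    then show ?thesis by (simp add: h_def)
  qed
  have h_meas: "h n \<in> borel_measurable I01" for n
  proof -
    have "continuous_on UNIV (h n)"
      by (rule continuous_on_vector_derivative) (use C1[of n] in \<open>auto simp: C1_supported_def\<close>)
    then show ?thesis
      by (intro measurable_restrict_space1 measurable_completion) (simp add: borel_measurable_continuous_onI)
  qed
  have hX: "h n \<in> Xp p" for n using Xnorm_bounded(1)[OF p h_meas hb] .
  have fin: "finite_measure I01" by (intro finite_measureI) (simp add: emeasure_restrict_space)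
  have gh: "(\<lambda>n. Xnorm p (\<lambda>x. g x - h n x)) \<longlonglongrightarrow> 0"
  proof (rule Xnorm_tendsto_0[OF p])
    show "(\<lambda>x. g x - h n x) \<in> borel_measurable I01" for n
      using XpD(1)[OF g] h_meas[of n] by measurable
    have "AE x in I01. x \<notin> N"
    proof -
      have "AE x in lebesgue. x \<notin> N" using N by (simp add: negligible_iff_null_sets AE_not_in)
      then show ?thesis by (subst AE_restrict_space_iff) (auto elim: AE_mp)
    qed
    with AE_I01_mem show "AE x in I01. (\<lambda>n. g x - h n x) \<longlonglongrightarrow> 0"
    proof eventually_elim
      case (elim x)
      then have "(\<lambda>n. c n x) \<longlonglongrightarrow> g x" using lim[of x] by simp
      then have "(\<lambda>n. clamp (c n x)) \<longlonglongrightarrow> clamp (g x)"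
        using clamp_cont by (intro continuous_on_tendsto_compose[OF clamp_cont]) auto
      then have cl: "(\<lambda>n. clamp (c n x)) \<longlonglongrightarrow> g x" using clamp_id K(2) by simp
      have "(\<lambda>n. clamp (c n x) - q n x) \<longlonglongrightarrow> 0"
      proof (rule Lim_null_comparison)
        show "\<forall>\<^sub>F n in sequentially. norm (clamp (c n x) - q n x) \<le> inverse (real (Suc n))"
          using q(2)[of x] elim by (intro always_eventually allI) (auto simp: inverse_eq_divide intro: less_imp_le)
      qed (rule LIMSEQ_inverse_real_of_nat)
      from tendsto_diff[OF cl this] have "(\<lambda>n. q n x) \<longlonglongrightarrow> g x" by simp
      from tendsto_scaleR[OF bump_tendsto[OF elim(1)] this]
      have "(\<lambda>n. h n x) \<longlonglongrightarrow> g x" by (simp add: h_def)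
      from tendsto_diff[OF tendsto_const[of "g x"] this] show ?case by simp
    qed
    show "integrable I01 (\<lambda>x. CARD('n) * (K + (K + 1)) powr p)"
      using fin by (simp add: finite_measure.integrable_const)
    show "AE x in I01. psum p (g x - h n x) \<le> CARD('n) * (K + (K + 1)) powr p" for n
      using AE_I01_mem
    proof eventually_elim
      case (elim x)
      have "norm (g x - h n x) \<le> K + (K + 1)"
        using norm_triangle_le_diff[of "g x" "h n x" "K + (K + 1)"] K(2)[of x] hb[OF elim, of n] by simp
      then show ?case
        using p by (intro order_trans[OF psum_le_norm] mult_left_mono powr_mono2) auto
    qed
  qed
  obtain n where n: "Xnorm p (\<lambda>x. g x - h n x) < e / 2"
    using order_tendstoD(2)[OF gh half_gt_zero[OF e]] by (auto simp: eventually_sequentially)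
  show ?thesis
  proof (rule that[OF C1 hX])
    show "Xnorm p (\<lambda>x. f x - h n x) < e"
      using Xnorm_triangle_diff[OF p f g hX[of n]] fg n by simp
  qed
qed


subsection \<open>Classical solutions\<close>

text \<open>
  The shifted solution \<open>x \<mapsto> B\<^sup>n h(n - t + x)\<close> is the restriction to \<open>(0,1)\<close> of a translate of this
  function, of which only one summand is nonzero at each point of \<open>[-K,1]\<close>.
\<close>

definition flow :: "complex^'n^'n \<Rightarrow> nat \<Rightarrow> (real \<Rightarrow> complex^'n) \<Rightarrow> real \<Rightarrow> complex^'n" where
  "flow B K h y = (\<Sum>n\<le>K. mat_pow B n *v h (y + real n))"

lemma bounded_linear_matrix_vector: "bounded_linear (\<lambda>v. A *v (v :: complex^'n))"
  by (simp add: linear_linear matrix_vector_mul_linear)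

lemma flow_has_vector_derivative:
  assumes "C1_supported h h'"
  shows "(flow B K h has_vector_derivative flow B K h' y) (at y)"
  unfolding flow_def[abs_def]
proof (rule has_vector_derivative_sum)
  fix n
  have "((\<lambda>y. y + real n) has_vector_derivative 1) (at y)"
    by (auto intro!: derivative_eq_intros)
  from vector_diff_chain_at[OF this, of h "h' (y + real n)"]
  have "((\<lambda>y. h (y + real n)) has_vector_derivative h' (y + real n)) (at y)"
    using assms by (simp add: C1_supported_def o_def)
  from bounded_linear.has_vector_derivative[OF bounded_linear_matrix_vector this]
  show "((\<lambda>y. mat_pow B n *v h (y + real n)) has_vector_derivative mat_pow B n *v h' (y + real n)) (at y)" .
qed

lemma continuous_flow:
  assumes "continuous_on UNIV g" shows "continuous_on UNIV (flow B K g)"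
proof -
  have "continuous_on UNIV (\<lambda>y. g (y + real n))" for n
    by (rule continuous_on_compose2[OF assms]) (auto intro: continuous_intros)
  from bounded_linear.continuous_on[OF bounded_linear_matrix_vector this]
  show ?thesis unfolding flow_def[abs_def] by (intro continuous_on_sum)
qed

lemma C1_supported_continuous:
  assumes "C1_supported h h'" shows "continuous_on UNIV h" "continuous_on UNIV h'"
proof -
  show "continuous_on UNIV h"
    by (rule continuous_on_vector_derivative[where f' = h']) (use assms in \<open>auto simp: C1_supported_def\<close>)
qed (use assms in \<open>simp add: C1_supported_def\<close>)

lemma continuous_on_translate:
  fixes g :: "real \<Rightarrow> 'a::topological_space"
  assumes "continuous_on UNIV g"
  shows "continuous_on UNIV (\<lambda>x. g (x - s))" "continuous_on UNIV (\<lambda>x. g (c - x - s))"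
  by (rule continuous_on_compose2[OF assms]; (intro continuous_intros)?; simp)+

lemma flow_eq:
  assumes "\<And>x. x \<notin> {0<..<1} \<Longrightarrow> h x = 0" "0 < real m + y" "real m + y < 1" "m \<le> K"
  shows "flow B K h y = mat_pow B m *v h (real m + y)"
proof -
  have "h (y + real n) = 0" if "n \<noteq> m" for n
  proof (rule assms(1))
    consider "real n + 1 \<le> real m" | "real m + 1 \<le> real n" using \<open>n \<noteq> m\<close> by linarith
    then show "y + real n \<notin> {0<..<1}" using assms(2,3) by cases auto
  qed
  then have "flow B K h y = (\<Sum>n\<le>K. if n = m then mat_pow B m *v h (real m + y) else 0)"
    unfolding flow_def by (intro sum.cong) (auto simp: add.commute)
  then show ?thesis using assms(4) by simp
qed

lemma flow_boundary:
  assumes h: "\<And>x. x \<notin> {0<..<1} \<Longrightarrow> h x = 0" and s: "0 \<le> s" "s \<le> real K"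
  shows "flow B K h (- s) = B *v flow B K h (1 - s)"
proof -
  have "B *v flow B K h (1 - s) = (\<Sum>n\<le>K. mat_pow B (Suc n) *v h (- s + real (Suc n)))"
    unfolding flow_def vec.sum by (simp add: mat_pow_Suc_vec algebra_simps)
  also have "\<dots> = (\<Sum>n\<le>Suc K. mat_pow B n *v h (- s + real n)) - mat_pow B 0 *v h (- s + real 0)"
    by (simp add: sum.atMost_Suc_shift del: sum.atMost_Suc)
  also have "\<dots> = (\<Sum>n\<le>K. mat_pow B n *v h (- s + real n))"
    \<comment> \<open>Both end terms vanish: - s \<le> 0 for index 0, and K + 1 - s \<ge> 1 for
      index K + 1.\<close>
    using s by (simp add: h)
  finally show ?thesis by (simp add: flow_def)
qed

text \<open>The bound n \<le> t + 1 tells how many summands of \<open>flow\<close> suffice up to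
  time t.\<close>

lemma ex_shift:
  assumes "0 \<le> t" "x \<in> {0<..<1}" "x \<noteq> frac t"
  shows "\<exists>n::nat. 0 < real n - t + x \<and> real n - t + x < 1 \<and> real n \<le> t + 1"
proof -
  have t: "real (nat \<lfloor>t\<rfloor>) = t - frac t" using assms(1) by (simp add: frac_def)
  have fr: "0 \<le> frac t" "frac t < 1" by (simp_all add: frac_lt_1)
  show ?thesis
  proof (cases "x < frac t")
    case True
    then show ?thesis using t fr assms(2)
      by (intro exI[of _ "Suc (nat \<lfloor>t\<rfloor>)"]) (simp only: of_nat_Suc greaterThanLessThan_iff, linarith)
  next
    case False
    then show ?thesis using t fr assms(2,3)
      by (intro exI[of _ "nat \<lfloor>t\<rfloor>"]) (simp only: greaterThanLessThan_iff, linarith)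
  qed
qed

lemma shift_op_flow:
  assumes "\<And>x. x \<notin> {0<..<1} \<Longrightarrow> h x = 0" "0 \<le> s" "s + 1 \<le> real K"
  shows "shift_op (mat_pow B) s h =\<^sub>a\<^sub>e (\<lambda>x. flow B K h (x - s))"
  unfolding ae_eq_def using AE_I01_neq[of "frac s"] AE_I01_mem
proof eventually_elim
  case (elim x)
  from ex_shift[OF assms(2) elim(2,1)] obtain n :: nat
    where n: "0 < real n - s + x" "real n - s + x < 1" "real n \<le> s + 1"
    by blast
  have "shift_op (mat_pow B) s h x = mat_pow B n *v h (real n - s + x)"
    by (rule shift_op_apply[OF n(1,2)])
  also have "\<dots> = flow B K h (x - s)"
    using flow_eq[where h = h and m = n and y = "x - s" and K = K and B = B, OF assms(1)] n assms(3) by (simp add: algebra_simps)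
  finally show ?case .
qed

lemma continuous_Xp:
  fixes g :: "real \<Rightarrow> complex^'n"
  assumes "1 \<le> p" "continuous_on UNIV g" shows "g \<in> Xp p"
proof -
  have "compact (g ` {0..1})"
    by (intro compact_continuous_image continuous_on_subset[OF assms(2)]) auto
  then obtain C where "\<forall>v\<in>g ` {0..1}. norm v \<le> C" using compact_imp_bounded bounded_iff by metis
  moreover have "g \<in> borel_measurable I01"
    using assms(2) by (intro measurable_restrict_space1 measurable_completion) (simp add: borel_measurable_continuous_onI)
  ultimately show ?thesis by (intro Xnorm_bounded(1)[OF assms(1), of g C]) auto
qed

lemma continuous_reflect:
  assumes "continuous_on UNIV g" shows "continuous_on UNIV (reflect P g)"
  unfolding reflect_def
proof (rule continuous_on_vec_lambda)
  fix i
  have "continuous_on UNIV (\<lambda>x. g (1 - x))"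
    by (rule continuous_on_compose2[OF assms]) (auto intro: continuous_intros)
  then show "continuous_on UNIV (\<lambda>x. if i \<in> P then g x $ i else g (1 - x) $ i)"
    using assms by (cases "i \<in> P") (auto intro: continuous_on_component)
qed

lemma continuous_integral_I01:
  fixes g :: "real \<Rightarrow> complex"
  assumes "continuous_on {0..1} g"
  shows "integrable I01 g" "(LINT x|I01. g x) = integral {0..1} g"
proof -
  have "g absolutely_integrable_on {0..1}"
    using absolutely_integrable_continuous_real[OF assms] .
  then have "g absolutely_integrable_on {0<..<1}"
    by (rule set_integrable_subset) auto
  then show int: "integrable I01 g"
    by (simp add: set_integrable_def integrable_restrict_space)
  have "(LINT x|I01. g x) = integral {0<..<1} g"
    by (rule lebesgue_integral_eq_integral[OF int]) simp
  then show "(LINT x|I01. g x) = integral {0..1} g" by (simp add: integral_open_interval_real)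
qed

text \<open>Integration by parts; the boundary terms drop out because test functions vanish at 0 and
  1.\<close>

lemma weak_derivativeI:
  fixes f f' :: "real \<Rightarrow> complex^'n"
  assumes f: "\<And>i x. ((\<lambda>x. f x $ i) has_vector_derivative f' x $ i) (at x)" and f': "continuous_on UNIV f'"
  shows "weak_derivative f f'"
  unfolding weak_derivative_def
proof (intro allI impI)
  fix \<phi> :: "real \<Rightarrow> real" and i
  assume "test_function \<phi>"
  then obtain D a b where D: "\<And>x. (\<phi> has_vector_derivative D x) (at x)" "continuous_on UNIV D"
    and ab: "0 < a" "b < 1" "\<And>x. x \<notin> {a..b} \<Longrightarrow> \<phi> x = 0"
    unfolding test_function_def C1_differentiable_on_def by blast
  have D': "deriv \<phi> x = D x" for x
    using D(1)[of x] by (intro DERIV_imp_deriv) (simp add: has_real_derivative_iff_has_vector_derivative)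
  have zero: "\<phi> 0 = 0" "\<phi> 1 = 0" using ab by auto
  have c: "continuous_on UNIV \<phi>" "continuous_on UNIV (\<lambda>x. f x $ i)"
    by (rule continuous_on_vector_derivative, rule D(1), rule continuous_on_vector_derivative, rule f)
  have ci: "continuous_on {0..1} (\<lambda>x. f x $ i * of_real (D x))" "continuous_on {0..1} (\<lambda>x. f' x $ i * of_real (\<phi> x))"
    by (rule continuous_on_subset[of UNIV], intro continuous_on_mult continuous_on_of_real
        continuous_on_component c f' D(2), simp)+
  have "((\<lambda>x. f x $ i * of_real (\<phi> x)) has_vector_derivative (f x $ i * of_real (D x) + f' x $ i * of_real (\<phi> x))) (at x)" for x
    using has_vector_derivative_mult[OF f[of i x] has_vector_derivative_of_real[OF
        D(1)[of x, folded has_real_derivative_iff_has_vector_derivative]]] .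
  then have "((\<lambda>x. f x $ i * of_real (D x) + f' x $ i * of_real (\<phi> x)) has_integral
      f 1 $ i * of_real (\<phi> 1) - f 0 $ i * of_real (\<phi> 0)) {0..1}"
    by (intro fundamental_theorem_of_calculus) (auto intro: has_vector_derivative_at_within)
  then have "integral {0..1} (\<lambda>x. f x $ i * of_real (D x) + f' x $ i * of_real (\<phi> x)) = 0"
    by (simp add: zero integral_unique)
  then have "(LINT x|I01. f x $ i * of_real (D x)) + (LINT x|I01. f' x $ i * of_real (\<phi> x)) = 0"
    using ci by (simp add: continuous_integral_I01 integral_add integrable_continuous_real)
  then show "(LINT x|I01. f x $ i * of_real (deriv \<phi> x)) = - (LINT x|I01. f' x $ i * of_real (\<phi> x))"
    by (simp add: D' eq_neg_iff_add_eq_0)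
qed

lemma has_vector_derivative_nth:
  assumes "(g has_vector_derivative g') (at x)"
  shows "((\<lambda>x. (g x :: complex^'n) $ i) has_vector_derivative g' $ i) (at x)"
  by (rule bounded_linear.has_vector_derivative[OF bounded_linear_vec_nth assms])

text \<open>In reflected coordinates the operator is minus differentiation in every component, and
  the coupling of inflow and outflow becomes E (- s) = B E (1 - s) for the flow E.\<close>

lemma reflect_flow_A_graph:
  fixes B :: "complex^'n^'n"
  assumes p: "1 \<le> p" and h: "C1_supported h h'" and s: "0 \<le> s" "s \<le> real K"
  shows "(reflect P (\<lambda>x. flow B K h (x - s)), reflect P (\<lambda>x. - flow B K h' (x - s))) \<in> A_graph p P B"
proof -
  let ?E = "flow B K h" and ?E' = "flow B K h'"
  let ?f = "reflect P (\<lambda>x. ?E (x - s))"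
  \<comment> \<open>Reflection reverses the sign of the derivative outside P, and A reverses it on
    P. The two together give the uniform sign of the second entry of the pair.\<close>
  define f' where "f' x = (\<chi> i. if i \<in> P then ?E' (x - s) $ i else - ?E' (1 - x - s) $ i)" for x
  have h': "continuous_on UNIV h'" and h0: "\<And>x. x \<notin> {0<..<1} \<Longrightarrow> h x = 0"
    using h by (auto simp: C1_supported_def)
  have contE: "continuous_on UNIV (\<lambda>x. ?E (x - s))" "continuous_on UNIV (\<lambda>x. - ?E' (x - s))"
    "continuous_on UNIV (\<lambda>x. ?E' (x - s))" "continuous_on UNIV (\<lambda>x. ?E' (1 - x - s))"
    by (intro continuous_on_minus continuous_on_translate continuous_flow C1_supported_continuous[OF h])+
  have cf: "continuous_on UNIV ?f" by (rule continuous_reflect[OF contE(1)])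
  have fX: "?f \<in> Xp p" using continuous_Xp[OF p cf] .
  have gX: "reflect P (\<lambda>x. - ?E' (x - s)) \<in> Xp p"
    using continuous_Xp[OF p continuous_reflect[OF contE(2)]] .
  have cf': "continuous_on UNIV f'"
    unfolding f'_def
  proof (rule continuous_on_vec_lambda)
    fix i
    show "continuous_on UNIV (\<lambda>x. if i \<in> P then ?E' (x - s) $ i else - ?E' (1 - x - s) $ i)"
      using contE by (cases "i \<in> P") (auto intro: continuous_on_component continuous_on_minus)
  qed
  have f'X: "f' \<in> Xp p" using continuous_Xp[OF p cf'] .
  have weak: "weak_derivative ?f f'"
  proof (rule weak_derivativeI[OF _ cf'])
    fix i x
    show "((\<lambda>x. ?f x $ i) has_vector_derivative f' x $ i) (at x)"
    proof (cases "i \<in> P")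
      case True
      have "((\<lambda>x. x - s) has_vector_derivative 1) (at x)" by (auto intro!: derivative_eq_intros)
      from vector_diff_chain_at[OF this flow_has_vector_derivative[OF h]]
      have "((\<lambda>x. ?E (x - s)) has_vector_derivative ?E' (x - s)) (at x)" by (simp add: o_def)
      from has_vector_derivative_nth[OF this, of i]
      show ?thesis using True by (simp add: reflect_def f'_def)
    next
      case False
      have "((\<lambda>x. 1 - x - s) has_vector_derivative -1) (at x)" by (auto intro!: derivative_eq_intros)
      from vector_diff_chain_at[OF this flow_has_vector_derivative[OF h]]
      have "((\<lambda>x. ?E (1 - x - s)) has_vector_derivative - ?E' (1 - x - s)) (at x)" by (simp add: o_def)
      from has_vector_derivative_nth[OF this, of i]
      show ?thesis using False by (simp add: reflect_def f'_def)
    qed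
  qed
  have bdry: "(\<chi> i. if i \<in> P then ?f 0 $ i else ?f 1 $ i) = B *v (\<chi> i. if i \<in> P then ?f 1 $ i else ?f 0 $ i)"
  proof -
    have "(\<chi> i. if i \<in> P then ?f 0 $ i else ?f 1 $ i) = ?E (- s)"
      "(\<chi> i. if i \<in> P then ?f 1 $ i else ?f 0 $ i) = ?E (1 - s)"
      by (auto simp: vec_eq_iff reflect_def)
    then show ?thesis using flow_boundary[where h = h and B = B, OF h0 s] by simp
  qed
  have "continuous_representative ?f ?f"
    using cf by (auto simp: continuous_representative_def intro: continuous_on_subset)
  then have "?f \<in> A_dom p P B"
    unfolding A_dom_def W1p_def using fX f'X weak bdry by blast
  moreover have "reflect P (\<lambda>x. - ?E' (x - s)) = (\<lambda>x. \<chi> i. if i \<in> P then - (f' x $ i) else f' x $ i)"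
    by (auto simp: fun_eq_iff vec_eq_iff reflect_def f'_def)
  ultimately show ?thesis
    unfolding A_graph_def using gX f'X weak ae_eq_refl by auto
qed

lemma Xnorm_tendsto_uniform:
  fixes g :: "real \<Rightarrow> real \<Rightarrow> complex^'n"
  assumes p: "1 \<le> p" and meas: "\<And>r. g r \<in> borel_measurable I01"
    and small: "\<And>e. 0 < e \<Longrightarrow> \<forall>\<^sub>F r in F. \<forall>x\<in>{0<..<1}. norm (g r x) \<le> e"
  shows "((\<lambda>r. Xnorm p (g r)) \<longlongrightarrow> 0) F"
proof (rule tendstoI)
  fix e :: real assume e: "0 < e"
  let ?c = "real CARD('n) powr (1 / p)"
  have c: "0 < ?c" by simp
  with e have e': "0 < e / (2 * ?c)" by simp
  show "\<forall>\<^sub>F r in F. dist (Xnorm p (g r)) 0 < e"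
    using small[OF e']
  proof eventually_elim
    case (elim r)
    have "Xnorm p (g r) \<le> ?c * (e / (2 * ?c))"
      by (rule Xnorm_bounded(2)[OF p meas]) (use elim in blast)
    then show ?case using e c by simp
  qed
qed

text \<open>The mean value estimate bounds the error by the oscillation of the derivative over a
  step of length r < 1, so uniform continuity on [- s - 1, 1] suffices. The sign is plus because the
  time derivative of E (x - s) is - E' (x - s).\<close>

lemma flow_difference_quotient:
  fixes h :: "real \<Rightarrow> complex^'n"
  assumes p: "1 \<le> p" and h: "C1_supported h h'" and s: "0 \<le> s"
  shows "((\<lambda>r. Xnorm p (\<lambda>x. (1 / r) *\<^sub>R (flow B K h (x - (s + r)) - flow B K h (x - s)) + flow B K h' (x - s)))
    \<longlongrightarrow> 0) (at_right 0)"
proof (rule Xnorm_tendsto_uniform[OF p])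
  let ?E = "flow B K h" and ?E' = "flow B K h'"
  have cE: "continuous_on UNIV ?E" "continuous_on UNIV ?E'"
    by (intro continuous_flow C1_supported_continuous[OF h])+
  fix r :: real
  have "continuous_on UNIV (\<lambda>x. (1 / r) *\<^sub>R (?E (x - (s + r)) - ?E (x - s)) + ?E' (x - s))"
    by (intro continuous_on_add continuous_on_scaleR continuous_on_const continuous_on_diff continuous_on_translate cE)
  then show "(\<lambda>x. (1 / r) *\<^sub>R (?E (x - (s + r)) - ?E (x - s)) + ?E' (x - s)) \<in> borel_measurable I01"
    using XpD(1)[OF continuous_Xp[OF p]] by blast
next
  let ?E = "flow B K h" and ?E' = "flow B K h'"
  fix e :: real assume e: "0 < e"
  have cE': "continuous_on UNIV ?E'"
    by (intro continuous_flow C1_supported_continuous[OF h])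
  then have "uniformly_continuous_on {- s - 1..1} ?E'"
    by (intro compact_uniformly_continuous) (auto intro: continuous_on_subset)
  then obtain d where d: "0 < d" "\<And>x y. x \<in> {- s - 1..1} \<Longrightarrow> y \<in> {- s - 1..1} \<Longrightarrow> dist y x < d \<Longrightarrow> dist (?E' y) (?E' x) < e"
    using e unfolding uniformly_continuous_on_def by metis
  have "\<forall>\<^sub>F r in at_right (0::real). 0 < r \<and> r < min d 1"
    using d(1) unfolding eventually_at_right_field by (intro exI[of _ "min d 1"]) simp
  then show "\<forall>\<^sub>F r in at_right 0. \<forall>x\<in>{0<..<1}.
      norm ((1 / r) *\<^sub>R (?E (x - (s + r)) - ?E (x - s)) + ?E' (x - s)) \<le> e"
  proof (eventually_elim, intro ballI)
    fix r x :: real assume r: "0 < r \<and> r < min d 1" and x: "x \<in> {0<..<1}"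
    let ?a = "x - s" and ?b = "x - (s + r)"
    have "norm (?E ?b - ?E ?a - (?b - ?a) *\<^sub>R ?E' ?a) \<le> norm (?b - ?a) * e"
    proof (rule vector_differentiable_bound_linearization[where S = "{?b..?a}"])
      show "(?E has_vector_derivative ?E' y) (at y within {?b..?a})" for y
        by (rule has_vector_derivative_at_within[OF flow_has_vector_derivative[OF h]])
      show "norm (?E' y - ?E' ?a) \<le> e" if "y \<in> {?b..?a}" for y
        using d(2)[of ?a y] that r x s by (auto simp: dist_norm norm_minus_commute less_imp_le)
    qed (use r in \<open>auto simp: closed_segment_eq_real_ivl\<close>)
    then have le: "norm (?E ?b - ?E ?a + r *\<^sub>R ?E' ?a) \<le> r * e" using r by simp
    have "(1 / r) *\<^sub>R (?E ?b - ?E ?a) + ?E' ?a = (1 / r) *\<^sub>R (?E ?b - ?E ?a + r *\<^sub>R ?E' ?a)"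
      using r by (simp add: scaleR_add_right)
    then have "norm ((1 / r) *\<^sub>R (?E ?b - ?E ?a) + ?E' ?a) = (1 / r) * norm (?E ?b - ?E ?a + r *\<^sub>R ?E' ?a)"
      using r by simp
    also have "\<dots> \<le> (1 / r) * (r * e)" using r le by (intro mult_left_mono) auto
    finally show "norm ((1 / r) *\<^sub>R (?E ?b - ?E ?a) + ?E' ?a) \<le> e" using r by simp
  qed
qed

lemma flow_translate_continuous:
  fixes h :: "real \<Rightarrow> complex^'n"
  assumes p: "1 \<le> p" and h: "C1_supported h h'" and s: "s \<in> {0..t}"
  shows "((\<lambda>r. Xnorm p (\<lambda>x. flow B K h (x - r) - flow B K h (x - s))) \<longlongrightarrow> 0) (at s within {0..t})"
proof (rule Xnorm_tendsto_uniform[OF p])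
  let ?E = "flow B K h"
  have cE: "continuous_on UNIV ?E"
    by (intro continuous_flow C1_supported_continuous[OF h])
  {
    fix r :: real
    have "continuous_on UNIV (\<lambda>x. ?E (x - r) - ?E (x - s))"
      by (intro continuous_on_diff continuous_on_translate cE)
    then show "(\<lambda>x. ?E (x - r) - ?E (x - s)) \<in> borel_measurable I01"
      using XpD(1)[OF continuous_Xp[OF p]] by blast
  next
    fix e :: real assume e: "0 < e"
    have "uniformly_continuous_on {- t..1} ?E"
      using cE by (intro compact_uniformly_continuous) (auto intro: continuous_on_subset)
    then obtain d where d: "0 < d" "\<And>x y. x \<in> {- t..1} \<Longrightarrow> y \<in> {- t..1} \<Longrightarrow> dist y x < d \<Longrightarrow> dist (?E y) (?E x) < e"
      using e unfolding uniformly_continuous_on_def by metis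
    have "\<forall>\<^sub>F r in at s within {0..t}. r \<in> {0..t} \<and> dist r s < d"
      using d(1) unfolding eventually_at by blast
    then show "\<forall>\<^sub>F r in at s within {0..t}. \<forall>x\<in>{0<..<1}. norm (?E (x - r) - ?E (x - s)) \<le> e"
    proof (eventually_elim, intro ballI)
      fix r x :: real assume r: "r \<in> {0..t} \<and> dist r s < d" and x: "x \<in> {0<..<1}"
      then show "norm (?E (x - r) - ?E (x - s)) \<le> e"
        using d(2)[of "x - s" "x - r"] s by (auto simp: dist_norm norm_minus_commute less_imp_le)
    qed
  }
qed

lemma reflect_scaleR: "reflect P (\<lambda>x. c *\<^sub>R f x) = (\<lambda>x. c *\<^sub>R reflect P f x)"
  by (auto simp: reflect_def fun_eq_iff vec_eq_iff)

lemma reflect_minus: "reflect P (\<lambda>x. - f x) = (\<lambda>x. - reflect P f x)"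
  by (auto simp: reflect_def fun_eq_iff vec_eq_iff)

lemma semigroup_eq_shift_smooth:
  fixes h :: "real \<Rightarrow> complex^'n"
  assumes p: "1 \<le> p" and G: "C0_semigroup p G" and gen: "A_graph p P B \<subseteq> generator p G"
    and h: "C1_supported h h'" and t: "0 \<le> t"
  shows "G t (reflect P h) =\<^sub>a\<^sub>e refl_shift P (mat_pow B) t (reflect P h)"
proof -
  \<comment> \<open>One truncation that serves all times s \<le> t.\<close>
  define K where "K = nat \<lceil>t\<rceil> + 1"
  have K: "t + 1 \<le> real K" unfolding K_def by linarith
  let ?E = "flow B K h" and ?E' = "flow B K h'"
  define u where "u s = reflect P (\<lambda>x. ?E (x - s))" for s
  define v where "v s = reflect P (\<lambda>x. - ?E' (x - s))" for s
  have h0: "\<And>x. x \<notin> {0<..<1} \<Longrightarrow> h x = 0" using h by (auto simp: C1_supported_def)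
  have cE: "continuous_on UNIV ?E" "continuous_on UNIV ?E'"
    by (intro continuous_flow C1_supported_continuous[OF h])+
  have uX: "u s \<in> Xp p" for s
    unfolding u_def
    by (intro reflect_Xp continuous_Xp[OF p] continuous_on_translate cE)
  have u_flow: "reflect P (shift_op (mat_pow B) s h) =\<^sub>a\<^sub>e u s" if "0 \<le> s" "s \<le> t" for s
    unfolding u_def using shift_op_flow[where h = h and s = s and K = K and B = B, OF h0] that K by (intro reflect_ae) auto
  have "G t (u 0) =\<^sub>a\<^sub>e u t"
  proof (rule C0_semigroup_solution_unique[OF G p t, where v = v])
    show "u s \<in> Xp p" for s by (rule uX)
    show "(u s, v s) \<in> generator p G" if "0 \<le> s" "s < t" for s
      unfolding u_def v_def using reflect_flow_A_graph[OF p h, of s K P B] gen that K by auto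
    show "((\<lambda>r. Xnorm p (\<lambda>x. (1 / r) *\<^sub>R (u (s + r) x - u s x) - v s x)) \<longlongrightarrow> 0) (at_right 0)"
      if "0 \<le> s" "s < t" for s
    proof -
      have "Xnorm p (\<lambda>x. (1 / r) *\<^sub>R (u (s + r) x - u s x) - v s x) =
          Xnorm p (\<lambda>x. (1 / r) *\<^sub>R (?E (x - (s + r)) - ?E (x - s)) + ?E' (x - s))" for r
      proof -
        have "(\<lambda>x. (1 / r) *\<^sub>R (?E (x - (s + r)) - ?E (x - s)) + ?E' (x - s)) \<in> Xp p"
          by (intro continuous_Xp[OF p] continuous_on_add continuous_on_scaleR continuous_on_const
              continuous_on_diff continuous_on_translate cE)
        from Xnorm_reflect[OF this, of P] show ?thesis
          by (simp add: u_def v_def reflect_add reflect_scaleR reflect_diff reflect_minus)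
      qed
      then show ?thesis using flow_difference_quotient[OF p h that(1), of B K] by simp
    qed
    show "((\<lambda>r. Xnorm p (\<lambda>x. u r x - u s x)) \<longlongrightarrow> 0) (at s within {0..t})" if "s \<in> {0..t}" for s
    proof -
      have "Xnorm p (\<lambda>x. u r x - u s x) = Xnorm p (\<lambda>x. ?E (x - r) - ?E (x - s))" for r
      proof -
        have "(\<lambda>x. ?E (x - r) - ?E (x - s)) \<in> Xp p"
          by (intro continuous_Xp[OF p] continuous_on_diff continuous_on_translate cE)
        from Xnorm_reflect[OF this, of P] show ?thesis
          by (simp add: u_def reflect_diff)
      qed
      then show ?thesis using flow_translate_continuous[OF p h that, of B K] by simp
    qed
  qed
  moreover have "reflect P h =\<^sub>a\<^sub>e u 0"
  proof -
    have "shift_op (mat_pow B) 0 h =\<^sub>a\<^sub>e h"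
      unfolding ae_eq_def using AE_I01_mem
    proof eventually_elim
      case (elim x)
      then show ?case using shift_op_apply[of 0 0 x "mat_pow B" h] by simp
    qed
    from ae_eq_trans[OF ae_eq_sym[OF reflect_ae[OF this, of P]] u_flow] show ?thesis using t by simp
  qed
  then have "G t (reflect P h) =\<^sub>a\<^sub>e G t (u 0)"
    using reflect_Xp[OF continuous_Xp[OF p C1_supported_continuous(1)[OF h]]] uX
    by (intro bounded_operatorD(2)[OF C0_semigroupD(1)[OF G t]])
  ultimately show ?thesis
    using ae_eq_trans ae_eq_sym[OF u_flow[OF t order_refl]] unfolding refl_shift_def reflect_reflect by blast
qed

text \<open>Both sides are bounded operators that agree on a dense set; C + D + 1 absorbs the two
  norm bounds and is positive even if both are 0.\<close>

lemma semigroup_eq_shift: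
  fixes f :: "real \<Rightarrow> complex^'n"
  assumes p: "1 \<le> p" and G: "C0_semigroup p G" and gen: "A_graph p P B \<subseteq> generator p G"
    and t: "0 \<le> t" and f: "f \<in> Xp p"
  shows "G t f =\<^sub>a\<^sub>e refl_shift P (mat_pow B) t f"
proof -
  let ?T = "refl_shift P (mat_pow B) t"
  have bG: "bounded_operator p (G t)" using C0_semigroupD(1)[OF G t] .
  have bT: "bounded_operator p ?T" using refl_shift_bounded_operator[OF p t] .
  obtain C where C: "0 \<le> C" "\<And>f. f \<in> Xp p \<Longrightarrow> Xnorm p (G t f) \<le> C * Xnorm p f"
    by (rule bounded_operator_bound[OF bG]) (rule that)
  obtain D where D: "0 \<le> D" "\<And>f. f \<in> Xp p \<Longrightarrow> Xnorm p (?T f) \<le> D * Xnorm p f"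
    by (rule bounded_operator_bound[OF bT]) (rule that)
  have X: "G t f \<in> Xp p" "?T f \<in> Xp p" using bounded_operatorD(1)[OF _ f] bG bT by auto
  have "Xnorm p (\<lambda>x. G t f x - ?T f x) \<le> 0 + e" if e: "0 < e" for e
  proof -
    have e': "0 < e / (C + D + 1)" using e C(1) D(1) by simp
    obtain h h' where h: "C1_supported h h'" "h \<in> Xp p" "Xnorm p (\<lambda>x. reflect P f x - h x) < e / (C + D + 1)"
      by (rule C1_supported_dense[OF p reflect_Xp[OF f] e'])
    let ?g = "reflect P h"
    have g: "?g \<in> Xp p" using reflect_Xp[OF h(2)] .
    have "(\<lambda>x. f x - ?g x) = reflect P (\<lambda>x. reflect P f x - h x)"
      by (simp add: reflect_diff)
    then have fg: "Xnorm p (\<lambda>x. f x - ?g x) < e / (C + D + 1)"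
      using Xnorm_reflect[OF Xp_diff[OF _ reflect_Xp[OF f] h(2)], of P] p h(3) by simp
    have Xg: "G t ?g \<in> Xp p" "?T ?g \<in> Xp p" using bounded_operatorD(1)[OF _ g] bG bT by auto
    have "Xnorm p (\<lambda>x. G t f x - ?T f x) \<le> Xnorm p (\<lambda>x. G t f x - G t ?g x) + Xnorm p (\<lambda>x. G t ?g x - ?T f x)"
      by (rule Xnorm_triangle_diff[OF p X(1) Xg(1) X(2)])
    also have "Xnorm p (\<lambda>x. G t ?g x - ?T f x) = Xnorm p (\<lambda>x. ?T f x - ?T ?g x)"
    proof -
      have "Xnorm p (\<lambda>x. G t ?g x - ?T f x) = Xnorm p (\<lambda>x. ?T ?g x - ?T f x)"
        using p by (intro Xnorm_cong Xp_diff Xg X ae_eq_lift2[where F = "(-)"] ae_eq_refl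
            semigroup_eq_shift_smooth[OF p G gen h(1) t]) auto
      then show ?thesis by (simp add: Xnorm_diff_commute)
    qed
    also have "Xnorm p (\<lambda>x. G t f x - G t ?g x) \<le> C * Xnorm p (\<lambda>x. f x - ?g x)"
      by (rule bounded_operator_diff_le[OF bG p f g C(2)])
    also have "Xnorm p (\<lambda>x. ?T f x - ?T ?g x) \<le> D * Xnorm p (\<lambda>x. f x - ?g x)"
      by (rule bounded_operator_diff_le[OF bT p f g D(2)])
    also have "C * Xnorm p (\<lambda>x. f x - ?g x) + D * Xnorm p (\<lambda>x. f x - ?g x) \<le> (C + D + 1) * Xnorm p (\<lambda>x. f x - ?g x)"
      by (simp add: algebra_simps)
    also have "\<dots> \<le> (C + D + 1) * (e / (C + D + 1))"
      using fg C(1) D(1) by (intro mult_left_mono) auto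
    also have "\<dots> = e" using C(1) D(1) by simp
    finally show ?thesis by simp
  qed
  then have "Xnorm p (\<lambda>x. G t f x - ?T f x) \<le> 0" by (rule field_le_epsilon)
  then have "Xnorm p (\<lambda>x. G t f x - ?T f x) = 0" using Xnorm_nonneg[of p] by (metis antisym)
  then show ?thesis
    using Xnorm_eq_0_iff[OF p Xp_diff[OF _ X]] p by (simp add: ae_eq_def)
qed


subsection \<open>The spectral subspaces of \<open>X\<^sub>p\<close>\<close>

lemma Xp_matrix:
  assumes p: "1 \<le> p" and f: "f \<in> Xp p"
  shows "(\<lambda>x. A *v (f x :: complex^'n)) \<in> Xp p"
    and "Xnorm p (\<lambda>x. A *v f x) \<le> CARD('n) powr (1 / p) * matsum A * Xnorm p f"
proof -
  let ?C = "CARD('n) powr (1 / p) * matsum A"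
  have C: "?C powr p = CARD('n) * matsum A powr p" using p by (simp add: powr_mult powr_powr)
  show X: "(\<lambda>x. A *v f x) \<in> Xp p"
    by (rule Xp_dominated[where h = "\<lambda>x. CARD('n) * matsum A powr p * psum p (f x)"])
      (use XpD[OF f] in \<open>auto intro: psum_matrix_le p\<close>)
  show "Xnorm p (\<lambda>x. A *v f x) \<le> ?C * Xnorm p f"
    by (rule Xnorm_mono[OF p X f]) (simp_all add: C psum_matrix_le[OF p])
qed

text \<open>The functions whose reflection takes values in the fixed space of Q almost everywhere.
  Unlike the range of an operator, this is a pointwise equation, from which closedness and
  invariance can be read off.\<close>

definition fixed_space :: "real \<Rightarrow> 'n set \<Rightarrow> complex^'n^'n \<Rightarrow> (real \<Rightarrow> complex^'n) set" where
  "fixed_space p P Q = {g \<in> Xp p. reflect P g =\<^sub>a\<^sub>e (\<lambda>x. Q *v reflect P g x)}"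

lemma shift_op_0: "shift_op M 0 g =\<^sub>a\<^sub>e (\<lambda>x. M 0 *v g x)"
  unfolding ae_eq_def using AE_I01_mem
proof eventually_elim
  case (elim x)
  then show ?case using shift_op_apply[of 0 0 x M g] by simp
qed

text \<open>At time 0 the index n is 0 throughout (0,1), so the reflected operator is pointwise
  multiplication by Q; for idempotent Q its range is the set of fixed points.\<close>

lemma operator_range_refl_shift:
  assumes p: "1 \<le> p" and Q: "M 0 = Q" "Q ** Q = Q"
  shows "operator_range p (refl_shift P M 0) = fixed_space p P Q"
proof -
  have r: "reflect P (refl_shift P M 0 f) =\<^sub>a\<^sub>e (\<lambda>x. Q *v reflect P f x)" for f
    using shift_op_0[of M "reflect P f"] Q(1) by (simp add: refl_shift_def)
  show ?thesis
  proof (intro set_eqI iffI)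
    fix g assume "g \<in> operator_range p (refl_shift P M 0)"
    then obtain f where g: "g \<in> Xp p" "g =\<^sub>a\<^sub>e refl_shift P M 0 f" by (auto simp: operator_range_def)
    have gf: "reflect P g =\<^sub>a\<^sub>e (\<lambda>x. Q *v reflect P f x)"
      by (rule ae_eq_trans[OF reflect_ae[OF g(2)] r])
    have "(\<lambda>x. Q *v reflect P g x) =\<^sub>a\<^sub>e (\<lambda>x. Q *v (Q *v reflect P f x))"
      by (rule ae_eq_lift[OF gf])
    also have "(\<lambda>x. Q *v (Q *v reflect P f x)) = (\<lambda>x. Q *v reflect P f x)"
      by (simp add: matrix_vector_mul_assoc Q(2))
    finally have "reflect P g =\<^sub>a\<^sub>e (\<lambda>x. Q *v reflect P g x)"
      using ae_eq_trans[OF gf ae_eq_sym] by blast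
    then show "g \<in> fixed_space p P Q" using g(1) by (simp add: fixed_space_def)
  next
    fix g assume g: "g \<in> fixed_space p P Q"
    then have "reflect P g =\<^sub>a\<^sub>e reflect P (refl_shift P M 0 g)"
      using ae_eq_trans[OF _ ae_eq_sym[OF r]] by (auto simp: fixed_space_def)
    then show "g \<in> operator_range p (refl_shift P M 0)"
      using g by (auto simp: reflect_ae_iff operator_range_def fixed_space_def)
  qed
qed

lemma closed_subspace_fixed_space:
  fixes Q :: "complex^'n^'n"
  assumes p: "1 \<le> p"
  shows "closed_subspace p (fixed_space p P Q)"
  unfolding closed_subspace_def
proof (intro conjI ballI allI impI)
  show "fixed_space p P Q \<subseteq> Xp p" by (auto simp: fixed_space_def)
  show "(\<lambda>x. 0) \<in> fixed_space p P Q" by (simp add: fixed_space_def)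
next
  fix f g assume fg: "f \<in> fixed_space p P Q" "g \<in> fixed_space p P Q"
  have "(\<lambda>x. reflect P f x + reflect P g x) =\<^sub>a\<^sub>e (\<lambda>x. Q *v reflect P f x + Q *v reflect P g x)"
    by (rule ae_eq_lift2[where F = "(+)"]) (use fg in \<open>auto simp: fixed_space_def\<close>)
  then show "(\<lambda>x. f x + g x) \<in> fixed_space p P Q"
    using fg p by (simp add: fixed_space_def reflect_add matrix_vector_right_distrib Xp_add)
next
  fix c f assume f: "f \<in> fixed_space p P Q"
  have "(\<lambda>x. c *s reflect P f x) =\<^sub>a\<^sub>e (\<lambda>x. c *s (Q *v reflect P f x))"
    by (rule ae_eq_lift) (use f in \<open>auto simp: fixed_space_def\<close>)
  then show "(\<lambda>x. c *s f x) \<in> fixed_space p P Q"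
    using f by (simp add: fixed_space_def reflect_scale vec.scale Xp_scale)
next
  fix F :: "nat \<Rightarrow> real \<Rightarrow> complex^'n" and f
  assume F: "\<forall>k. F k \<in> fixed_space p P Q" and f: "f \<in> Xp p"
    and lim: "(\<lambda>k. Xnorm p (\<lambda>x. F k x - f x)) \<longlonglongrightarrow> 0"
  have FX: "F k \<in> Xp p" for k using F by (simp add: fixed_space_def)
  \<comment> \<open>This matrix annihilates the reflections of all F k, so its value on f is
    controlled by the distance from F k to f.\<close>
  let ?D = "mat 1 - Q"
  define C where "C = CARD('n) powr (1 / p) * matsum ?D"
  have DX: "(\<lambda>x. ?D *v reflect P f x) \<in> Xp p" by (intro Xp_matrix p reflect_Xp f)
  have "Xnorm p (\<lambda>x. ?D *v reflect P f x) \<le> C * Xnorm p (\<lambda>x. F k x - f x)" for k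
  proof -
    have d: "(\<lambda>x. f x - F k x) \<in> Xp p" using p by (intro Xp_diff f FX) simp
    have "reflect P (F k) =\<^sub>a\<^sub>e (\<lambda>x. Q *v reflect P (F k) x)" using F by (simp add: fixed_space_def)
    then have "(\<lambda>x. ?D *v reflect P f x) =\<^sub>a\<^sub>e (\<lambda>x. ?D *v reflect P (\<lambda>x. f x - F k x) x)"
      unfolding ae_eq_def
      by eventually_elim
        (simp add: reflect_diff matrix_vector_mult_diff_distrib matrix_vector_mult_diff_rdistrib)
    then have "Xnorm p (\<lambda>x. ?D *v reflect P f x) = Xnorm p (\<lambda>x. ?D *v reflect P (\<lambda>x. f x - F k x) x)"
      by (intro Xnorm_cong DX Xp_matrix p reflect_Xp d)
    also have "\<dots> \<le> C * Xnorm p (reflect P (\<lambda>x. f x - F k x))"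
      unfolding C_def by (intro Xp_matrix p reflect_Xp d)
    finally show ?thesis by (simp add: Xnorm_reflect[OF d] Xnorm_diff_commute[of p f])
  qed
  moreover have "(\<lambda>k. C * Xnorm p (\<lambda>x. F k x - f x)) \<longlonglongrightarrow> 0"
    using tendsto_mult_right_zero[OF lim] .
  ultimately have "Xnorm p (\<lambda>x. ?D *v reflect P f x) \<le> 0"
    by (intro tendsto_lowerbound[where F = sequentially]) auto
  then have "Xnorm p (\<lambda>x. ?D *v reflect P f x) = 0" using Xnorm_nonneg[of p] by (metis antisym)
  then have "(\<lambda>x. ?D *v reflect P f x) =\<^sub>a\<^sub>e (\<lambda>x. 0)" using Xnorm_eq_0_iff[OF p DX] by simp
  then have "reflect P f =\<^sub>a\<^sub>e (\<lambda>x. Q *v reflect P f x)"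
    unfolding ae_eq_def by eventually_elim (simp add: matrix_vector_mult_diff_rdistrib)
  then show "f \<in> fixed_space p P Q" using f by (simp add: fixed_space_def)
qed

lemma direct_sum_fixed_spaces:
  fixes Q1 Q2 :: "complex^'n^'n"
  assumes p: "1 \<le> p" and Q: "Q1 ** Q1 = Q1" "Q2 ** Q2 = Q2" "Q1 ** Q2 = 0" "Q1 + Q2 = mat 1"
  shows "direct_sum p (fixed_space p P Q1) (fixed_space p P Q2)"
  unfolding direct_sum_def
proof (intro conjI ballI closed_subspace_fixed_space p)
  fix f :: "real \<Rightarrow> complex^'n" assume f: "f \<in> Xp p"
  have mem: "reflect P (\<lambda>x. Q *v reflect P f x) \<in> fixed_space p P Q" if "Q ** Q = Q" for Q :: "complex^'n^'n"
    using that f p by (simp add: fixed_space_def reflect_Xp Xp_matrix matrix_vector_mul_assoc)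
  have "f = reflect P (\<lambda>x. (Q1 + Q2) *v reflect P f x)" by (simp add: Q(4))
  then have "f = (\<lambda>x. reflect P (\<lambda>x. Q1 *v reflect P f x) x + reflect P (\<lambda>x. Q2 *v reflect P f x) x)"
    unfolding matrix_vector_mult_add_rdistrib reflect_add by simp
  then show "\<exists>g\<in>fixed_space p P Q1. \<exists>h\<in>fixed_space p P Q2. f =\<^sub>a\<^sub>e (\<lambda>x. g x + h x)"
    using mem[OF Q(1)] mem[OF Q(2)] ae_eq_refl by metis
next
  fix f :: "real \<Rightarrow> complex^'n" assume "f \<in> fixed_space p P Q1 \<inter> fixed_space p P Q2"
  then have f1: "reflect P f =\<^sub>a\<^sub>e (\<lambda>x. Q1 *v reflect P f x)" and f2: "reflect P f =\<^sub>a\<^sub>e (\<lambda>x. Q2 *v reflect P f x)"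
    by (auto simp: fixed_space_def)
  have "(\<lambda>x. Q1 *v reflect P f x) =\<^sub>a\<^sub>e (\<lambda>x. Q1 *v (Q2 *v reflect P f x))" by (rule ae_eq_lift[OF f2])
  then have "reflect P f =\<^sub>a\<^sub>e (\<lambda>x. 0)"
    using ae_eq_trans[OF f1] by (simp add: matrix_vector_mul_assoc Q(3))
  then show "f =\<^sub>a\<^sub>e (\<lambda>x. 0)" using reflect_ae[of "reflect P f" "\<lambda>x. 0" P] by simp
qed

lemma shift_op_matrix: "shift_op M t (\<lambda>x. Q *v g x) = shift_op (\<lambda>n. M n ** Q) t g"
  by (simp add: shift_op_def Let_def matrix_vector_mul_assoc)

lemma shift_op_matrix_commute:
  assumes "\<And>n. M n ** Q = Q ** M n"
  shows "shift_op (\<lambda>n. M n ** Q) t g = (\<lambda>x. Q *v shift_op M t g x)"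
  by (simp add: shift_op_def Let_def matrix_vector_mul_assoc assms)

lemma refl_shift_on_fixed_space:
  assumes "0 \<le> t" "f \<in> fixed_space p P Q"
  shows "refl_shift P (\<lambda>n. M n ** Q) t f =\<^sub>a\<^sub>e refl_shift P M t f"
proof -
  have "shift_op M t (reflect P f) =\<^sub>a\<^sub>e shift_op M t (\<lambda>x. Q *v reflect P f x)"
    using assms by (intro shift_op_ae) (auto simp: fixed_space_def)
  then show ?thesis
    unfolding refl_shift_def shift_op_matrix by (rule reflect_ae[OF ae_eq_sym])
qed

text \<open>Stated for an arbitrary representative g, because the given semigroup agrees with the
  explicit shift only almost everywhere.\<close>

lemma fixed_space_invariant:
  assumes t: "0 \<le> t" and f: "f \<in> fixed_space p P Q" and Q: "\<And>n. M n ** Q = Q ** M n"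
    and g: "g \<in> Xp p" "g =\<^sub>a\<^sub>e refl_shift P M t f"
  shows "g \<in> fixed_space p P Q"
proof -
  have gs: "reflect P g =\<^sub>a\<^sub>e shift_op M t (reflect P f)"
    using reflect_ae[OF g(2), of P] by (simp add: refl_shift_def)
  have "g =\<^sub>a\<^sub>e refl_shift P (\<lambda>n. M n ** Q) t f"
    by (rule ae_eq_trans[OF g(2) ae_eq_sym[OF refl_shift_on_fixed_space[OF t f]]])
  from reflect_ae[OF this, of P]
  have "reflect P g =\<^sub>a\<^sub>e (\<lambda>x. Q *v shift_op M t (reflect P f) x)"
    unfolding refl_shift_def reflect_reflect shift_op_matrix_commute[where M = M, OF Q] .
  also have "(\<lambda>x. Q *v shift_op M t (reflect P f) x) =\<^sub>a\<^sub>e (\<lambda>x. Q *v reflect P g x)"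
    by (rule ae_eq_lift[OF ae_eq_sym[OF gs]])
  finally show ?thesis using g(1) by (simp add: fixed_space_def)
qed

subsection \<open>Decay of the complementary part\<close>

lemma matsum_tendsto_0:
  fixes M :: "nat \<Rightarrow> complex^'n^'n"
  assumes "\<And>v. (\<lambda>n. M n *v v) \<longlonglongrightarrow> 0"
  shows "(\<lambda>n. matsum (M n)) \<longlonglongrightarrow> 0"
proof -
  have "(\<lambda>n. norm (M n $ i $ l)) \<longlonglongrightarrow> 0" for i l
  proof -
    have "M n $ i $ l = (M n *v axis l 1) $ i" for n
      by (simp add: matrix_vector_mult_def axis_def if_distrib cong: if_cong)
    then show ?thesis
      using tendsto_norm_zero[OF tendsto_vec_nth[OF assms[of "axis l 1"], of i, simplified]] by simp
  qed
  then show ?thesis unfolding matsum_def by (intro tendsto_null_sum)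
qed

lemma operator_norm_le:
  fixes T :: "(real \<Rightarrow> complex^'n) \<Rightarrow> (real \<Rightarrow> complex^'n)"
  assumes "0 \<le> C" "\<And>f. f \<in> Xp p \<Longrightarrow> Xnorm p (T f) \<le> C * Xnorm p f"
  shows "operator_norm p T \<le> ennreal C"
  unfolding operator_norm_def
proof (rule SUP_least)
  fix f :: "real \<Rightarrow> complex^'n" assume f: "f \<in> {f \<in> Xp p. Xnorm p f \<le> 1}"
  then have "Xnorm p (T f) \<le> C * Xnorm p f" using assms(2) by blast
  also have "\<dots> \<le> C * 1" using f assms(1) by (intro mult_left_mono) auto
  finally show "ennreal (Xnorm p (T f)) \<le> ennreal C" by (simp add: ennreal_leI)
qed

text \<open>Only the norms of T are compared with those of the shift: T will be the difference of
  the semigroup and its first part, which equals a shift only up to null sets.\<close>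

lemma operator_norm_refl_shift_tendsto_0:
  fixes M :: "nat \<Rightarrow> complex^'n^'n"
  assumes p: "1 \<le> p" and M: "(\<lambda>n. matsum (M n)) \<longlonglongrightarrow> 0"
    and T: "\<And>t f. 0 \<le> t \<Longrightarrow> f \<in> Xp p \<Longrightarrow> Xnorm p (T t f) = Xnorm p (refl_shift P M t f)"
  shows "((\<lambda>t. operator_norm p (T t)) \<longlongrightarrow> 0) at_top"
proof -
  define c where "c t = CARD('n) powr (1 / p) * max (matsum (M (nat \<lfloor>t\<rfloor>))) (matsum (M (Suc (nat \<lfloor>t\<rfloor>))))" for t :: real
  have lim: "filterlim (\<lambda>t::real. nat \<lfloor>t\<rfloor>) sequentially at_top"
    unfolding filterlim_at_top
  proof
    fix N :: nat
    show "\<forall>\<^sub>F t in at_top. N \<le> nat \<lfloor>t::real\<rfloor>"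
      using eventually_ge_at_top[of "real N"] by eventually_elim (simp add: le_nat_floor)
  qed
  have "((\<lambda>t. max (matsum (M (nat \<lfloor>t\<rfloor>))) (matsum (M (Suc (nat \<lfloor>t\<rfloor>))))) \<longlongrightarrow> max 0 0) (at_top :: real filter)"
    by (rule tendsto_max[OF filterlim_compose[OF M lim] filterlim_compose[OF LIMSEQ_Suc[OF M] lim]])
  from tendsto_mult_left[OF this, of "CARD('n) powr (1 / p)"]
  have "(c \<longlongrightarrow> 0) at_top" by (simp add: c_def[abs_def])
  then have lim_c: "((\<lambda>t. ennreal (c t)) \<longlongrightarrow> 0) at_top"
    using tendsto_ennrealI[of c 0 at_top] by simp
  have le_c: "\<forall>\<^sub>F t in at_top. operator_norm p (T t) \<le> ennreal (c t)"
    using eventually_ge_at_top[of 0]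
  proof eventually_elim
    case (elim t)
    show ?case
    proof (rule operator_norm_le)
      show "0 \<le> c t" by (simp add: c_def le_max_iff_disj)
      show "Xnorm p (T t f) \<le> c t * Xnorm p f" if "f \<in> Xp p" for f
        unfolding T[OF elim that] c_def
        by (rule refl_shift_bound(2)[OF p elim that]) (auto simp: le_Suc_eq)
    qed
  qed
  show ?thesis by (rule tendsto_sandwich[OF _ le_c tendsto_const lim_c]) simp
qed

subsection \<open>Pointwise formulas\<close>

lemma G_part_component_plus:
  assumes "i \<in> P" "real n - 1 + x < t" "t < real n + x"
  shows "G_part P B lam J t f x $ i =
    (\<Sum>j\<in>J. (\<Sum>l\<in>P. spectral_term B (lam j) n $ i $ l * f (real n - t + x) $ l) +
      (\<Sum>l\<in>-P. spectral_term B (lam j) n $ i $ l * f (1 - real n + t - x) $ l))"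
proof -
  have n: "0 < real n - t + x" "real n - t + x < 1" using assms by auto
  have eq: "1 - (real n - t + x) = 1 - real n + t - x" by simp
  have "(spectral_term B (lam j) n *v reflect P f (real n - t + x)) $ i =
      (\<Sum>l\<in>P. spectral_term B (lam j) n $ i $ l * f (real n - t + x) $ l) +
      (\<Sum>l\<in>-P. spectral_term B (lam j) n $ i $ l * f (1 - real n + t - x) $ l)" for j
    unfolding matrix_vector_mult_def reflect_def
    by (simp add: eq if_distrib sum.If_cases cong: if_cong)
  then show ?thesis
    using assms(1) by (simp add: G_part_def S_part_def reflect_def[of P "\<lambda>x. _ x"] reflect_def[of P "S_part _ _ _ _ _"] the_shift[OF n])
qed

lemma G_part_component_minus:
  assumes "i \<in> - P" "real n - x < t" "t < real n + 1 - x"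
  shows "G_part P B lam J t f x $ i =
    (\<Sum>j\<in>J. (\<Sum>l\<in>P. spectral_term B (lam j) n $ i $ l * f (1 - t + real n - x) $ l) +
      (\<Sum>l\<in>-P. spectral_term B (lam j) n $ i $ l * f (t - real n + x) $ l))"
proof -
  have n: "0 < real n - t + (1 - x)" "real n - t + (1 - x) < 1" using assms by auto
  have eq: "real n - t + (1 - x) = 1 - t + real n - x" "1 - (1 - t + real n - x) = t - real n + x" by simp_all
  have "(spectral_term B (lam j) n *v reflect P f (1 - t + real n - x)) $ i =
      (\<Sum>l\<in>P. spectral_term B (lam j) n $ i $ l * f (1 - t + real n - x) $ l) +
      (\<Sum>l\<in>-P. spectral_term B (lam j) n $ i $ l * f (t - real n + x) $ l)" for j
    unfolding matrix_vector_mult_def reflect_def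
    by (simp add: eq if_distrib sum.If_cases cong: if_cong)
  moreover have "G_part P B lam J t f x $ i = S_part B lam J t (reflect P f) (1 - x) $ i"
    using assms(1) by (simp add: G_part_def reflect_def[of P "S_part _ _ _ _ _"])
  ultimately show ?thesis
    using the_shift[OF n] by (simp add: S_part_def eq)
qed

subsection \<open>Periodicity\<close>

lemma AE_I01_ex:
  assumes "AE x in I01. Q x" "0 \<le> a" "a < b" "b \<le> (1::real)"
  shows "\<exists>x\<in>{a<..<b}. Q x"
proof (rule ccontr)
  assume *: "\<not> (\<exists>x\<in>{a<..<b}. Q x)"
  have "AE x in lebesgue. x \<in> {0<..<1} \<longrightarrow> Q x"
    using assms(1) by (subst (asm) AE_restrict_space_iff) auto
  then obtain N where N: "{x \<in> space lebesgue. \<not> (x \<in> {0<..<1} \<longrightarrow> Q x)} \<subseteq> N" "N \<in> null_sets lebesgue"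
    by (auto simp: eventually_ae_filter)
  have "{a<..<b} \<subseteq> N" using N(1) * assms by auto
  then have "negligible {a<..<b}"
    using N(2) negligible_subset by (auto simp: negligible_iff_null_sets)
  then show False using open_not_negligible[of "{a<..<b}"] assms by auto
qed

lemma shift_op_add_period:
  assumes M: "\<And>n. M (n + d) = M n" and t: "0 \<le> t"
  shows "shift_op M (t + real d) g =\<^sub>a\<^sub>e shift_op M t g"
  unfolding ae_eq_def using AE_I01_neq[of "frac t"] AE_I01_mem
proof eventually_elim
  case (elim x)
  then obtain n :: nat where n: "0 < real n - t + x" "real n - t + x < 1"
    using ex_shift[OF t elim(2,1)] by blast
  then have n': "0 < real (n + d) - (t + real d) + x" "real (n + d) - (t + real d) + x < 1" by simp_all
  show ?case
    unfolding shift_op_apply[OF n] shift_op_apply[OF n'] M by simp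
qed

text \<open>The test function x v detects translations. With N = floor s, returning to the start
  gives \<mu>^N (x - frac s) = x for almost all x > frac s; subtracting the equations at two such
  points gives \<mu>^N = 1, and then frac s = 0.\<close>

lemma shift_op_return_time:
  assumes v: "v \<noteq> 0" and M: "\<And>n. M n *v v = \<mu> ^ n *s v" and s: "0 < s"
    and eq: "shift_op M s (\<lambda>x. complex_of_real x *s v) =\<^sub>a\<^sub>e shift_op M 0 (\<lambda>x. complex_of_real x *s v)"
  shows "\<exists>n. s = real n \<and> \<mu> ^ n = 1"
proof -
  define N where "N = nat \<lfloor>s\<rfloor>"
  have N: "real N = s - frac s" using s by (simp add: N_def frac_def)
  have fr: "0 \<le> frac s" "frac s < 1" by (simp_all add: frac_lt_1)
  let ?Q = "\<lambda>x. x \<in> {0<..<1} \<longrightarrow> x > frac s \<longrightarrow> \<mu> ^ N * complex_of_real (x - frac s) = complex_of_real x"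
  have Q: "AE x in I01. ?Q x"
    using eq unfolding ae_eq_def
  proof eventually_elim
    case (elim x)
    show ?case
    proof (intro impI)
      assume x: "x \<in> {0<..<1}" "x > frac s"
      have n: "0 < real N - s + x" "real N - s + x < 1" using N x fr unfolding greaterThanLessThan_iff by linarith+
      have n0: "0 < real 0 - 0 + x" "real 0 - 0 + x < 1" using x by auto
      have "shift_op M s (\<lambda>x. complex_of_real x *s v) x = complex_of_real (real N - s + x) *s (\<mu> ^ N *s v)"
        unfolding shift_op_apply[OF n] vec.scale M ..
      moreover have "shift_op M 0 (\<lambda>x. complex_of_real x *s v) x = complex_of_real x *s v"
        unfolding shift_op_apply[OF n0] vec.scale M by simp
      ultimately have "complex_of_real (real N - s + x) *s (\<mu> ^ N *s v) = complex_of_real x *s v"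
        using elim by (simp only:)
      then have "(complex_of_real (real N - s + x) * \<mu> ^ N) *s v = complex_of_real x *s v"
        by (simp only: vec.scale_scale)
      then have "complex_of_real (real N - s + x) * \<mu> ^ N = complex_of_real x"
        using v by (metis vec.scale_right_imp_eq)
      moreover have "real N - s + x = x - frac s" using N by simp
      ultimately show "\<mu> ^ N * complex_of_real (x - frac s) = complex_of_real x" by (simp only: mult.commute)
    qed
  qed
  \<comment> \<open>Points from the two halves of the interval (frac s, 1), so that they are
    distinct.\<close>
  obtain x y where xy: "x \<in> {frac s<..<(frac s + 1) / 2}" "?Q x" "y \<in> {(frac s + 1) / 2<..<1}" "?Q y"
    using AE_I01_ex[OF Q, of "frac s" "(frac s + 1) / 2"] AE_I01_ex[OF Q, of "(frac s + 1) / 2" 1] fr by auto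
  have x: "x \<in> {0<..<1}" "x > frac s" and y: "y \<in> {0<..<1}" "y > frac s" and "x < y"
    using xy(1,3) fr unfolding greaterThanLessThan_iff by linarith+
  have eqx: "\<mu> ^ N * complex_of_real (x - frac s) = complex_of_real x"
    and eqy: "\<mu> ^ N * complex_of_real (y - frac s) = complex_of_real y"
    using xy x y by blast+
  have "\<mu> ^ N * complex_of_real (y - x) = complex_of_real (y - x)"
    using eqx eqy by (simp add: algebra_simps)
  then have one: "\<mu> ^ N = 1" using \<open>x < y\<close> by simp
  then have "frac s = 0" using eqx by simp
  then show ?thesis using N one by (intro exI[of _ N]) simp
qed

text \<open>A cosine equal to 1 forces n / d to be an integer, and this integer is positive.\<close>

lemma cis_root_order:
  assumes "cis (2 * pi / real d) ^ n = 1" "0 < n" "0 < d"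
  shows "d \<le> n"
proof -
  have "cis (real n * (2 * pi / real d)) = 1" by (rule trans[OF Complex.DeMoivre[symmetric] assms(1)])
  then have "cos (real n * (2 * pi / real d)) = 1" by (metis cis.sel(1) one_complex.sel(1))
  then obtain k :: int where k: "real n * (2 * pi / real d) = of_int k * 2 * pi"
    by (auto simp: cos_one_2pi_int)
  then have "pi * real n = pi * (of_int k * real d)" using assms(3) by (simp add: field_simps)
  then have nk: "real n = of_int k * real d" by (metis mult_left_cancel pi_neq_zero)
  then have "0 < k" using assms(2,3) by (metis of_int_0_less_iff of_nat_0_less_iff zero_less_mult_pos2)
  then have "1 * real d \<le> of_int k * real d" by (intro mult_right_mono) auto
  then show ?thesis using nk by simp
qed


section \<open>Decomposition, decay and period of the given semigroup\<close>

theorem theorem4p13: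
  fixes p :: real
    and mp mm m d k :: nat
    and P :: "'n::finite set"
    and Breal :: "real ^ 'n ^ 'n"
    and B :: "complex ^ 'n ^ 'n"
    and lam :: "nat \<Rightarrow> complex"
    and G G1 G2 :: "real \<Rightarrow> (real \<Rightarrow> complex ^ 'n) \<Rightarrow> (real \<Rightarrow> complex ^ 'n)"
    and Z1 Z2 :: "(real \<Rightarrow> complex ^ 'n) set"
  assumes p: "1 \<le> p"
    and dims: "card P = mp" "card (- P) = mm" "mp + mm = 2 * m" "1 \<le> 2 * m"
    and B_def: "B = map_matrix complex_of_real Breal"
    and lam_inj: "inj_on lam {1..k}"
    and lam_spec: "lam ` {1..k} = eigenvalues B"
    and d_le: "d \<le> k"
    and semigroup: "C0_semigroup p G"
    and gen: "generator p G = A_graph p P B"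
    and small: "\<forall>j\<in>{d+1..k}. norm (lam j) < 1"
    and G1_def: "G1 = G_part P B lam {1..d}"
    and G2_def: "G2 = G_part P B lam {d+1..k}"
    and Z1_def: "Z1 = operator_range p (G1 0)"
    and Z2_def: "Z2 = operator_range p (G2 0)"
  shows
    "(\<forall>t\<ge>0. bounded_operator p (G1 t) \<and> bounded_operator p (G2 t)) \<and>
     direct_sum p Z1 Z2 \<and>
     (\<forall>t\<ge>0. (\<forall>f\<in>Z1. G t f \<in> Z1) \<and> (\<forall>f\<in>Z2. G t f \<in> Z2)) \<and>
     (\<forall>t\<ge>0. \<forall>f\<in>Z1. G1 t f =\<^sub>a\<^sub>e G t f) \<and>
     ((\<lambda>t. operator_norm p (\<lambda>f x. G t f x - G1 t f x)) \<longlongrightarrow> 0) at_top \<and>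
     (\<forall>t\<ge>0. \<forall>f\<in>Xp p. AE x in I01. \<forall>n::nat.
        (real n - 1 + x < t \<and> t < real n + x \<longrightarrow>
          (\<forall>i\<in>P. G1 t f x $ i =
            (\<Sum>j=1..d.
               (\<Sum>l\<in>P. spectral_term B (lam j) n $ i $ l * f (real n - t + x) $ l) +
               (\<Sum>l\<in>-P. spectral_term B (lam j) n $ i $ l * f (1 - real n + t - x) $ l)))) \<and>
        (real n - x < t \<and> t < real n + 1 - x \<longrightarrow>
          (\<forall>i\<in>-P. G1 t f x $ i =
            (\<Sum>j=1..d.
               (\<Sum>l\<in>P. spectral_term B (lam j) n $ i $ l * f (1 - t + real n - x) $ l) +
               (\<Sum>l\<in>-P. spectral_term B (lam j) n $ i $ l * f (t - real n + x) $ l))))) \<and>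
     (1 \<le> d \<and> (\<forall>j\<in>{1..d}. semisimple_eigenvalue B (lam j) \<and>
                              lam j = cis (2 * pi * (real j - 1) / real d)) \<longrightarrow>
       periodic_with_period p G1 (real d) \<and>
       (\<forall>t\<ge>0. \<forall>f\<in>Xp p. AE x in I01. \<forall>n::nat.
          (real n - 1 + x < t \<and> t < real n + x \<longrightarrow>
            (\<forall>i\<in>P. G1 t f x $ i =
              (\<Sum>j=1..d. cis (2 * pi * (real j - 1) * real n / real d) *
                ((\<Sum>l\<in>P. spectral_projection B (lam j) $ i $ l * f (real n - t + x) $ l) +
                 (\<Sum>l\<in>-P. spectral_projection B (lam j) $ i $ l * f (1 - real n + t - x) $ l))))) \<and>
          (real n - x < t \<and> t < real n + 1 - x \<longrightarrow>
            (\<forall>i\<in>-P. G1 t f x $ i =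
              (\<Sum>j=1..d. cis (2 * pi * (real j - 1) * real n / real d) *
                ((\<Sum>l\<in>P. spectral_projection B (lam j) $ i $ l * f (1 - t + real n - x) $ l) +
                 (\<Sum>l\<in>-P. spectral_projection B (lam j) $ i $ l * f (t - real n + x) $ l)))))))"
proof -
  let ?K = "{1..k}" and ?J1 = "{1..d}" and ?J2 = "{d+1..k}"
  define Q1 where "Q1 = spectral_sum B lam ?J1"
  define Q2 where "Q2 = spectral_sum B lam ?J2"
  have sub: "?J1 \<subseteq> ?K" "?J2 \<subseteq> ?K" using d_le by auto
  note mult = spectral_sum_mult[OF lam_inj finite_atLeastAtMost lam_spec]
  have QQ: "Q1 ** Q1 = Q1" "Q2 ** Q2 = Q2" "Q1 ** Q2 = 0"
    using mult[OF sub(1) sub(1)] mult[OF sub(2) sub(2)] mult[OF sub(1) sub(2)]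
    unfolding Q1_def Q2_def by auto
  have "?K = ?J1 \<union> ?J2" using d_le by auto
  then have "Q1 + Q2 = spectral_sum B lam ?K"
    unfolding Q1_def Q2_def spectral_sum_def by (simp only:) (subst sum.union_disjoint, auto)
  then have Qsum: "Q1 + Q2 = mat 1"
    using spectral_sum_UNIV[OF lam_inj finite_atLeastAtMost lam_spec] by simp
  have comm: "mat_pow B n ** Q1 = Q1 ** mat_pow B n" "mat_pow B n ** Q2 = Q2 ** mat_pow B n" for n
    unfolding Q1_def Q2_def by (rule mat_pow_spectral_sum_commute)+
  define M1 where "M1 n = mat_pow B n ** Q1" for n
  define M2 where "M2 n = mat_pow B n ** Q2" for n
  have G1: "G1 t = refl_shift P M1 t" and G2: "G2 t = refl_shift P M2 t" for t
    by (simp_all add: G1_def G2_def G_part_eq M1_def[abs_def] M2_def[abs_def] Q1_def Q2_def)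
  have Z: "Z1 = fixed_space p P Q1" "Z2 = fixed_space p P Q2"
    unfolding Z1_def Z2_def G1 G2 by (rule operator_range_refl_shift[OF p _ QQ(1)], simp add: M1_def,
        rule operator_range_refl_shift[OF p _ QQ(2)], simp add: M2_def)
  have G_eq: "G t f =\<^sub>a\<^sub>e refl_shift P (mat_pow B) t f" if "0 \<le> t" "f \<in> Xp p" for t f
    using semigroup_eq_shift[OF p semigroup _ that] gen by simp

  have bounded: "\<forall>t\<ge>0. bounded_operator p (G1 t) \<and> bounded_operator p (G2 t)"
    unfolding G1 G2 using refl_shift_bounded_operator[OF p] by blast
  have dsum: "direct_sum p Z1 Z2"
    unfolding Z by (rule direct_sum_fixed_spaces[OF p QQ Qsum])
  have invariant: "\<forall>t\<ge>0. (\<forall>f\<in>Z1. G t f \<in> Z1) \<and> (\<forall>f\<in>Z2. G t f \<in> Z2)"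
  proof (intro allI impI conjI ballI)
    fix t :: real and f assume t: "0 \<le> t"
    have "G t f \<in> fixed_space p P Q"
      if f: "f \<in> fixed_space p P Q" and Q: "\<And>n. mat_pow B n ** Q = Q ** mat_pow B n" for Q
    proof -
      have fX: "f \<in> Xp p" using f by (simp add: fixed_space_def)
      show ?thesis
        by (rule fixed_space_invariant[OF t f Q C0_semigroup_Xp[OF semigroup t fX] G_eq[OF t fX]])
    qed
    then show "f \<in> Z1 \<Longrightarrow> G t f \<in> Z1" "f \<in> Z2 \<Longrightarrow> G t f \<in> Z2"
      using comm unfolding Z by blast+
  qed
  have agree: "\<forall>t\<ge>0. \<forall>f\<in>Z1. G1 t f =\<^sub>a\<^sub>e G t f"
  proof (intro allI impI ballI)
    fix t :: real and f assume t: "0 \<le> t" and f: "f \<in> Z1"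
    have "f \<in> Xp p" using f by (simp add: Z fixed_space_def)
    then show "G1 t f =\<^sub>a\<^sub>e G t f"
      using ae_eq_trans[OF refl_shift_on_fixed_space[OF t, of f p P Q1 "mat_pow B"] ae_eq_sym[OF G_eq[OF t]]] f
      by (simp add: G1 Z M1_def[abs_def])
  qed
  have decay: "((\<lambda>t. operator_norm p (\<lambda>f x. G t f x - G1 t f x)) \<longlongrightarrow> 0) at_top"
  proof (rule operator_norm_refl_shift_tendsto_0[OF p])
    show "(\<lambda>n. matsum (M2 n)) \<longlonglongrightarrow> 0"
    proof (rule matsum_tendsto_0)
      show "(\<lambda>n. M2 n *v v) \<longlonglongrightarrow> 0" for v
        using mat_pow_spectral_sum_tendsto_0[OF small, of B v]
        by (simp add: M2_def Q2_def matrix_vector_mul_assoc)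
    qed
  next
    fix t :: real and f :: "real \<Rightarrow> complex^'n" assume t: "0 \<le> t" and f: "f \<in> Xp p"
    let ?g = "reflect P f"
    \<comment> \<open>Since Q1 + Q2 is the identity, B^n = M1 n + M2 n, so subtracting the first
      part leaves the shift with the decaying matrices M2.\<close>
    have "shift_op (mat_pow B) t ?g x = shift_op M1 t ?g x + shift_op M2 t ?g x" for x
    proof -
      have "mat_pow B n = mat_pow B n ** Q1 + mat_pow B n ** Q2" for n
        using Qsum by (metis matrix_add_ldistrib matrix_mul_rid)
      then have "mat_pow B n *v v = M1 n *v v + M2 n *v v" for n v
        unfolding M1_def M2_def by (metis matrix_vector_mult_add_rdistrib)
      then show ?thesis by (simp add: shift_op_def Let_def)
    qed
    then have split: "refl_shift P (mat_pow B) t f = (\<lambda>x. refl_shift P M1 t f x + refl_shift P M2 t f x)"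
      unfolding refl_shift_def reflect_add[symmetric] by presburger
    have eq: "(\<lambda>x. G t f x - G1 t f x) =\<^sub>a\<^sub>e refl_shift P M2 t f"
      using G_eq[OF t f] unfolding ae_eq_def G1 split by eventually_elim simp
    have b: "bounded_operator p (refl_shift P M t)" for M
      by (rule refl_shift_bounded_operator[OF p t])
    have "G1 t f \<in> Xp p" unfolding G1 using bounded_operatorD(1)[OF b f] .
    then show "Xnorm p (\<lambda>x. G t f x - G1 t f x) = Xnorm p (refl_shift P M2 t f)"
      using p bounded_operatorD(1)[OF b f]
      by (intro Xnorm_cong eq Xp_diff C0_semigroup_Xp[OF semigroup t f]) auto
  qed
  have formula_plus: "G1 t f x $ i =
      (\<Sum>j=1..d. (\<Sum>l\<in>P. spectral_term B (lam j) n $ i $ l * f (real n - t + x) $ l) +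
         (\<Sum>l\<in>-P. spectral_term B (lam j) n $ i $ l * f (1 - real n + t - x) $ l))"
    if "real n - 1 + x < t" "t < real n + x" "i \<in> P" for t f x i and n :: nat
    unfolding G1_def by (rule G_part_component_plus) (use that in auto)
  have formula_minus: "G1 t f x $ i =
      (\<Sum>j=1..d. (\<Sum>l\<in>P. spectral_term B (lam j) n $ i $ l * f (1 - t + real n - x) $ l) +
         (\<Sum>l\<in>-P. spectral_term B (lam j) n $ i $ l * f (t - real n + x) $ l))"
    if "real n - x < t" "t < real n + 1 - x" "i \<in> - P" for t f x i and n :: nat
    unfolding G1_def by (rule G_part_component_minus) (use that in auto)

  have periodic: "periodic_with_period p G1 (real d)"
    and ss_term: "\<And>j n i l. j \<in> ?J1 \<Longrightarrow> spectral_term B (lam j) n $ i $ l =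
      cis (2 * pi * (real j - 1) * real n / real d) * spectral_projection B (lam j) $ i $ l"
    if d: "1 \<le> d" and ss: "\<forall>j\<in>{1..d}. semisimple_eigenvalue B (lam j) \<and>
        lam j = cis (2 * pi * (real j - 1) / real d)"
  proof -
    have lam_pow: "lam j ^ n = cis (2 * pi * (real j - 1) * real n / real d)" if "j \<in> ?J1" for j n
    proof -
      have "lam j ^ n = cis (2 * pi * (real j - 1) / real d) ^ n" using ss that by simp
      also have "\<dots> = cis (real n * (2 * pi * (real j - 1) / real d))" by (rule Complex.DeMoivre)
      also have "real n * (2 * pi * (real j - 1) / real d) = 2 * pi * (real j - 1) * real n / real d" by simp
      finally show ?thesis .
    qed
    have sterm: "spectral_term B (lam j) n = mat (lam j ^ n) ** spectral_projection B (lam j)" if "j \<in> ?J1" for j n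
      using ss that by (intro semisimple_spectral_term) blast
    then show "spectral_term B (lam j) n $ i $ l =
        cis (2 * pi * (real j - 1) * real n / real d) * spectral_projection B (lam j) $ i $ l"
      if "j \<in> ?J1" for j n i l
      using that by (simp add: lam_pow matrix_matrix_mult_def mat_def if_distrib if_distribR cong: if_cong)
    have lam_d: "lam j ^ d = 1" if "j \<in> ?J1" for j
    proof -
      have "2 * pi * (real j - 1) * real d / real d = 2 * pi * real (j - 1)" using d that by (simp add: of_nat_diff)
      then show ?thesis using lam_pow[OF that, of d] cis_multiple_2pi[of "real (j - 1)"] by simp
    qed
    have M1_vec: "M1 n *v v = (\<Sum>j\<in>?J1. lam j ^ n *s (spectral_projection B (lam j) *v v))" for n v
    proof -
      have "M1 n *v v = (\<Sum>j\<in>?J1. spectral_term B (lam j) n *v v)"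
        by (simp add: M1_def Q1_def sum_spectral_term flip: matrix_vector_mul_assoc)
      also have "\<dots> = (\<Sum>j\<in>?J1. lam j ^ n *s (spectral_projection B (lam j) *v v))"
        by (intro sum.cong refl) (simp add: sterm mat_vec flip: matrix_vector_mul_assoc)
      finally show ?thesis .
    qed
    have M1_period: "M1 (n + d) = M1 n" for n
      by (simp add: matrix_eq M1_vec power_add lam_d)
    have "is_period p G1 (real d)"
      unfolding is_period_def G1 refl_shift_def
      using d shift_op_add_period[where M = M1 and d = d, OF M1_period] by (auto intro!: reflect_ae)
    moreover have "real d \<le> s" if s: "is_period p G1 s" for s
    proof -
      have s0: "0 < s" using s by (simp add: is_period_def)
      \<comment> \<open>Each eigenvector of an eigenvalue in the first group is a test vector: on it
        M1 n acts as lam j ^ n, so any period is an integer n with lam j ^ n = 1.\<close>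
      have root: "\<exists>n. s = real n \<and> lam j ^ n = 1" if j: "j \<in> ?J1" for j
      proof -
        have "lam j \<in> eigenvalues B" using j sub(1) lam_spec by blast
        then obtain v where v: "v \<in> eigenspace B (lam j)" "v \<noteq> 0" by (auto simp: eigenvalues_def)
        have vg: "v \<in> gen_eigenspace B (lam j)" using v(1) eigenspace_subset_gen by blast
        have proj: "spectral_projection B (lam i) *v v = (if i = j then v else 0)" if "i \<in> ?J1" for i
          using spectral_projection_on_gen[OF vg, of "lam i"] inj_onD[OF lam_inj, of i j] that j sub(1) by auto
        have M: "M1 n *v v = lam j ^ n *s v" for n
        proof -
          have "M1 n *v v = (\<Sum>i\<in>?J1. if i = j then lam j ^ n *s v else 0)"
            unfolding M1_vec by (intro sum.cong refl) (simp add: proj)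
          then show ?thesis using j by simp
        qed
        let ?g = "\<lambda>x. complex_of_real x *s v"
        have "continuous_on UNIV ?g"
        proof -
          have "?g = (\<lambda>x. x *\<^sub>R v)" by (simp add: fun_eq_iff vec_eq_iff) (simp add: scaleR_conv_of_real)
          then show ?thesis by (simp only:) (intro continuous_intros)
        qed
        then have "reflect P ?g \<in> Xp p" by (intro reflect_Xp continuous_Xp p)
        then have "G1 (0 + s) (reflect P ?g) =\<^sub>a\<^sub>e G1 0 (reflect P ?g)"
          using s unfolding is_period_def by blast
        then have "shift_op M1 s ?g =\<^sub>a\<^sub>e shift_op M1 0 ?g"
          by (simp add: G1 refl_shift_def reflect_ae_iff)
        then show ?thesis by (rule shift_op_return_time[OF v(2) M s0])
      qed
      show ?thesis
      \<comment> \<open>For d \<ge> 2 the eigenvalue with index 2 is a primitive root of unity of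
        order d and forces n \<ge> d. For d = 1 there is no index 2, but a period that is a positive
        integer is at least 1.\<close>
      proof (cases "d = 1")
        case True
        obtain n where "s = real n" using root[of 1] d by auto
        then show ?thesis using True s0 by simp
      next
        case False
        then have two: "2 \<in> ?J1" using d by simp
        then obtain n where n: "s = real n" "lam 2 ^ n = 1" using root by blast
        have "lam 2 = cis (2 * pi / real d)" using ss two by simp
        then have "d \<le> n" using n s0 d by (intro cis_root_order) auto
        then show ?thesis using n(1) by simp
      qed
    qed
    ultimately show "periodic_with_period p G1 (real d)" by (simp add: periodic_with_period_def)
  qed

  have factor: "(\<Sum>j=1..d. (\<Sum>l\<in>P. spectral_term B (lam j) n $ i $ l * a l) +
        (\<Sum>l\<in>-P. spectral_term B (lam j) n $ i $ l * b l)) =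
      (\<Sum>j=1..d. cis (2 * pi * (real j - 1) * real n / real d) *
        ((\<Sum>l\<in>P. spectral_projection B (lam j) $ i $ l * a l) +
         (\<Sum>l\<in>-P. spectral_projection B (lam j) $ i $ l * b l)))"
    if "1 \<le> d" "\<forall>j\<in>{1..d}. semisimple_eigenvalue B (lam j) \<and>
        lam j = cis (2 * pi * (real j - 1) / real d)" for n i a b
    using ss_term[OF that]
    by (intro sum.cong refl) (simp add: distrib_left sum_distrib_left mult.assoc)
  \<comment> \<open>The formulas for semisimple eigenvalues are the general ones followed by pulling
    the scalar lam j ^ n out of the block sums.\<close>
  note root_plus = formula_plus[THEN trans, OF _ _ _ factor] and root_minus = formula_minus[THEN trans, OF _ _ _ factor]
  show ?thesis
    by (intro conjI impI bounded dsum invariant agree decay; (elim conjE)?; (rule periodic; assumption)?;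
        intro allI impI ballI AE_I2 conjI; elim conjE;
        (rule formula_plus formula_minus root_plus root_minus; assumption))
qed

end
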